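(* Let $F$ be a global field, let $p$ be an odd prime with $p\neq\operatorname{char}F$, and assume $\mu_p\subset F$. Let $a,b,c,d\in F^\times$ be such that $K=F(\sqrt[p]{a},\sqrt[p]{b},\sqrt[p]{c},\sqrt[p]{d})$ is a $C_p^4$-extension of $F$, and assume $(a,b)_p=(c,d)_p$ in $\operatorname{Br}(F)[p]$. Let $x,y\in F^\times$ satisfy \[(a,b)_p=(x^{-1},b)_p=(x,y)_p=(c^{-1},y)_p=(c,d)_p,\] and let $f_1\in F(\sqrt[p]{b})^\times$, $f_2\in F(\sqrt[p]{by})^\times$, $f_3\in F(\sqrt[p]{xc})^\times$, $f_4\in F(\sqrt[p]{c})^\times$ satisfy \[N_b(f_1)=ax,\qquad N_{by}(f_2)=x^{-1},\qquad N_{xc}(f_3)=y^{-1},\qquad N_c(f_4)=yd.\] Assume that the six classes of $a,b,c,d,x,y$ in $F^\times/F^{\times p}$ are linearly independent over $\mathbb F_p$. Put \[M=F(\sqrt[p]{a},\sqrt[p]{b},\sqrt[p]{c},\sqrt[p]{d},\sqrt[p]{x},\sqrt[p]{y}),\qquad w=W_b(f_1)\,W_{by}(f_2)\,W_{xc}(f_3)\,W_c(f_4).\] Then one can choose $r\in F^\times$ such that $rw\notin M^{\times p}$, and for any such choice, putting $w'=rw$ and $\widetilde L=M(\sqrt[p]{w'})$, one has that $\widetilde L/F$ is Galois with \[\operatorname{Gal}(\widetilde L/F)\cong(H_{p^3}*H_{p^3})\times C_p^2.\] Moreover, if $A\cong C_p^2$ denotes the direct factor generated by the two auxiliary Kummer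 directions $x$ and $y$ (the subgroup generated by $\widetilde\sigma_x,\widetilde\sigma_y$ described in the context), then the fixed field $L=\widetilde L^A$ contains $K$ and satisfies \[\operatorname{Gal}(L/F)\cong H_{p^3}*H_{p^3}.\]
   Context: Fix a primitive $p$-th root of unity $\zeta\in F$. For $u,v\in F^\times$, $(u,v)_p$ denotes the class in $\operatorname{Br}(F)[p]$ (written additively) of the degree-$p$ symbol algebra generated by $i,j$ with $i^p=u$, $j^p=v$, $ji=\zeta ij$. A $C_p^4$-extension is a Galois extension with group $C_p^4$. For $u\in F^\times\setminus F^{\times p}$, $N_u$ denotes the norm from $F(\sqrt[p]{u})$ to $F$, $\rho_u$ denotes the generator of $\operatorname{Gal}(F(\sqrt[p]{u})/F)$ with $\rho_u(\sqrt[p]{u})=\zeta\sqrt[p]{u}$, and for $f\in F(\sqrt[p]{u})^\times$ \[W_u(f)=\prod_{i=0}^{p-2}\rho_u^i(f)^{p-1-i}.\] The fields $F(\sqrt[p]{b}),F(\sqrt[p]{by}),F(\sqrt[p]{xc}),F(\sqrt[p]{c})$ are regarded as subfields of $M$. Commutators are $[g,h]=g^{-1}h^{-1}gh$. $H_{p^3}$ is the Heisenberg group of order $p^3$ and exponent $p$. $H_{p^3}*H_{p^3}$ is the central product of two copies of $H_{p^3}$ obtained by identifying the centers with opposite orientation; equivalently it is the group of order $p^5$ with generators $s_a,s_b,s_c,s_d,\tau$ and relations: $s_a^p=s_b^p=s_c^p=s_d^p=\tau^p=1$; $\tau$ is central; $[s_a,s_b]=\tau$; $[s_c,s_d]=\tau^{-1}$;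 $[s_a,s_c]=[s_a,s_d]=[s_b,s_c]=[s_b,s_d]=1$. The auxiliary factor: let $\sigma_x$ (resp. $\sigma_y$) be the element of $\operatorname{Gal}(M/F)$ multiplying $\sqrt[p]{x}$ (resp. $\sqrt[p]{y}$) by $\zeta$ and fixing the other five chosen radicals among $\sqrt[p]{a},\sqrt[p]{b},\sqrt[p]{c},\sqrt[p]{d},\sqrt[p]{x},\sqrt[p]{y}$, and put $z=\sqrt[p]{w'}$. Then $\widetilde\sigma_x,\widetilde\sigma_y\in\operatorname{Gal}(\widetilde L/F)$ are the lifts of $\sigma_x,\sigma_y$ given by \[\widetilde\sigma_x(z)=\frac{1}{\sqrt[p]{y}\,f_3}\,z,\qquad \widetilde\sigma_y(z)=\frac{1}{\sqrt[p]{x}\,f_2}\,z,\] and $A=\langle\widetilde\sigma_x,\widetilde\sigma_y\rangle$. *)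

theory Defs
  imports "HOL-Algebra.Algebra" "HOL-Algebra.Algebraic_Closure_Type"
begin

text \<open>All fields are subfields of one fixed algebraically closed field, given as a type
  \<open>'a\<close> of class \<open>alg_closed_field\<close>; \<open>ring_of_type_algebra\<close> is that field as a record, so that
  the notions of HOL-Algebra (\<open>subfield\<close>, \<open>generate_field\<close>, \<open>finite_dimension\<close>, ...) apply.\<close>

definition field_ring :: "'a::field set \<Rightarrow> 'a ring" where
  "field_ring F = ring_of_type_algebra\<lparr>carrier := F\<rparr>"

definition adjoin :: "'a::field set \<Rightarrow> 'a set \<Rightarrow> 'a set" where
  "adjoin F S = generate_field ring_of_type_algebra (F \<union> S)"

text \<open>A global field is a finite extension of \<open>\<rat>\<close>, or of \<open>\<F>\<^sub>l(t)\<close> with \<open>t\<close> transcendental over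
  \<open>\<F>\<^sub>l\<close>. The field generated by the empty set is the prime field.\<close>

definition number_field :: "'a::field set \<Rightarrow> bool" where
  "number_field F \<longleftrightarrow> subfield F ring_of_type_algebra \<and> CHAR('a) = 0 \<and>
     ring.finite_dimension ring_of_type_algebra (generate_field ring_of_type_algebra {}) F"

definition global_function_field :: "'a::field set \<Rightarrow> bool" where
  "global_function_field F \<longleftrightarrow> subfield F ring_of_type_algebra \<and> CHAR('a) > 0 \<and>
     (\<exists>t\<in>F. ring.transcendental ring_of_type_algebra (generate_field ring_of_type_algebra {}) t \<and>
        ring.finite_dimension ring_of_type_algebra (generate_field ring_of_type_algebra {t}) F)"

definition global_field :: "'a::field set \<Rightarrow> bool" where
  "global_field F \<longleftrightarrow> number_field F \<or> global_function_field F"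

definition primitive_root_of_unity :: "nat \<Rightarrow> 'a::field \<Rightarrow> bool" where
  "primitive_root_of_unity n \<zeta> \<longleftrightarrow> \<zeta> ^ n = 1 \<and> (\<forall>k. 0 < k \<and> k < n \<longrightarrow> \<zeta> ^ k \<noteq> 1)"

definition power_units :: "nat \<Rightarrow> 'a::field set \<Rightarrow> 'a set" where
  "power_units p E = {m ^ p | m. m \<in> E - {0}}"

text \<open>Linear independence over \<open>\<F>\<^sub>p\<close> of the classes of the listed elements in the
  (multiplicatively written) space of units of \<open>F\<close> modulo \<open>p\<close>-th powers. Exponents, i.e. scalars
  in \<open>\<F>\<^sub>p\<close>, are represented by natural numbers.\<close>

definition independent_mod_powers :: "nat \<Rightarrow> 'a::field set \<Rightarrow> 'a list \<Rightarrow> bool" where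
  "independent_mod_powers p F us \<longleftrightarrow>
     (\<forall>e :: nat \<Rightarrow> nat. (\<Prod>i<length us. us ! i ^ e i) \<in> power_units p F \<longrightarrow>
        (\<forall>i<length us. p dvd e i))"


section \<open>Galois theory\<close>

text \<open>Automorphisms of \<open>E\<close> over \<open>F\<close>, as functions on \<open>'a\<close> that are \<open>undefined\<close> outside \<open>E\<close>;
  the product of \<open>g\<close> and \<open>h\<close> is \<open>g\<close> after \<open>h\<close>.\<close>

definition galois_group :: "'a::field set \<Rightarrow> 'a set \<Rightarrow> ('a \<Rightarrow> 'a) monoid" where
  "galois_group E F = (BijGroup E)\<lparr>carrier :=
     {\<sigma> \<in> Bij E. \<sigma> \<in> ring_hom (field_ring E) (field_ring E) \<and> (\<forall>x\<in>F. \<sigma> x = x)}\<rparr>"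

definition fixed_field :: "'a set \<Rightarrow> ('a \<Rightarrow> 'a) set \<Rightarrow> 'a set" where
  "fixed_field E A = {x \<in> E. \<forall>\<sigma>\<in>A. \<sigma> x = x}"

definition finite_galois :: "'a::field set \<Rightarrow> 'a set \<Rightarrow> bool" where
  "finite_galois E F \<longleftrightarrow>
     subfield F ring_of_type_algebra \<and> subfield E ring_of_type_algebra \<and> F \<subseteq> E \<and>
     ring.finite_dimension ring_of_type_algebra F E \<and>
     fixed_field E (carrier (galois_group E F)) = F"

text \<open>This is the norm only if \<open>E\<close> is a finite Galois extension of \<open>F\<close>.\<close>

definition field_norm :: "'a::field set \<Rightarrow> 'a set \<Rightarrow> 'a \<Rightarrow> 'a" where
  "field_norm E F f = (\<Prod>\<sigma>\<in>carrier (galois_group E F). \<sigma> f)"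

text \<open>In the following, \<open>r\<close> is the chosen \<open>p\<close>-th root of an element \<open>u\<close> of \<open>F\<close>, and \<open>\<zeta>\<close> is a primitive
  \<open>p\<close>-th root of unity in \<open>F\<close>. Neither \<open>adjoin F {r}\<close> nor \<open>rho F \<zeta> r\<close> depends on the choice of the
  root, since any other one is \<open>\<zeta> ^ k * r\<close> for some \<open>k\<close>.\<close>

definition rho :: "'a::field set \<Rightarrow> 'a \<Rightarrow> 'a \<Rightarrow> 'a \<Rightarrow> 'a" where
  "rho F \<zeta> r = (THE \<sigma>. \<sigma> \<in> carrier (galois_group (adjoin F {r}) F) \<and> \<sigma> r = \<zeta> * r)"

definition W_elem :: "'a::field set \<Rightarrow> 'a \<Rightarrow> nat \<Rightarrow> 'a \<Rightarrow> 'a \<Rightarrow> 'a" where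
  "W_elem F \<zeta> p r f = (\<Prod>i = 0..p - 2. ((rho F \<zeta> r ^^ i) f) ^ (p - 1 - i))"

definition radical_aut :: "'a::field set \<Rightarrow> 'a set \<Rightarrow> 'a \<Rightarrow> 'a \<Rightarrow> 'a set \<Rightarrow> ('a \<Rightarrow> 'a) \<Rightarrow> bool" where
  "radical_aut M F \<zeta> r S \<sigma> \<longleftrightarrow>
     \<sigma> \<in> carrier (galois_group M F) \<and> \<sigma> r = \<zeta> * r \<and> (\<forall>t\<in>S. \<sigma> t = t)"


section \<open>Brauer classes\<close>

text \<open>An associative unital algebra is a \<open>module\<close> record whose ring part need not be commutative
  (unlike in the library locale \<open>algebra\<close>).\<close>

definition assoc_algebra :: "('a, 'm) ring_scheme \<Rightarrow> ('a, 'b, 'n) module_scheme \<Rightarrow> bool" where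
  "assoc_algebra R A \<longleftrightarrow> module R A \<and> ring A \<and>
     (\<forall>c\<in>carrier R. \<forall>x\<in>carrier A. \<forall>y\<in>carrier A.
        c \<odot>\<^bsub>A\<^esub> (x \<otimes>\<^bsub>A\<^esub> y) = (c \<odot>\<^bsub>A\<^esub> x) \<otimes>\<^bsub>A\<^esub> y \<and>
        c \<odot>\<^bsub>A\<^esub> (x \<otimes>\<^bsub>A\<^esub> y) = x \<otimes>\<^bsub>A\<^esub> (c \<odot>\<^bsub>A\<^esub> y))"

definition scalars :: "('a, 'm) ring_scheme \<Rightarrow> ('a, 'b, 'n) module_scheme \<Rightarrow> 'b set" where
  "scalars R A = {c \<odot>\<^bsub>A\<^esub> \<one>\<^bsub>A\<^esub> | c. c \<in> carrier R}"

definition central_simple_algebra ::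
    "('a, 'm) ring_scheme \<Rightarrow> ('a, 'b, 'n) module_scheme \<Rightarrow> bool" where
  "central_simple_algebra R A \<longleftrightarrow> field R \<and> assoc_algebra R A \<and>
     ring.finite_dimension A (scalars R A) (carrier A) \<and>
     {x \<in> carrier A. \<forall>y\<in>carrier A. x \<otimes>\<^bsub>A\<^esub> y = y \<otimes>\<^bsub>A\<^esub> x} = scalars R A \<and>
     \<one>\<^bsub>A\<^esub> \<noteq> \<zero>\<^bsub>A\<^esub> \<and> (\<forall>I. ideal I A \<longrightarrow> I = {\<zero>\<^bsub>A\<^esub>} \<or> I = carrier A)"

definition algebra_isomorphic ::
    "('a, 'm) ring_scheme \<Rightarrow> ('a, 'b, 'n) module_scheme \<Rightarrow> ('a, 'c, 'k) module_scheme \<Rightarrow> bool" where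
  "algebra_isomorphic R A B \<longleftrightarrow>
     (\<exists>h \<in> ring_iso A B. \<forall>c\<in>carrier R. \<forall>x\<in>carrier A. h (c \<odot>\<^bsub>A\<^esub> x) = c \<odot>\<^bsub>B\<^esub> h x)"

definition matrix_algebra ::
    "nat \<Rightarrow> ('a, 'b, 'n) module_scheme \<Rightarrow> ('a, nat \<times> nat \<Rightarrow> 'b) module" where
  "matrix_algebra n A = (let I = {..<n} \<times> {..<n} in
     \<lparr>carrier = I \<rightarrow>\<^sub>E carrier A,
      monoid.mult = (\<lambda>f g. \<lambda>ij\<in>I. \<Oplus>\<^bsub>A\<^esub>k\<in>{..<n}. f (fst ij, k) \<otimes>\<^bsub>A\<^esub> g (k, snd ij)),
      monoid.one = (\<lambda>ij\<in>I. if fst ij = snd ij then \<one>\<^bsub>A\<^esub> else \<zero>\<^bsub>A\<^esub>),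
      ring.zero = (\<lambda>_\<in>I. \<zero>\<^bsub>A\<^esub>),
      ring.add = (\<lambda>f g. \<lambda>ij\<in>I. f ij \<oplus>\<^bsub>A\<^esub> g ij),
      module.smult = (\<lambda>c f. \<lambda>ij\<in>I. c \<odot>\<^bsub>A\<^esub> f ij)\<rparr>)"

definition brauer_equivalent ::
    "('a, 'm) ring_scheme \<Rightarrow> ('a, 'b, 'n) module_scheme \<Rightarrow> ('a, 'c, 'k) module_scheme \<Rightarrow> bool" where
  "brauer_equivalent R A B \<longleftrightarrow>
     (\<exists>m>0. \<exists>n>0. algebra_isomorphic R (matrix_algebra m A) (matrix_algebra n B))"

text \<open>Every finite-dimensional algebra over a subfield of \<open>'a\<close> is isomorphic to one whose carrier
  has elements of type \<open>nat \<times> nat \<Rightarrow> 'a\<close> (coordinate vectors), so this type suffices for the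
  representatives of a Brauer class.\<close>

definition brauer_class ::
    "('a, 'm) ring_scheme \<Rightarrow> ('a, nat \<times> nat \<Rightarrow> 'a) module \<Rightarrow> ('a, nat \<times> nat \<Rightarrow> 'a) module set" where
  "brauer_class R A = {B. central_simple_algebra R B \<and> brauer_equivalent R A B}"

text \<open>The symbol algebra generated by \<open>i, j\<close> with \<open>i\<^sup>p = u\<close>, \<open>j\<^sup>p = v\<close>, \<open>j i = \<zeta> i j\<close>. An element is the
  family of its coordinates \<open>f (k, l)\<close> on the basis \<open>i\<^sup>k j\<^sup>l\<close>, \<open>k, l < p\<close>, and
  \<open>(i\<^sup>k j\<^sup>l) (i\<^sup>m j\<^sup>n) = \<zeta>\<^bsup>l m\<^esup> i\<^bsup>k + m\<^esup> j\<^bsup>l + n\<^esup>\<close>.\<close>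

definition symbol_algebra ::
    "'a::field set \<Rightarrow> 'a \<Rightarrow> nat \<Rightarrow> 'a \<Rightarrow> 'a \<Rightarrow> ('a, nat \<times> nat \<Rightarrow> 'a) module" where
  "symbol_algebra F \<zeta> p u v = (let I = {..<p} \<times> {..<p} in
     \<lparr>carrier = I \<rightarrow>\<^sub>E F,
      monoid.mult = (\<lambda>f g. \<lambda>st\<in>I. \<Sum>(k, l)\<in>I. \<Sum>(m, n)\<in>I.
        if st = ((k + m) mod p, (l + n) mod p)
        then f (k, l) * g (m, n) * \<zeta> ^ (l * m) * u ^ ((k + m) div p) * v ^ ((l + n) div p)
        else 0),
      monoid.one = (\<lambda>kl\<in>I. if kl = (0, 0) then 1 else 0),
      ring.zero = (\<lambda>_\<in>I. 0),
      ring.add = (\<lambda>f g. \<lambda>kl\<in>I. f kl + g kl),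
      module.smult = (\<lambda>c f. \<lambda>kl\<in>I. c * f kl)\<rparr>)"

text \<open>The class \<open>(u, v)\<^sub>p\<close> in the Brauer group of \<open>F\<close>.\<close>

definition symbol_class ::
    "'a::field set \<Rightarrow> 'a \<Rightarrow> nat \<Rightarrow> 'a \<Rightarrow> 'a \<Rightarrow> ('a, nat \<times> nat \<Rightarrow> 'a) module set" where
  "symbol_class F \<zeta> p u v = brauer_class (field_ring F) (symbol_algebra F \<zeta> p u v)"


section \<open>Finite groups\<close>

definition elementary_abelian :: "nat \<Rightarrow> nat \<Rightarrow> (nat \<Rightarrow> int) monoid" where
  "elementary_abelian p n = product_group {..<n} (\<lambda>_. integer_mod_group p)"

text \<open>The triple \<open>(x, y, z)\<close> stands for the upper unitriangular matrix over \<open>\<int>/p\<close> with rows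
  \<open>(1, x, z)\<close>, \<open>(0, 1, y)\<close>, \<open>(0, 0, 1)\<close>. With \<open>[g, h] = g\<^bsup>-1\<^esup> h\<^bsup>-1\<^esup> g h\<close>, the commutator of \<open>(1, 0, 0)\<close>
  and \<open>(0, 1, 0)\<close> is \<open>(0, 0, 1)\<close>.\<close>

definition heisenberg :: "nat \<Rightarrow> (int \<times> int \<times> int) monoid" where
  "heisenberg p =
     \<lparr>carrier = {0..<int p} \<times> {0..<int p} \<times> {0..<int p},
      monoid.mult = (\<lambda>(x, y, z) (x', y', z').
        ((x + x') mod int p, (y + y') mod int p, (z + z' + x * y') mod int p)),
      one = (0, 0, 0)\<rparr>"

text \<open>Dividing out the diagonal of the two centres identifies \<open>(0, 0, t)\<close> in the first factor with
  the inverse of \<open>(0, 0, t)\<close> in the second one (opposite orientation). Thus for \<open>s\<^sub>a, s\<^sub>b\<close> (resp.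
  \<open>s\<^sub>c, s\<^sub>d\<close>) the classes of the standard generators of the first (resp. second) factor,
  \<open>[s\<^sub>a, s\<^sub>b] = \<tau>\<close> and \<open>[s\<^sub>c, s\<^sub>d] = \<tau>\<^bsup>-1\<^esup>\<close>.\<close>

definition heisenberg_central_product ::
    "nat \<Rightarrow> ((int \<times> int \<times> int) \<times> (int \<times> int \<times> int)) set monoid" where
  "heisenberg_central_product p =
     (heisenberg p \<times>\<times> heisenberg p) Mod {((0, 0, t), (0, 0, t)) | t. t \<in> {0..<int p}}"

end

theory Submission
  imports Defs
begin

text \<open>Let \<open>\<rho>\<close> generate the Galois group of \<open>F(\<surd>u)\<close> over \<open>F\<close>, where \<open>\<surd>u\<close> is a \<open>p\<close>-th root of \<open>u\<close>. The
  exponents in \<open>W(f)\<close> are chosen so that \<open>\<rho>\<close> multiplies \<open>W(f)\<close> by \<open>N(f) / f\<^sup>p\<close>. Of the six basic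
  automorphisms of \<open>M\<close>, each of which multiplies one radical by \<open>\<zeta>\<close>, those for \<open>a\<close> and \<open>d\<close> fix \<open>w\<close>,
  and the prescribed norms make the others multiply \<open>w\<close> by \<open>\<gamma>\<^sup>p\<close>, where
  \<open>\<gamma>\<^sub>b = ra / (f1 f2)\<close>, \<open>\<gamma>\<^sub>c = rd / (f3 f4)\<close>, \<open>\<gamma>\<^sub>x = 1 / (ry f3)\<close> and \<open>\<gamma>\<^sub>y = 1 / (rx f2)\<close>.
  Hence the field \<open>Lt\<close> generated by a \<open>p\<close>-th root \<open>z\<close> of \<open>r w\<close> is Galois over \<open>F\<close>, and every basic
  automorphism lifts to it by \<open>z \<mapsto> \<gamma> z\<close>, with \<open>\<gamma> = 1\<close> for \<open>a\<close> and \<open>d\<close>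
  (\<open>w_moved\<close>, \<open>w_quotient_is_power\<close>, \<open>galois_radical_step\<close>).

  The group of \<open>Lt\<close> over \<open>F\<close> is generated by these six lifts and the central automorphism \<open>\<tau>\<close> with
  \<open>\<tau> z = \<zeta> z\<close>. The commutator of two lifts is the power of \<open>\<tau>\<close> found by comparing their values at \<open>z\<close>
  (\<open>commutation\<close>). The automorphism for \<open>a\<close> moves \<open>ra\<close> in \<open>\<gamma>\<^sub>b\<close>, and the one for \<open>d\<close> moves \<open>rd\<close> in \<open>\<gamma>\<^sub>c\<close>;
  these are the two commutators \<open>[s\<^sub>a, s\<^sub>b] = \<tau>\<close> and \<open>[s\<^sub>c, s\<^sub>d] = \<tau>\<^bsup>-1\<^esup>\<close>. Between \<open>x\<close> and \<open>y\<close> the contributions of \<open>ry\<close> and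
  \<open>rx\<close> cancel. Between \<open>b\<close> and \<open>y\<close>, both lifts move \<open>f2\<close> in the same way, and the same happens for \<open>f3\<close>
  between \<open>x\<close> and \<open>c\<close>. So these lifts commute. The \<open>p\<close>-th power of a lift multiplies \<open>z\<close> by the orbit
  product of \<open>\<gamma>\<close>, a quotient of norms with value \<open>1\<close>. The lifts thus satisfy the relations of a central
  product of two Heisenberg groups, generated by the lifts for \<open>a, b, c, d\<close>, times \<open>C\<^sub>p\<^sup>2\<close>, generated by
  those for \<open>x, y\<close>. No further relation holds, since exponents of the lifts are visible on the radicals
  and the exponent of \<open>\<tau>\<close> is visible on \<open>z\<close> (\<open>recognise_central_product\<close>).

  That \<open>w\<close> has no \<open>p\<close>-th root in \<open>M\<close> follows from the same computation: on such a root the automorphisms for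
  \<open>a\<close> and \<open>b\<close>, which commute on \<open>M\<close>, would have commutator \<open>\<zeta>\<close> (\<open>w_not_power\<close>).

  The Galois theory behind this is elementary. A field generated by a \<open>p\<close>-th root has the powers of the
  root as a basis (\<open>powers_of_radical_independent\<close>), so automorphisms can be extended by formulas
  (\<open>galois_extend_to_radical\<close>); iterating this gives the group of \<open>M\<close> (\<open>kummer_tower\<close>). For the fixed
  field \<open>L\<close> of the two auxiliary lifts, Lagrange resolvents show \<open>Lt = L(rx, ry)\<close>. So every automorphism
  of \<open>L\<close> extends to \<open>Lt\<close>, which identifies the group of \<open>L\<close> with the quotient by the auxiliary factor
  (\<open>fixed_field_of_central_pair\<close>).\<close>

section \<open>Subfields of a field given as a type\<close>

abbreviation subfield_of_type :: "'a::field set \<Rightarrow> bool" where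
  "subfield_of_type E \<equiv> subfield E ring_of_type_algebra"

lemma ring_of_type_algebra_simps [simp]:
  "carrier (ring_of_type_algebra :: 'a::field ring) = UNIV"
  "\<zero>\<^bsub>ring_of_type_algebra\<^esub> = (0 :: 'a::field)"
  "\<one>\<^bsub>ring_of_type_algebra\<^esub> = (1 :: 'a::field)"
  "u \<oplus>\<^bsub>ring_of_type_algebra\<^esub> v = (u + v :: 'a::field)"
  "u \<otimes>\<^bsub>ring_of_type_algebra\<^esub> v = (u * v :: 'a::field)"
  by (simp_all add: ring_of_type_algebra_def)

lemma ring_of_type_algebra_uminus [simp]: "\<ominus>\<^bsub>ring_of_type_algebra\<^esub> u = - (u :: 'a::field)"
proof -
  interpret R: ring "ring_of_type_algebra :: 'a ring" by (rule ring_from_type_algebra)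
  show ?thesis using R.minus_equality[of "- u" u] by simp
qed

lemma ring_of_type_algebra_inverse [simp]:
  assumes "u \<noteq> (0 :: 'a::field)" shows "inv\<^bsub>ring_of_type_algebra\<^esub> u = inverse u"
proof -
  interpret R: field "ring_of_type_algebra :: 'a ring" by (rule field_from_type_algebra)
  show ?thesis using R.comm_inv_char[of u "inverse u"] assms by simp
qed

lemma ring_of_type_algebra_power [simp]:
  "u [^]\<^bsub>ring_of_type_algebra\<^esub> n = (u :: 'a::field) ^ (n::nat)"
  by (induction n) (simp_all add: nat_pow_def)

lemma subfield_of_type_iff:
  "subfield_of_type (E :: 'a::field set) \<longleftrightarrow>
     1 \<in> E \<and> (\<forall>u\<in>E. \<forall>v\<in>E. u + v \<in> E \<and> u * v \<in> E) \<and> (\<forall>u\<in>E. - u \<in> E \<and> inverse u \<in> E)"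
  (is "_ \<longleftrightarrow> ?rhs")
proof
  interpret R: field "ring_of_type_algebra :: 'a ring" by (rule field_from_type_algebra)
  show ?rhs if E: "subfield_of_type E"
  proof -
    note sub = subringE[OF subfieldE(1)[OF E]]
    have "inverse u \<in> E" if "u \<in> E" for u
      using R.subfield_m_inv(1)[OF E, of u] that sub(2) by (cases "u = 0") auto
    then show ?thesis using sub by auto
  qed
  show "subfield_of_type E" if ?rhs
    using that by (intro R.subfieldI' R.subringI) auto
qed

lemma subfield_closed:
  assumes "subfield_of_type (E :: 'a::field set)"
  shows "0 \<in> E" "1 \<in> E" "\<And>u v. u \<in> E \<Longrightarrow> v \<in> E \<Longrightarrow> u + v \<in> E"
    "\<And>u v. u \<in> E \<Longrightarrow> v \<in> E \<Longrightarrow> u * v \<in> E" "\<And>u. u \<in> E \<Longrightarrow> - u \<in> E"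
    "\<And>u. u \<in> E \<Longrightarrow> inverse u \<in> E" "\<And>u v. u \<in> E \<Longrightarrow> v \<in> E \<Longrightarrow> u - v \<in> E"
    "\<And>u v. u \<in> E \<Longrightarrow> v \<in> E \<Longrightarrow> u / v \<in> E" "\<And>u (n::nat). u \<in> E \<Longrightarrow> u ^ n \<in> E"
proof -
  note E = assms[unfolded subfield_of_type_iff]
  show one: "1 \<in> E" and add: "u \<in> E \<Longrightarrow> v \<in> E \<Longrightarrow> u + v \<in> E"
    and mul: "u \<in> E \<Longrightarrow> v \<in> E \<Longrightarrow> u * v \<in> E" and min: "u \<in> E \<Longrightarrow> - u \<in> E"
    and inv: "u \<in> E \<Longrightarrow> inverse u \<in> E" for u v using E by auto
  show "0 \<in> E" using add[OF one min[OF one]] by simp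
  show "u - v \<in> E" if "u \<in> E" "v \<in> E" for u v using add[OF that(1) min[OF that(2)]] by simp
  show "u / v \<in> E" if "u \<in> E" "v \<in> E" for u v
    using mul[OF that(1) inv[OF that(2)]] by (simp add: divide_inverse)
  show "u ^ n \<in> E" if "u \<in> E" for u and n :: nat
    by (induction n) (use that one mul in auto)
qed

lemma subfield_sum:
  assumes "subfield_of_type E" "\<And>i. i \<in> I \<Longrightarrow> f i \<in> E" shows "sum f I \<in> E"
  using assms(2) by (induction I rule: infinite_finite_induct) (auto intro: subfield_closed[OF assms(1)])

lemma subfield_prod:
  assumes "subfield_of_type E" "\<And>i. i \<in> I \<Longrightarrow> f i \<in> E" shows "prod f I \<in> E"
  using assms(2) by (induction I rule: infinite_finite_induct) (auto intro: subfield_closed[OF assms(1)])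

lemma adjoin_subfield: "subfield_of_type (adjoin F S)"
  unfolding adjoin_def using field.generate_field_is_subfield[OF field_from_type_algebra] by simp

lemma adjoin_base: "F \<subseteq> adjoin F S" and adjoin_gens: "S \<subseteq> adjoin F S"
  unfolding adjoin_def by (auto intro: generate_field.incl)

lemma adjoin_gen: "r \<in> S \<Longrightarrow> r \<in> adjoin F S"
  using adjoin_gens by blast

lemma adjoin_least: "subfield_of_type E \<Longrightarrow> F \<subseteq> E \<Longrightarrow> S \<subseteq> E \<Longrightarrow> adjoin F S \<subseteq> E"
  unfolding adjoin_def
  using field.generate_field_min_subfield1[OF field_from_type_algebra, of "F \<union> S" E] by simp

lemma adjoin_mono: "S \<subseteq> T \<Longrightarrow> adjoin F S \<subseteq> adjoin F T"
  by (rule adjoin_least[OF adjoin_subfield adjoin_base]) (use adjoin_gens in blast)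

lemma adjoin_adjoin: "adjoin (adjoin F S) T = adjoin F (S \<union> T)"
proof
  show "adjoin (adjoin F S) T \<subseteq> adjoin F (S \<union> T)"
    by (intro adjoin_least adjoin_subfield adjoin_mono) (use adjoin_gens[of "S \<union> T" F] in auto)
  have "F \<subseteq> adjoin (adjoin F S) T" "S \<subseteq> adjoin (adjoin F S) T"
    using adjoin_base[of "adjoin F S" T] adjoin_base[of F S] adjoin_gens[of S F] by blast+
  then show "adjoin F (S \<union> T) \<subseteq> adjoin (adjoin F S) T"
    using adjoin_gens[of T "adjoin F S"] by (intro adjoin_least[OF adjoin_subfield]) auto
qed

lemma adjoin_empty: "subfield_of_type F \<Longrightarrow> adjoin F {} = F"
  using adjoin_least[of F F "{}"] adjoin_base[of F "{}"] by auto


section \<open>Galois groups\<close>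

abbreviation Gal :: "'a::field set \<Rightarrow> 'a set \<Rightarrow> ('a \<Rightarrow> 'a) set" where
  "Gal E F \<equiv> carrier (galois_group E F)"

lemma galois_group_iff:
  "\<sigma> \<in> Gal E F \<longleftrightarrow>
     \<sigma> \<in> extensional E \<and> bij_betw \<sigma> E E \<and>
     (\<forall>u\<in>E. \<forall>v\<in>E. \<sigma> (u + v) = \<sigma> u + \<sigma> v \<and> \<sigma> (u * v) = \<sigma> u * \<sigma> v) \<and> \<sigma> 1 = 1 \<and> (\<forall>u\<in>F. \<sigma> u = u)"
  by (auto simp: galois_group_def Bij_def ring_hom_def field_ring_def ring_of_type_algebra_def
      bij_betw_def)

lemma galois_groupD:
  assumes "subfield_of_type E" "\<sigma> \<in> Gal E F"
  shows "\<And>u. u \<in> E \<Longrightarrow> \<sigma> u \<in> E" "\<And>u v. u \<in> E \<Longrightarrow> v \<in> E \<Longrightarrow> \<sigma> (u + v) = \<sigma> u + \<sigma> v"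
    "\<And>u v. u \<in> E \<Longrightarrow> v \<in> E \<Longrightarrow> \<sigma> (u * v) = \<sigma> u * \<sigma> v" "\<sigma> 1 = 1" "\<sigma> 0 = 0"
    "\<And>u. u \<in> E \<Longrightarrow> \<sigma> (- u) = - \<sigma> u" "\<And>u v. u \<in> E \<Longrightarrow> v \<in> E \<Longrightarrow> \<sigma> (u - v) = \<sigma> u - \<sigma> v"
    "\<And>u. u \<in> E \<Longrightarrow> \<sigma> (inverse u) = inverse (\<sigma> u)"
    "\<And>u v. u \<in> E \<Longrightarrow> v \<in> E \<Longrightarrow> \<sigma> (u / v) = \<sigma> u / \<sigma> v"
    "\<And>u (n::nat). u \<in> E \<Longrightarrow> \<sigma> (u ^ n) = \<sigma> u ^ n" "\<And>u. u \<in> F \<Longrightarrow> \<sigma> u = u"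
    "\<And>u. u \<in> E \<Longrightarrow> \<sigma> u = 0 \<longleftrightarrow> u = 0"
proof -
  note E = subfield_closed[OF assms(1)]
  note s = assms(2)[unfolded galois_group_iff]
  show mem: "\<And>u. u \<in> E \<Longrightarrow> \<sigma> u \<in> E" using s by (auto simp: bij_betw_def)
  show add: "\<sigma> (u + v) = \<sigma> u + \<sigma> v" and mul: "\<sigma> (u * v) = \<sigma> u * \<sigma> v" if "u \<in> E" "v \<in> E" for u v
    using s that by auto
  show one: "\<sigma> 1 = 1" using s by auto
  show zero: "\<sigma> 0 = 0" using add[OF E(1) E(1)] by (metis add_0 add_right_imp_eq)
  show min: "\<sigma> (- u) = - \<sigma> u" if "u \<in> E" for u
    using add[OF that E(5)[OF that]] zero by (simp add: eq_neg_iff_add_eq_0 add.commute)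
  show "\<sigma> (u - v) = \<sigma> u - \<sigma> v" if "u \<in> E" "v \<in> E" for u v
    using add[OF that(1) E(5)[OF that(2)]] min[OF that(2)] by simp
  show inv: "\<sigma> (inverse u) = inverse (\<sigma> u)" if "u \<in> E" for u
  proof (cases "u = 0")
    case False
    then have "\<sigma> u * \<sigma> (inverse u) = 1" using mul[OF that E(6)[OF that]] one by simp
    then show ?thesis by (simp add: inverse_unique)
  qed (simp add: zero)
  show "\<sigma> (u / v) = \<sigma> u / \<sigma> v" if "u \<in> E" "v \<in> E" for u v
    using mul[OF that(1) E(6)[OF that(2)]] inv[OF that(2)] by (simp add: divide_inverse)
  show "\<sigma> (u ^ n) = \<sigma> u ^ n" if "u \<in> E" for u and n :: nat
    by (induction n) (use mul[OF that E(9)[OF that]] one in auto)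
  show "\<And>u. u \<in> F \<Longrightarrow> \<sigma> u = u" using s by auto
  have "inj_on \<sigma> E" using s by (auto simp: bij_betw_def)
  then show "\<sigma> u = 0 \<longleftrightarrow> u = 0" if "u \<in> E" for u
    using inj_on_eq_iff[of \<sigma> E u 0] that E(1) zero by auto
qed

lemma galois_group_sum:
  assumes "subfield_of_type E" "\<sigma> \<in> Gal E F" "\<And>i. i \<in> I \<Longrightarrow> f i \<in> E"
  shows "\<sigma> (sum f I) = (\<Sum>i\<in>I. \<sigma> (f i))"
  using assms(3)
  by (induction I rule: infinite_finite_induct)
     (auto simp: galois_groupD[OF assms(1,2)] subfield_sum[OF assms(1)])

lemma galois_group_prod:
  assumes "subfield_of_type E" "\<sigma> \<in> Gal E F" "\<And>i. i \<in> I \<Longrightarrow> f i \<in> E"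
  shows "\<sigma> (prod f I) = (\<Prod>i\<in>I. \<sigma> (f i))"
  using assms(3)
  by (induction I rule: infinite_finite_induct)
     (auto simp: galois_groupD[OF assms(1,2)] subfield_prod[OF assms(1)])

lemma galois_mult:
  assumes "g \<in> Gal E F" "h \<in> Gal E F"
  shows "g \<otimes>\<^bsub>galois_group E F\<^esub> h = compose E g h"
  using assms by (auto simp: galois_group_def BijGroup_def)

lemma galois_mult_apply [simp]:
  assumes "g \<in> Gal E F" "h \<in> Gal E F" "u \<in> E"
  shows "(g \<otimes>\<^bsub>galois_group E F\<^esub> h) u = g (h u)"
  using galois_mult[OF assms(1,2)] assms(3) by (simp add: compose_def)

lemma galois_one: "\<one>\<^bsub>galois_group E F\<^esub> = (\<lambda>u\<in>E. u)"
  by (auto simp: galois_group_def BijGroup_def)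

lemma galois_one_apply [simp]: "u \<in> E \<Longrightarrow> \<one>\<^bsub>galois_group E F\<^esub> u = u"
  by (simp add: galois_one)

lemma galois_group_group:
  assumes "subfield_of_type E" "F \<subseteq> E"
  shows "group (galois_group E F)"
proof -
  note E = subfield_closed[OF assms(1)]
  let ?H = "Gal E F"
  have eq: "galois_group E F = (BijGroup E)\<lparr>carrier := ?H\<rparr>"
    by (simp add: galois_group_def)
  have sub: "?H \<subseteq> Bij E" by (auto simp: galois_group_def)
  have "subgroup ?H (BijGroup E)"
  proof (rule group.subgroupI[OF group_BijGroup])
    show "?H \<subseteq> carrier (BijGroup E)" using sub by (simp add: BijGroup_def)
    have "(\<lambda>u\<in>E. u) \<in> ?H"
      using E(2-4) assms(2) by (auto simp: galois_group_iff bij_betw_def inj_on_def)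
    then show "?H \<noteq> {}" by blast
    show "inv\<^bsub>BijGroup E\<^esub> g \<in> ?H" if g: "g \<in> ?H" for g
    proof -
      let ?k = "\<lambda>u\<in>E. inv_into E g u"
      note gd = galois_groupD[OF assms(1) g]
      have bij: "bij_betw g E E" using g by (auto simp: galois_group_iff)
      have k: "?k u \<in> E" "g (?k u) = u" if "u \<in> E" for u
        using that bij by (auto simp: bij_betw_def inv_into_into f_inv_into_f)
      have uniq: "?k v = u" if "u \<in> E" "g u = v" for u v
        using that bij gd(1) by (auto simp: bij_betw_def)
      have "?k (u + v) = ?k u + ?k v \<and> ?k (u * v) = ?k u * ?k v" if "u \<in> E" "v \<in> E" for u v
        using k[OF that(1)] k[OF that(2)]
        by (intro conjI uniq E(3,4)) (simp_all only: gd(2,3))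
      moreover have "?k 1 = 1" using uniq[of 1 1] gd(4) E(2) by blast
      moreover have "?k u = u" if "u \<in> F" for u using uniq[of u u] gd(11) assms(2) that by blast
      moreover have "bij_betw ?k E E" using bij_betw_inv_into[OF bij] by simp
      ultimately have "?k \<in> ?H" unfolding galois_group_iff by auto
      then show ?thesis using inv_BijGroup[of g E] g sub by auto
    qed
    show "g \<otimes>\<^bsub>BijGroup E\<^esub> h \<in> ?H" if g: "g \<in> ?H" and h: "h \<in> ?H" for g h
    proof -
      note gd = galois_groupD[OF assms(1) g] and hd = galois_groupD[OF assms(1) h]
      have "compose E g h \<in> Bij E" using g h sub by (blast intro: compose_Bij)
      then have "compose E g h \<in> ?H"
        unfolding galois_group_iff Bij_def
        by (simp add: compose_def gd(1-4,11) hd(1-4,11) E(2-4) subsetD[OF assms(2)])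
      then show ?thesis using g h sub by (auto simp: BijGroup_def)
    qed
  qed
  then show ?thesis using group.subgroup_imp_group[OF group_BijGroup] eq by metis
qed

lemma galois_group_eqI:
  assumes "g \<in> Gal E F" "h \<in> Gal E F"
    and "\<And>u. u \<in> E \<Longrightarrow> g u = h u"
  shows "g = h"
  using assms by (auto simp: galois_group_iff intro: extensionalityI)

text \<open>The two automorphisms may live on different fields, so that an automorphism can be compared with its
  restriction to a subfield or with one of its extensions.\<close>

lemma galois_group_agree_on_adjoin:
  assumes E: "subfield_of_type E" and g: "g \<in> Gal E F"
    and E': "subfield_of_type E'" and h: "h \<in> Gal E' F'"
    and sub: "B \<union> S \<subseteq> E" "B \<union> S \<subseteq> E'" and eq: "\<And>u. u \<in> B \<union> S \<Longrightarrow> g u = h u"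
    and u: "u \<in> adjoin B S"
  shows "g u = h u"
proof -
  note gd = galois_groupD[OF E g] and hd = galois_groupD[OF E' h]
  have "subfield_of_type {u \<in> E \<inter> E'. g u = h u}"
    unfolding subfield_of_type_iff
    by (simp add: gd(2-4,6,8) hd(2-4,6,8) subfield_closed(2-6)[OF E] subfield_closed(2-6)[OF E'])
  then have "adjoin B S \<subseteq> {u \<in> E \<inter> E'. g u = h u}"
    by (rule adjoin_least) (use sub eq in auto)
  then show ?thesis using u by auto
qed

lemma galois_group_eq_on_gens:
  assumes g: "g \<in> Gal (adjoin F S) F"
    and h: "h \<in> Gal (adjoin F S) F" and eq: "\<And>u. u \<in> S \<Longrightarrow> g u = h u"
  shows "g = h"
proof (rule galois_group_eqI[OF g h])
  have sub: "F \<union> S \<subseteq> adjoin F S" using adjoin_base[of F S] adjoin_gens[of S F] by auto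
  have "g u = h u" if "u \<in> F \<union> S" for u
    using that eq galois_groupD(11)[OF adjoin_subfield g] galois_groupD(11)[OF adjoin_subfield h] by auto
  then show "g u = h u" if "u \<in> adjoin F S" for u
    using galois_group_agree_on_adjoin[OF adjoin_subfield g adjoin_subfield h sub sub _ that] by blast
qed

lemma fixed_field_subfield:
  assumes E: "subfield_of_type E" and A: "A \<subseteq> Gal E F"
  shows "subfield_of_type (fixed_field E A)"
proof -
  have fixed: "\<sigma> 1 = 1" "\<sigma> (u + v) = u + v" "\<sigma> (u * v) = u * v" "\<sigma> (- u) = - u"
      "\<sigma> (inverse u) = inverse u"
    if s: "\<sigma> \<in> A" and u: "u \<in> fixed_field E A" and v: "v \<in> fixed_field E A" for \<sigma> u v
  proof -
    note gd = galois_groupD[OF E subsetD[OF A s]]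
    have "u \<in> E" "v \<in> E" "\<sigma> u = u" "\<sigma> v = v" using s u v by (auto simp: fixed_field_def)
    then show "\<sigma> 1 = 1" "\<sigma> (u + v) = u + v" "\<sigma> (u * v) = u * v" "\<sigma> (- u) = - u"
      "\<sigma> (inverse u) = inverse u" by (simp_all add: gd(2-4,6,8))
  qed
  have in_E: "u \<in> E" if "u \<in> fixed_field E A" for u using that by (simp add: fixed_field_def)
  have mem: "u \<in> fixed_field E A" if "u \<in> E" "\<And>\<sigma>. \<sigma> \<in> A \<Longrightarrow> \<sigma> u = u" for u
    using that by (simp add: fixed_field_def)
  have one: "1 \<in> fixed_field E A"
  proof (rule mem)
    show "\<sigma> 1 = 1" if "\<sigma> \<in> A" for \<sigma>
      using galois_groupD(4)[OF E subsetD[OF A that]] .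
  qed (rule subfield_closed(2)[OF E])
  show ?thesis
    unfolding subfield_of_type_iff
  proof (intro conjI ballI one)
    fix u v assume u: "u \<in> fixed_field E A" and v: "v \<in> fixed_field E A"
    show "u + v \<in> fixed_field E A"
      by (rule mem[OF subfield_closed(3)[OF E in_E[OF u] in_E[OF v]]]) (rule fixed(2)[OF _ u v])
    show "u * v \<in> fixed_field E A"
      by (rule mem[OF subfield_closed(4)[OF E in_E[OF u] in_E[OF v]]]) (rule fixed(3)[OF _ u v])
  next
    fix u assume u: "u \<in> fixed_field E A"
    show "- u \<in> fixed_field E A"
      by (rule mem[OF subfield_closed(5)[OF E in_E[OF u]]]) (rule fixed(4)[OF _ u u])
    show "inverse u \<in> fixed_field E A"
      by (rule mem[OF subfield_closed(6)[OF E in_E[OF u]]]) (rule fixed(5)[OF _ u u])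
  qed
qed

section \<open>Adjoining a radical\<close>

lemma algebraic_radical:
  assumes "subfield_of_type (E :: 'a::field set)" "p > 0" "r ^ p \<in> E"
  shows "(ring.algebraic ring_of_type_algebra over E) r"
proof -
  interpret R: field "ring_of_type_algebra :: 'a ring" by (rule field_from_type_algebra)
  let ?f = "1 # replicate (p - 1) 0 @ [- (r ^ p)]"
  show ?thesis
  proof (rule R.algebraicI)
    show "?f \<in> carrier (E [X]\<^bsub>ring_of_type_algebra\<^esub>)"
      using assms(3) subfield_closed[OF assms(1)] by (auto simp: univ_poly_def polynomial_def)
    show "R.eval ?f r = \<zero>\<^bsub>ring_of_type_algebra\<^esub>"
      using R.eval_replicate[of "[- (r ^ p)]" r "p - 1"] assms(2) by simp
  qed simp
qed

text \<open>The ring \<open>simple_extension E r\<close> generated by \<open>E\<close> and \<open>r\<close> is already a field, because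
  \<open>r\<close> is algebraic. This is why elements of \<open>adjoin E {r}\<close> can be written as polynomials in \<open>r\<close>.\<close>

lemma adjoin_radical_eq_simple_extension:
  assumes "subfield_of_type (E :: 'a::field set)" "p > 0" "r ^ p \<in> E"
  shows "adjoin E {r} = ring.simple_extension ring_of_type_algebra E r"
proof -
  interpret R: field "ring_of_type_algebra :: 'a ring" by (rule field_from_type_algebra)
  have sub: "subfield_of_type (R.simple_extension E r)"
    using R.simple_extension_is_subfield[OF assms(1)] algebraic_radical[OF assms] by simp
  show ?thesis
  proof
    show "adjoin E {r} \<subseteq> R.simple_extension E r"
      using R.simple_extension_mem[OF subfieldE(1)[OF assms(1)]] R.simple_extension_incl[of E r]
      by (intro adjoin_least[OF sub]) auto
    show "R.simple_extension E r \<subseteq> adjoin E {r}"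
      using adjoin_base[of E "{r}"] adjoin_gens[of "{r}" E]
      by (intro R.simple_extension_subring_incl subfieldE(1)[OF adjoin_subfield]) auto
  qed
qed

lemma adjoin_radical_finite_dimension:
  assumes "subfield_of_type (E :: 'a::field set)" "p > 0" "r ^ p \<in> E"
  shows "ring.finite_dimension ring_of_type_algebra E (adjoin E {r})"
proof -
  interpret R: field "ring_of_type_algebra :: 'a ring" by (rule field_from_type_algebra)
  show ?thesis
    using R.finite_dimension_simple_extension[OF assms(1)] algebraic_radical[OF assms]
      adjoin_radical_eq_simple_extension[OF assms] by simp
qed

lemma adjoin_radical_expansion:
  assumes E: "subfield_of_type (E :: 'a::field set)" and "p > 0" "r ^ p \<in> E" and v: "v \<in> adjoin E {r}"
  shows "\<exists>c. (\<forall>i. c i \<in> E) \<and> v = (\<Sum>i<p. c i * r ^ i)"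
proof -
  interpret R: field "ring_of_type_algebra :: 'a ring" by (rule field_from_type_algebra)
  obtain q where q: "p = Suc q" using assms(2) by (cases p) auto
  from v have "v \<in> R.simple_extension E r"
    using adjoin_radical_eq_simple_extension[OF assms(1-3)] by simp
  then show ?thesis
  proof induction
    case zero
    show ?case by (rule exI[of _ "\<lambda>_. 0"]) (simp add: subfield_closed[OF E])
  next
    case (lin k1 k2)
    then obtain c where c: "\<And>i. c i \<in> E" "k1 = (\<Sum>i<p. c i * r ^ i)" by auto
    let ?c = "case_nat (k2 + c q * r ^ p) c"
    have "k1 * r + k2 = (\<Sum>i<q. c i * r ^ Suc i) + c q * r ^ p + k2"
      by (simp add: c(2) q sum_distrib_left sum_distrib_right algebra_simps)
    also have "\<dots> = (\<Sum>i<p. ?c i * r ^ i)"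
      unfolding q by (subst sum.lessThan_Suc_shift) (simp add: algebra_simps)
    finally have "k1 * r + k2 = (\<Sum>i<p. ?c i * r ^ i)" .
    moreover have "?c i \<in> E" for i
      using c(1) lin(2) assms(3) by (cases i) (auto intro!: subfield_closed[OF E])
    ultimately show ?case by auto
  qed
qed

lemma adjoin_radical_sum_mem:
  assumes "\<And>i. c i \<in> E" shows "(\<Sum>i<(p::nat). c i * r ^ i) \<in> adjoin E {r}"
proof (rule subfield_sum[OF adjoin_subfield])
  show "c i * r ^ i \<in> adjoin E {r}" for i
    using assms[of i] adjoin_base[of E "{r}"] adjoin_gens[of "{r}" E]
    by (intro subfield_closed[OF adjoin_subfield]) auto
qed


section \<open>Kummer extensions of degree \<open>p\<close>\<close>

locale kummer_base =
  fixes p :: nat and \<zeta> :: "'a::alg_closed_field" and E :: "'a set"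
  assumes prime_p: "Factorial_Ring.prime p" and base_subfield: "subfield_of_type E"
    and roots_of_unity: "{\<mu>. \<mu> ^ p = 1} \<subseteq> E" and primitive: "primitive_root_of_unity p \<zeta>"
begin

lemmas base_closed = subfield_closed[OF base_subfield]

lemma p_gt_1: "p > 1" and p_gt_0: "p > 0"
  using prime_gt_1_nat[OF prime_p] by auto

lemma zeta_pow_p: "\<zeta> ^ p = 1"
  using primitive by (auto simp: primitive_root_of_unity_def)

lemma zeta_nonzero: "\<zeta> \<noteq> 0"
  using zeta_pow_p p_gt_0 by (auto simp: power_0_left)

lemma zeta_mem: "\<zeta> \<in> E"
  using zeta_pow_p roots_of_unity by auto

lemma zeta_pow_mod: "\<zeta> ^ (k mod p) = \<zeta> ^ k"
proof -
  have "\<zeta> ^ k = \<zeta> ^ (p * (k div p) + k mod p)" by simp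
  also have "\<dots> = \<zeta> ^ (k mod p)" by (simp only: power_add power_mult zeta_pow_p) simp
  finally show ?thesis ..
qed

lemma zeta_pow_eq_1_iff: "\<zeta> ^ k = 1 \<longleftrightarrow> p dvd k"
proof
  assume "\<zeta> ^ k = 1"
  then have "\<zeta> ^ (k mod p) = 1" by (simp add: zeta_pow_mod)
  then have "\<not> 0 < k mod p"
    using primitive p_gt_0 by (auto simp: primitive_root_of_unity_def)
  then show "p dvd k" by auto
qed (auto simp: power_mult zeta_pow_p elim!: dvdE)

lemma zeta_pow_inj: "inj_on ((^) \<zeta>) {..<p}"
proof (rule linorder_inj_onI)
  fix i j assume ij: "i < j" "i \<in> {..<p}" "j \<in> {..<p}"
  show "\<zeta> ^ i \<noteq> \<zeta> ^ j"
  proof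
    assume "\<zeta> ^ i = \<zeta> ^ j"
    moreover have "\<zeta> ^ j = \<zeta> ^ i * \<zeta> ^ (j - i)" using ij(1) by (simp flip: power_add)
    ultimately have "\<zeta> ^ (j - i) = 1" using zeta_nonzero by simp
    then have "p dvd j - i" by (simp add: zeta_pow_eq_1_iff)
    then show False using ij by (auto dest: dvd_imp_le)
  qed
qed auto

lemma root_of_unity_eq_zeta_pow:
  assumes "\<mu> ^ p = 1" shows "\<exists>k<p. \<mu> = \<zeta> ^ k"
proof -
  let ?f = "Polynomial.monom 1 p - 1 :: 'a poly"
  have f: "poly ?f t = t ^ p - 1" for t by (simp add: poly_monom)
  have "poly ?f 0 \<noteq> 0" using p_gt_0 by (simp add: poly_monom power_0_left)
  then have nz: "?f \<noteq> 0" by (metis poly_0)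
  have deg: "Polynomial.degree ?f \<le> p"
    by (rule order.trans[OF degree_diff_le_max]) (simp add: degree_monom_eq)
  have eq: "{t. poly ?f t = 0} = {t. t ^ p = 1}" by (simp add: poly_monom)
  have "(^) \<zeta> ` {..<p} = {t. t ^ p = 1}"
  proof (rule card_seteq)
    show "finite {t::'a. t ^ p = 1}" using poly_roots_finite[OF nz] unfolding eq .
    have "(\<zeta> ^ k) ^ p = 1" for k by (metis mult.commute power_mult power_one zeta_pow_p)
    then show "(^) \<zeta> ` {..<p} \<subseteq> {t. t ^ p = 1}" by auto
    show "card {t::'a. t ^ p = 1} \<le> card ((^) \<zeta> ` {..<p})"
      using card_poly_roots_bound[OF nz] deg unfolding eq by (simp add: card_image[OF zeta_pow_inj])
  qed
  then show ?thesis using assms by auto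
qed

lemma pth_roots_differ_by_zeta:
  assumes "s ^ p = r ^ p" shows "\<exists>k<p. s = \<zeta> ^ k * r"
proof (cases "r = 0")
  case True
  then show ?thesis using assms p_gt_0 by (auto simp: power_0_left intro!: exI[of _ 0])
next
  case False
  then have "(s / r) ^ p = 1" using assms by (simp add: power_divide)
  then show ?thesis using root_of_unity_eq_zeta_pow[of "s / r"] False by (auto simp: field_simps)
qed

text \<open>Two \<open>p\<close>-th roots of the same element differ by a root of unity, and these lie in the base field.\<close>

lemma radical_mem_iff:
  assumes "s ^ p = r ^ p" shows "s \<in> E \<longleftrightarrow> r \<in> E"
proof -
  have "s \<in> E" if "s ^ p = r ^ p" "r \<in> E" for s r :: 'a
    using pth_roots_differ_by_zeta[OF that(1)] that(2) base_closed(4,9) zeta_mem by auto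
  then show ?thesis using assms by metis
qed

text \<open>The exponents \<open>m\<close> and \<open>p\<close> are coprime, so \<open>r\<close> is a quotient of a power of \<open>r\<^sup>m\<close> and a power of \<open>r\<^sup>p\<close>.\<close>

lemma coprime_power_mem:
  assumes r: "r ^ p \<in> E" "r ^ m \<in> E" and m: "0 < m" "m < p"
  shows "r \<in> E"
proof (cases "r = 0")
  case False
  have "coprime m p"
    using prime_p m by (metis coprime_commute nat_dvd_not_less prime_imp_coprime)
  then obtain i j where ij: "m * i = p * j + 1"
    using bezout_nat[of m p] m by auto
  have "(r ^ m) ^ i = r ^ (p * j + 1)" by (simp only: ij flip: power_mult)
  also have "\<dots> = (r ^ p) ^ j * r" by (simp add: power_mult)
  finally have "r = (r ^ m) ^ i / (r ^ p) ^ j" using False by (simp add: field_simps)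
  then show ?thesis using r base_closed(8,9) by metis
qed (simp add: base_closed)

text \<open>The classical irreducibility of \<open>X\<^sup>p - u\<close> for \<open>u = r\<^sup>p\<close>. The minimal polynomial of \<open>r\<close>, of degree \<open>m\<close>, divides
  \<open>X\<^sup>p - u\<close>, so up to sign its constant term is a product of \<open>m\<close> roots of \<open>X\<^sup>p - u\<close>, that is, \<open>r\<^sup>m\<close> times
  a root of unity. Hence \<open>r\<^sup>m\<close> lies in the base field. For \<open>0 < m < p\<close> this forces \<open>r\<close> to lie there too.\<close>

lemma powers_of_radical_independent:
  assumes r: "r ^ p \<in> E" "r \<notin> E" and c: "\<And>i. c i \<in> E" and sum: "(\<Sum>i<p. c i * r ^ i) = 0"
    and j: "j < p"
  shows "c j = 0"
proof (rule ccontr)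
  assume cj: "c j \<noteq> 0"
  define Q where "Q = {q :: 'a poly. \<forall>i. Polynomial.coeff q i \<in> E}"
  define ann where "ann = {q \<in> Q. q \<noteq> 0 \<and> poly q r = 0}"
  have r0: "r \<noteq> 0" using r(2) base_closed(1) by auto
  define q0 where "q0 = (\<Sum>i<p. Polynomial.monom (c i) i)"
  have coeff_q0: "Polynomial.coeff q0 i = (if i < p then c i else 0)" for i
    by (simp add: q0_def coeff_sum)
  have q0: "q0 \<in> ann" 
    using coeff_q0 j cj sum c base_closed(1)
    by (auto simp: ann_def Q_def q0_def poly_sum poly_monom poly_eq_iff)
  have deg_q0: "Polynomial.degree q0 < p"
    using degree_lessI[of q0 p] j p_gt_0 by (auto simp: coeff_q0)
  obtain g where g: "g \<in> ann" and min: "\<And>q. q \<in> ann \<Longrightarrow> Polynomial.degree g \<le> Polynomial.degree q"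
    using ex_has_least_nat[of "\<lambda>q. q \<in> ann" q0 Polynomial.degree] q0 by blast
  define m where "m = Polynomial.degree g"
  have g': "g \<noteq> 0" "poly g r = 0" "\<And>i. Polynomial.coeff g i \<in> E" using g by (auto simp: ann_def Q_def)
  have m: "m < p" using min[OF q0] deg_q0 by (simp add: m_def)
  have "m \<noteq> 0"
  proof
    assume "m = 0"
    then obtain k where "g = [:k:]" unfolding m_def by (metis degree_eq_zeroE)
    then show False using g'(1,2) by simp
  qed
  \<comment> \<open>Division by \<open>g\<close> stays inside \<open>Q\<close>: each step subtracts a multiple of \<open>g\<close> with coefficients in \<open>E\<close>.\<close>
  have dvd: "g dvd q" if "q \<in> Q" "poly q r = 0" for q
    using that
  proof (induction "Polynomial.degree q" arbitrary: q rule: less_induct)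
    case less
    show ?case
    proof (cases "q = 0")
      case False
      then have le: "m \<le> Polynomial.degree q" using min[of q] less.prems by (simp add: ann_def m_def)
      define h where "h = Polynomial.monom (Polynomial.lead_coeff q / Polynomial.lead_coeff g)
        (Polynomial.degree q - m)"
      define q' where "q' = q - h * g"
      have coeff_hg: "Polynomial.coeff (h * g) i =
          (if i < Polynomial.degree q - m then 0
           else Polynomial.lead_coeff q / Polynomial.lead_coeff g *
             Polynomial.coeff g (i - (Polynomial.degree q - m)))" for i
        by (simp add: h_def coeff_monom_mult)
      have "q' \<in> Q"
        using less.prems(1) g'(3) base_closed
        by (auto simp: Q_def q'_def coeff_hg)
      moreover have "poly q' r = 0" using less.prems g' by (simp add: q'_def)
      moreover have "q' = 0 \<or> Polynomial.degree q' < Polynomial.degree q"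
      proof -
        have "Polynomial.coeff q' i = 0" if "i \<ge> Polynomial.degree q" for i
        proof (cases "i = Polynomial.degree q")
          case True
          have "Polynomial.degree q - (Polynomial.degree q - m) = m" using le by simp
          then show ?thesis using g'(1) le True
            by (simp add: q'_def coeff_hg flip: m_def) (simp add: m_def)
        next
          case False
          then have "i - (Polynomial.degree q - m) > m" using that le by simp
          then show ?thesis using that False le
            by (simp add: q'_def coeff_hg coeff_eq_0 m_def)
        qed
        then show ?thesis by (metis degree_lessI leading_coeff_0_iff linorder_le_less_linear)
      qed
      ultimately have "g dvd q'" using less.hyps[of q'] by auto
      then show ?thesis by (simp add: q'_def) (metis dvd_add_left_iff dvd_triv_right diff_add_cancel)
    qed simp
  qed
  define f where "f = Polynomial.monom 1 p - [:r ^ p:]"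
  have "g dvd f"
    using base_closed r(1)
    by (intro dvd) (auto simp: Q_def f_def poly_monom coeff_pCons split: nat.split)
  obtain A where A: "size A = m" "g = smult (Polynomial.lead_coeff g) (\<Prod>t\<in>#A. [:- t, 1:])"
    using alg_closed_imp_factorization[OF g'(1)] by (auto simp: m_def)
  have root: "t ^ p = r ^ p" if "t \<in># A" for t
  proof -
    have "[:- t, 1:] dvd (\<Prod>t\<in>#A. [:- t, 1:])" using that by (auto intro: dvd_prod_mset)
    then have "[:- t, 1:] dvd g" by (subst A(2)) (rule dvd_smult)
    then have "poly f t = 0" using \<open>g dvd f\<close> by (metis dvd_trans poly_eq_0_iff_dvd)
    then show ?thesis by (simp add: f_def poly_monom)
  qed
  define e where "e = (\<Prod>t\<in>#A. t)"
  have "poly (\<Prod>t\<in>#A. [:- t, 1:]) 0 = (- 1) ^ size A * (\<Prod>t\<in>#A. t)"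
    by (induction A) auto
  then have "Polynomial.coeff g 0 = Polynomial.lead_coeff g * ((- 1) ^ m * e)"
    by (metis A e_def poly_0_coeff_0 poly_smult)
  moreover have "(- 1) ^ m * ((- 1) ^ m * e) = e"
    by (simp flip: mult.assoc power_mult_distrib)
  ultimately have e_eq: "e = (- 1) ^ m * Polynomial.coeff g 0 / Polynomial.lead_coeff g"
    using g'(1) by (metis mult.left_commute nonzero_mult_div_cancel_left leading_coeff_0_iff)
  have "e \<in> E"
    unfolding e_eq by (intro base_closed g'(3))
  have "(\<Prod>t\<in>#A. t) ^ p = (r ^ p) ^ size A"
    using root by (induction A) (auto simp: power_mult_distrib)
  then have "(r ^ m) ^ p = e ^ p" by (simp add: e_def A(1) mult.commute flip: power_mult)
  then have "r ^ m \<in> E" using radical_mem_iff \<open>e \<in> E\<close> by blast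
  then show False using coprime_power_mem[OF r(1)] m \<open>m \<noteq> 0\<close> r(2) by auto
qed

end

context kummer_base begin

lemma radical_coefficients_unique:
  assumes r: "r ^ p \<in> E" "r \<notin> E" and "\<And>i. c i \<in> E" "\<And>i. d i \<in> E"
    and "(\<Sum>i<p. c i * r ^ i) = (\<Sum>i<p. d i * r ^ i)" and "i < p"
  shows "c i = d i"
  using powers_of_radical_independent[OF r, of "\<lambda>i. c i - d i" i] assms base_closed(7)
  by (simp add: algebra_simps sum_subtractf)

text \<open>The extension is forced to map \<open>\<Sum> c\<^sub>i r\<^sup>i\<close> to \<open>\<Sum> \<sigma>(c\<^sub>i) (\<gamma> r)\<^sup>i\<close>, and this is well defined because the powers
  of \<open>r\<close> form a basis.\<close>

lemma galois_extend_to_radical: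
  assumes r: "r ^ p \<in> E" "r \<notin> E" and FE: "F \<subseteq> E" and \<sigma>: "\<sigma> \<in> Gal E F"
    and \<gamma>: "\<gamma> \<in> E" "\<gamma> \<noteq> 0" "\<sigma> (r ^ p) = \<gamma> ^ p * r ^ p"
  shows "\<exists>\<sigma>'\<in>Gal (adjoin E {r}) F. (\<forall>v\<in>E. \<sigma>' v = \<sigma> v) \<and> \<sigma>' r = \<gamma> * r"
proof -
  let ?K = "adjoin E {r}"
  note K = adjoin_subfield[of E "{r}"]
  note Kc = subfield_closed[OF K]
  note \<sigma>d = galois_groupD[OF base_subfield \<sigma>]
  have EK: "E \<subseteq> ?K" and rK: "r \<in> ?K" by (auto intro: subsetD[OF adjoin_base] adjoin_gen)
  have r0: "r \<noteq> 0" using r(2) base_closed(1) by auto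
  obtain co where co: "\<And>v. v \<in> ?K \<Longrightarrow> (\<forall>i. co v i \<in> E) \<and> v = (\<Sum>i<p. co v i * r ^ i)"
    using adjoin_radical_expansion[OF base_subfield p_gt_0 r(1)] by metis
  have co_sum: "(\<Sum>i<p. co v i * r ^ i) = v" if "v \<in> ?K" for v
    using co[OF that] by simp
  define s where "s = (\<lambda>v\<in>?K. \<Sum>i<p. \<sigma> (co v i) * (\<gamma> * r) ^ i)"
  have s_sum: "s (\<Sum>i<p. c i * r ^ i) = (\<Sum>i<p. \<sigma> (c i) * (\<gamma> * r) ^ i)" if c: "\<And>i. c i \<in> E" for c
  proof -
    define v where "v = (\<Sum>i<p. c i * r ^ i)"
    have v: "v \<in> ?K" unfolding v_def by (rule adjoin_radical_sum_mem[OF c])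
    have "c i = co v i" if "i < p" for i
      by (rule radical_coefficients_unique[OF r _ _ _ that]) (use co[OF v] c v_def in auto)
    then have "(\<Sum>i<p. \<sigma> (c i) * (\<gamma> * r) ^ i) = s v" using v by (simp add: s_def)
    then show ?thesis by (simp only: v_def)
  qed
  have s_add: "s (u + v) = s u + s v" if "u \<in> ?K" "v \<in> ?K" for u v
  proof -
    have eq: "u + v = (\<Sum>i<p. (co u i + co v i) * r ^ i)"
      by (simp add: distrib_right sum.distrib co_sum that)
    have "s (u + v) = (\<Sum>i<p. \<sigma> (co u i + co v i) * (\<gamma> * r) ^ i)"
      unfolding eq by (rule s_sum) (use co[OF that(1)] co[OF that(2)] base_closed(3) in auto)
    also have "\<dots> = (\<Sum>i<p. \<sigma> (co u i) * (\<gamma> * r) ^ i + \<sigma> (co v i) * (\<gamma> * r) ^ i)"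
      using co[OF that(1)] co[OF that(2)] by (intro sum.cong refl) (simp add: \<sigma>d(2) distrib_right)
    also have "\<dots> = s u + s v" using that by (simp add: s_def sum.distrib)
    finally show ?thesis .
  qed
  have "s 0 + s 0 = s 0 + 0" using s_add[of 0 0] Kc(1) by simp
  then have s0: "s 0 = 0" by (rule add_left_imp_eq)
  have s_setsum: "s (sum f I) = (\<Sum>i\<in>I. s (f i))" if "\<And>i. i \<in> I \<Longrightarrow> f i \<in> ?K" for f and I :: "nat set"
    using that by (induction I rule: infinite_finite_induct) (auto simp: s0 s_add subfield_sum[OF K])
  \<comment> \<open>The hypothesis on \<open>\<gamma>\<close> enters here: reducing \<open>r ^ n\<close> modulo \<open>r ^ p\<close> commutes with the map.\<close>
  have s_monom: "s (e * r ^ n) = \<sigma> e * (\<gamma> * r) ^ n" if e: "e \<in> E" for e n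
  proof -
    define q m where "q = n div p" and "m = n mod p"
    have m: "m < p" and n: "n = p * q + m" using p_gt_0 by (auto simp: q_def m_def)
    let ?e = "e * (r ^ p) ^ q"
    have e': "?e \<in> E" using e r(1) by (intro base_closed(4) base_closed(9)[of "r ^ p"])
    have "e * r ^ n = ?e * r ^ m" by (simp add: n power_add power_mult)
    also have "\<dots> = (\<Sum>i<p. if m = i then ?e * r ^ i else 0)" using m by simp
    also have "\<dots> = (\<Sum>i<p. (if m = i then ?e else 0) * r ^ i)" by (intro sum.cong) auto
    also have "s \<dots> = (\<Sum>i<p. \<sigma> (if m = i then ?e else 0) * (\<gamma> * r) ^ i)"
      by (rule s_sum) (use e' base_closed(1) in auto)
    also have "\<dots> = (\<Sum>i<p. if m = i then \<sigma> ?e * (\<gamma> * r) ^ i else 0)"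
      by (intro sum.cong) (auto simp: \<sigma>d(5))
    also have "\<dots> = \<sigma> ?e * (\<gamma> * r) ^ m" using m by simp
    also have "\<sigma> ?e = \<sigma> e * (\<gamma> ^ p * r ^ p) ^ q"
      using e r(1) \<gamma>(3) \<sigma>d(3)[OF e base_closed(9)[OF r(1)]] \<sigma>d(10)[OF r(1)] by simp
    also have "\<sigma> e * (\<gamma> ^ p * r ^ p) ^ q * (\<gamma> * r) ^ m = \<sigma> e * (\<gamma> * r) ^ n"
      by (simp add: n power_add power_mult power_mult_distrib)
    finally show ?thesis .
  qed
  have s_mul: "s (u * v) = s u * s v" if u: "u \<in> ?K" and v: "v \<in> ?K" for u v
  proof -
    let ?c = "co u" and ?d = "co v"
    have c: "?c i \<in> E" and d: "?d i \<in> E" for i using co[OF u] co[OF v] by auto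
    have mem: "?c i * ?d j * r ^ (i + j) \<in> ?K" for i j
      using c d EK rK by (intro Kc) auto
    have "u * v = (\<Sum>i<p. \<Sum>j<p. ?c i * ?d j * r ^ (i + j))"
      by (subst (1 2) co_sum[symmetric]) (simp_all add: u v sum_product power_add mult_ac)
    then have "s (u * v) = (\<Sum>i<p. \<Sum>j<p. s (?c i * ?d j * r ^ (i + j)))"
      by (simp add: s_setsum mem subfield_sum[OF K])
    also have "\<dots> = (\<Sum>i<p. \<Sum>j<p. (\<sigma> (?c i) * (\<gamma> * r) ^ i) * (\<sigma> (?d j) * (\<gamma> * r) ^ j))"
      by (intro sum.cong refl, subst s_monom[OF base_closed(4)[OF c d]])
         (simp add: \<sigma>d(3)[OF c d] power_add mult_ac)
    also have "\<dots> = s u * s v" using u v by (simp add: s_def sum_product)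
    finally show ?thesis .
  qed
  have s_E: "s v = \<sigma> v" if "v \<in> E" for v using s_monom[OF that, of 0] by simp
  have s_r: "s r = \<gamma> * r" using s_monom[OF base_closed(2), of 1] \<sigma>d(4) by simp
  have s_nz: "s u \<noteq> 0" if "u \<in> ?K" "u \<noteq> 0" for u
    using s_mul[OF that(1) Kc(6)[OF that(1)]] that(2) s_E[OF base_closed(2)] \<sigma>d(4) by auto
  have bij: "bij_betw s ?K ?K"
  proof (rule bij_betw_imageI)
    show "inj_on s ?K"
    proof (rule inj_onI)
      fix u v assume uv: "u \<in> ?K" "v \<in> ?K" "s u = s v"
      have "s u = s (u - v) + s v" using s_add[OF Kc(7)[OF uv(1,2)] uv(2)] by simp
      then show "u = v" using s_nz[OF Kc(7)[OF uv(1,2)]] uv(3) by auto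
    qed
    show "s ` ?K = ?K"
    proof
      show "s ` ?K \<subseteq> ?K"
        using co \<sigma>d(1) EK rK \<gamma>(1)
        by (auto simp: s_def power_mult_distrib intro!: subfield_sum[OF K] Kc)
      show "?K \<subseteq> s ` ?K"
      proof
        fix v assume v: "v \<in> ?K"
        have im: "\<sigma> ` E = E" using \<sigma> by (auto simp: galois_group_iff bij_betw_def)
        define c where "c = (\<lambda>i. inv_into E \<sigma> (co v i / \<gamma> ^ i))"
        have "co v i / \<gamma> ^ i \<in> \<sigma> ` E" for i using co[OF v] \<gamma>(1) by (simp add: im base_closed)
        then have c: "c i \<in> E" "\<sigma> (c i) = co v i / \<gamma> ^ i" for i
          by (auto simp: c_def f_inv_into_f inv_into_into)
        have "s (\<Sum>i<p. c i * r ^ i) = (\<Sum>i<p. co v i * r ^ i)"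
          using \<gamma>(2) by (simp add: s_sum c power_mult_distrib)
        also have "\<dots> = v" using co[OF v] by simp
        finally show "v \<in> s ` ?K" using adjoin_radical_sum_mem[where c = c and p = p and r = r] c(1) by force
      qed
    qed
  qed
  have "s \<in> Gal ?K F"
    unfolding galois_group_iff
    using bij s_add s_mul s_E base_closed(2) \<sigma>d(4,11) FE by (auto simp: s_def subset_iff)
  then show ?thesis using s_E s_r by blast
qed

lemma identity_in_galois_group: "(\<lambda>u\<in>E. u) \<in> Gal E E"
  using base_closed by (auto simp: galois_group_iff bij_betw_def inj_on_def)

lemma radical_generator_exists:
  assumes "r ^ p \<in> E" "r \<notin> E"
  shows "\<exists>\<tau>\<in>Gal (adjoin E {r}) E. \<tau> r = \<zeta> * r"
  using galois_extend_to_radical[OF assms order_refl identity_in_galois_group zeta_mem zeta_nonzero]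
    assms(1) zeta_pow_p by auto

text \<open>Comparing coefficients: \<open>g\<close> multiplies the coefficient of \<open>r\<^sup>i\<close> by \<open>\<zeta>\<^sup>i\<close>, which is \<open>1\<close> only for \<open>i = 0\<close>.\<close>

lemma fixed_by_radical_generator:
  assumes r: "r ^ p \<in> E" "r \<notin> E" and g: "g \<in> Gal (adjoin E {r}) E" "g r = \<zeta> * r"
    and v: "v \<in> adjoin E {r}" "g v = v"
  shows "v \<in> E"
proof -
  note gd = galois_groupD[OF adjoin_subfield g(1)]
  have EK: "E \<subseteq> adjoin E {r}" and rK: "r \<in> adjoin E {r}" by (auto intro: subsetD[OF adjoin_base] adjoin_gen)
  obtain c where c: "\<And>i. c i \<in> E" "v = (\<Sum>i<p. c i * r ^ i)"
    using adjoin_radical_expansion[OF base_subfield p_gt_0 r(1) v(1)] by auto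
  have "g v = (\<Sum>i<p. g (c i * r ^ i))"
    unfolding c(2)
    using c(1) EK rK by (intro galois_group_sum[OF adjoin_subfield g(1)] subfield_closed[OF adjoin_subfield]) auto
  also have "\<dots> = (\<Sum>i<p. (c i * \<zeta> ^ i) * r ^ i)"
  proof (intro sum.cong refl)
    fix i
    show "g (c i * r ^ i) = (c i * \<zeta> ^ i) * r ^ i"
      using gd(3)[of "c i" "r ^ i"] gd(10)[OF rK] gd(11)[OF c(1)] c(1) EK rK g(2)
        subfield_closed(9)[OF adjoin_subfield rK]
      by (auto simp: power_mult_distrib mult.assoc)
  qed
  finally have eq: "(\<Sum>i<p. c i * r ^ i) = (\<Sum>i<p. (c i * \<zeta> ^ i) * r ^ i)" using v(2) c(2) by simp
  have "c i = 0" if "i < p" "i \<noteq> 0" for i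
  proof -
    have "c i = c i * \<zeta> ^ i"
      by (rule radical_coefficients_unique[OF r c(1) _ eq that(1)])
         (intro base_closed c(1) zeta_mem)
    moreover have "\<zeta> ^ i \<noteq> 1" using that zeta_pow_eq_1_iff[of i] by (auto dest: dvd_imp_le)
    ultimately show ?thesis by simp
  qed
  then have "v = (\<Sum>i<p. if i = 0 then c 0 else 0)"
    unfolding c(2) by (intro sum.cong) auto
  then show ?thesis using c(1) p_gt_0 by simp
qed

text \<open>The hypothesis on \<open>\<gamma>\<close> makes every automorphism of \<open>E\<close> extend to \<open>E(r)\<close>. An element fixed by all
  automorphisms of \<open>E(r)\<close> lies in \<open>E\<close>, by \<open>fixed_by_radical_generator\<close>, and then in \<open>F\<close>, because it is fixed by
  the extensions of all automorphisms of \<open>E\<close>.\<close>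

lemma galois_radical_step:
  assumes gal: "finite_galois E F" and r: "r ^ p \<in> E" "r \<notin> E"
    and ext: "\<And>\<sigma>. \<sigma> \<in> Gal E F \<Longrightarrow> \<exists>\<gamma>\<in>E - {0}. \<sigma> (r ^ p) = \<gamma> ^ p * r ^ p"
  shows "finite_galois (adjoin E {r}) F"
proof -
  interpret R: ring "ring_of_type_algebra :: 'a ring" by (rule ring_from_type_algebra)
  let ?K = "adjoin E {r}"
  have F: "subfield_of_type F" "F \<subseteq> E" "R.finite_dimension F E"
    and fix_E: "fixed_field E (Gal E F) = F"
    using gal by (auto simp: finite_galois_def)
  have EK: "E \<subseteq> ?K" by (rule adjoin_base)
  have "v \<in> F" if v: "v \<in> ?K" and fixed: "\<And>g. g \<in> Gal ?K F \<Longrightarrow> g v = v" for v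
  proof -
    obtain \<tau> where \<tau>: "\<tau> \<in> Gal ?K E" "\<tau> r = \<zeta> * r"
      using radical_generator_exists[OF r] by auto
    then have "\<tau> \<in> Gal ?K F" using F(2) by (auto simp: galois_group_iff)
    then have vE: "v \<in> E" using fixed_by_radical_generator[OF r \<tau> v] fixed by auto
    have "\<sigma> v = v" if \<sigma>: "\<sigma> \<in> Gal E F" for \<sigma>
    proof -
      obtain \<gamma> where "\<gamma> \<in> E" "\<gamma> \<noteq> 0" "\<sigma> (r ^ p) = \<gamma> ^ p * r ^ p" using ext[OF \<sigma>] by auto
      from galois_extend_to_radical[OF r F(2) \<sigma> this] show ?thesis using fixed vE by metis
    qed
    then show "v \<in> F" using vE fix_E by (auto simp: fixed_field_def)
  qed
  then have "fixed_field ?K (Gal ?K F) = F"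
    using F(2) EK by (auto simp: fixed_field_def galois_group_iff)
  moreover have "R.finite_dimension F ?K"
    using R.telescopic_base_dim(1)[OF F(1) base_subfield F(3)]
      adjoin_radical_finite_dimension[OF base_subfield p_gt_0 r(1)] .
  ultimately show ?thesis
    using F EK adjoin_subfield[of E "{r}"] by (auto simp: finite_galois_def)
qed

lemma kummer_base_extend:
  assumes "subfield_of_type K" "E \<subseteq> K" shows "kummer_base p \<zeta> K"
  using assms prime_p roots_of_unity primitive by (auto simp: kummer_base_def)

lemma finite_galois_refl: "finite_galois E E"
proof -
  interpret R: ring "ring_of_type_algebra :: 'a ring" by (rule ring_from_type_algebra)
  have "R.finite_dimension E E"
    using R.dimension_one[OF base_subfield] by (rule R.finite_dimensionI)
  then show ?thesis
    using base_subfield by (auto simp: finite_galois_def fixed_field_def galois_group_iff)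
qed

text \<open>The third conclusion is the core of Kummer theory: the elements of the base field that
  acquire a \<open>p\<close>-th root in the extension are the evident ones. It is what makes the next radical of an
  independent family generate a proper extension, so the three statements are proved together.\<close>

lemma kummer_tower:
  assumes "independent_mod_powers p E (map (\<lambda>r. r ^ p) rs)" and "\<And>r. r \<in> set rs \<Longrightarrow> r ^ p \<in> E \<and> r \<noteq> 0"
  shows "finite_galois (adjoin E (set rs)) E \<and>
    (\<forall>e. \<exists>\<sigma>\<in>Gal (adjoin E (set rs)) E. \<forall>i<length rs. \<sigma> (rs ! i) = \<zeta> ^ e i * rs ! i) \<and>
    (\<forall>s\<in>adjoin E (set rs). s ^ p \<in> E \<longrightarrow> (\<exists>t\<in>E. \<exists>e. s = t * (\<Prod>i<length rs. rs ! i ^ e i)))"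
  using assms
proof (induction rs rule: rev_induct)
  case Nil
  then show ?case
    using finite_galois_refl identity_in_galois_group
    by (auto simp: adjoin_empty[OF base_subfield])
next
  case (snoc r rs)
  let ?n = "length rs"
  let ?K = "adjoin E (set rs)"
  have r: "r ^ p \<in> E" "r \<noteq> 0" using snoc.prems(2)[of r] by auto
  have nth: "(rs @ [r]) ! i = rs ! i" if "i < ?n" for i using that by (simp add: nth_append)
  have "independent_mod_powers p E (map (\<lambda>r. r ^ p) rs)"
    unfolding independent_mod_powers_def
  proof (intro allI impI)
    fix e i
    assume e: "(\<Prod>i<length (map (\<lambda>r. r ^ p) rs). map (\<lambda>r. r ^ p) rs ! i ^ e i) \<in> power_units p E"
      and i: "i < length (map (\<lambda>r. r ^ p) rs)"
    let ?e = "\<lambda>j. if j < ?n then e j else 0"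
    have "(\<Prod>i<length (map (\<lambda>r. r ^ p) (rs @ [r])). map (\<lambda>r. r ^ p) (rs @ [r]) ! i ^ ?e i) \<in> power_units p E"
      using e by (simp add: nth_append)
    then have "\<forall>i<length (map (\<lambda>r. r ^ p) (rs @ [r])). p dvd ?e i"
      using snoc.prems(1)[unfolded independent_mod_powers_def, rule_format, of ?e] by blast
    then show "p dvd e i" using i by (auto dest: spec[of _ i])
  qed
  then have gal: "finite_galois ?K E"
    and lift: "\<And>e. \<exists>\<sigma>\<in>Gal ?K E. \<forall>i<?n. \<sigma> (rs ! i) = \<zeta> ^ e i * rs ! i"
    and rad: "\<And>s. s \<in> ?K \<Longrightarrow> s ^ p \<in> E \<Longrightarrow> \<exists>t\<in>E. \<exists>e. s = t * (\<Prod>i<?n. rs ! i ^ e i)"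
    using snoc.IH snoc.prems(2) by auto
  interpret K: kummer_base p \<zeta> ?K by (rule kummer_base_extend[OF adjoin_subfield adjoin_base])
  have EK: "E \<subseteq> ?K" by (rule adjoin_base)
  have "r \<notin> ?K"
  proof
    assume "r \<in> ?K"
    then obtain t e where te: "t \<in> E" "r = t * (\<Prod>i<?n. rs ! i ^ e i)" using rad r by blast
    \<comment> \<open>Writing \<open>r\<close> with exponents \<open>e\<close> gives a relation with exponent \<open>1\<close> at \<open>r\<close>; the exponents
      \<open>(p - 1) * e i\<close> replace \<open>- e i\<close>, which is not a natural number.\<close>
    let ?e = "\<lambda>j. if j < ?n then (p - 1) * e j else 1"
    have "(\<Prod>i<length (map (\<lambda>r. r ^ p) (rs @ [r])). map (\<lambda>r. r ^ p) (rs @ [r]) ! i ^ ?e i)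
        = (\<Prod>i<?n. (rs ! i ^ p) ^ ((p - 1) * e i)) * r ^ p"
      by (simp add: nth_append)
    also have "(\<Prod>i<?n. (rs ! i ^ p) ^ ((p - 1) * e i)) = ((\<Prod>i<?n. rs ! i ^ e i) ^ (p - 1)) ^ p"
      by (simp add: prod_power_distrib mult_ac flip: power_mult)
    also have "\<dots> * r ^ p = ((\<Prod>i<?n. rs ! i ^ e i) ^ p * t) ^ p"
      using p_gt_0 by (cases p) (simp_all add: te(2) power_mult_distrib mult_ac)
    finally have eq: "(\<Prod>i<length (map (\<lambda>r. r ^ p) (rs @ [r])). map (\<lambda>r. r ^ p) (rs @ [r]) ! i ^ ?e i)
        = ((\<Prod>i<?n. rs ! i ^ e i) ^ p * t) ^ p" .
    have "(\<Prod>i<?n. rs ! i ^ e i) ^ p = (\<Prod>i<?n. (rs ! i ^ p) ^ e i)"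
      by (simp add: prod_power_distrib mult.commute flip: power_mult)
    also have "\<dots> \<in> E"
      using snoc.prems(2) by (intro subfield_prod[OF base_subfield] base_closed(9)[of "_ ^ p"]) auto
    finally have "(\<Prod>i<?n. rs ! i ^ e i) ^ p * t \<in> E - {0}"
      using te r(2) base_closed(4) by (auto simp: p_gt_0)
    then have "\<forall>i<length (map (\<lambda>r. r ^ p) (rs @ [r])). p dvd ?e i"
      using snoc.prems(1)[unfolded independent_mod_powers_def, rule_format, of ?e] eq
      unfolding power_units_def by blast
    then have "p dvd 1" by (auto dest: spec[of _ ?n])
    then show False using p_gt_1 by simp
  qed
  note rK = subsetD[OF EK r(1)] this
  let ?L = "adjoin ?K {r}"
  have L: "adjoin E (set (rs @ [r])) = ?L" by (simp add: adjoin_adjoin)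
  have KL: "?K \<subseteq> ?L" and rL: "r \<in> ?L" by (auto intro: subsetD[OF adjoin_base] adjoin_gen)
  have fixed_rp: "\<sigma> (r ^ p) = (\<zeta> ^ k) ^ p * r ^ p" if "\<sigma> \<in> Gal ?K E" for \<sigma> k
  proof -
    have "(\<zeta> ^ k) ^ p = 1" by (metis mult.commute power_mult power_one zeta_pow_p)
    then show ?thesis using galois_groupD(11)[OF adjoin_subfield that r(1)] by simp
  qed
  have zK: "\<zeta> ^ k \<in> ?K" "\<zeta> ^ k \<noteq> 0" for k using K.base_closed(9)[OF K.zeta_mem] zeta_nonzero by auto
  have "finite_galois ?L E"
    using zK fixed_rp by (intro K.galois_radical_step[OF gal rK]) blast
  moreover have "\<exists>\<sigma>\<in>Gal ?L E. \<forall>i<Suc ?n. \<sigma> ((rs @ [r]) ! i) = \<zeta> ^ e i * (rs @ [r]) ! i" for e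
  proof -
    obtain \<sigma> where \<sigma>: "\<sigma> \<in> Gal ?K E" "\<And>i. i < ?n \<Longrightarrow> \<sigma> (rs ! i) = \<zeta> ^ e i * rs ! i"
      using lift[of e] by auto
    obtain \<sigma>' where \<sigma>': "\<sigma>' \<in> Gal ?L E" "\<And>v. v \<in> ?K \<Longrightarrow> \<sigma>' v = \<sigma> v"
        "\<sigma>' r = \<zeta> ^ e ?n * r"
      using K.galois_extend_to_radical[OF rK EK \<sigma>(1) zK[of "e ?n"] fixed_rp[OF \<sigma>(1)]] by auto
    have "\<sigma>' ((rs @ [r]) ! i) = \<zeta> ^ e i * (rs @ [r]) ! i" if "i < Suc ?n" for i
    proof (cases "i = ?n")
      case False
      then have "i < ?n" using that by simp
      moreover from this have "rs ! i \<in> ?K" using adjoin_gens[of "set rs" E] by auto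
      ultimately show ?thesis using \<sigma>'(2) \<sigma>(2) by (simp add: nth_append)
    qed (simp add: \<sigma>'(3))
    then show ?thesis using \<sigma>'(1) by blast
  qed
  moreover have "\<exists>t\<in>E. \<exists>e. s = t * (\<Prod>i<Suc ?n. (rs @ [r]) ! i ^ e i)" if s: "s \<in> ?L" "s ^ p \<in> E" for s
  proof -
    obtain \<tau> where \<tau>: "\<tau> \<in> carrier (galois_group ?L ?K)" "\<tau> r = \<zeta> * r"
      using K.radical_generator_exists[OF rK] by auto
    note \<tau>d = galois_groupD[OF adjoin_subfield \<tau>(1)]
    have "\<tau> s ^ p = s ^ p" using \<tau>d(10)[OF s(1), of p] \<tau>d(11)[OF subsetD[OF EK s(2)]] by simp
    then obtain k where k: "\<tau> s = \<zeta> ^ k * s" using pth_roots_differ_by_zeta by blast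
    have rk: "r ^ k \<in> ?L" "r ^ k \<noteq> 0" using rL r(2) by (auto intro: subfield_closed[OF adjoin_subfield])
    have "\<tau> (s / r ^ k) = s / r ^ k"
      using \<tau>d(9)[OF s(1) rk(1)] \<tau>d(10)[OF rL, of k] \<tau>(2) k zeta_nonzero by (simp add: power_mult_distrib)
    then have "s / r ^ k \<in> ?K"
      using K.fixed_by_radical_generator[OF rK \<tau>] subfield_closed(8)[OF adjoin_subfield s(1) rk(1)] by blast
    moreover have "(s / r ^ k) ^ p = s ^ p / (r ^ p) ^ k"
      by (simp add: power_divide mult.commute flip: power_mult)
    then have "(s / r ^ k) ^ p \<in> E" using s(2) r(1) base_closed(8,9) by simp
    ultimately obtain t e where te: "t \<in> E" "s / r ^ k = t * (\<Prod>i<?n. rs ! i ^ e i)"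
      using rad by blast
    let ?e = "\<lambda>i. if i < ?n then e i else k"
    have "s = t * (\<Prod>i<Suc ?n. (rs @ [r]) ! i ^ ?e i)"
      using te(2) rk(2) by (simp add: nth_append field_simps)
    then show ?thesis using te(1) by (intro bexI[of _ t] exI[of _ ?e])
  qed
  ultimately show ?case unfolding L by simp
qed

end

section \<open>Norms and the elements \<open>W(f)\<close>\<close>

text \<open>The computation behind \<open>\<rho>(W(f)) f\<^sup>p = W(f) N(f)\<close>, with \<open>a i = \<rho>\<^sup>i(f)\<close> and \<open>n = p - 1\<close>: multiplying the
  shifted product by \<open>a 0 ^ Suc n\<close> raises every exponent of the original product by one.\<close>

lemma prod_shifted_powers:
  fixes a :: "nat \<Rightarrow> 'a::comm_monoid_mult"
  shows "(\<Prod>i<n. a (Suc i) ^ (n - i)) * a 0 ^ Suc n = (\<Prod>i<n. a i ^ (n - i)) * (\<Prod>i<Suc n. a i)"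
proof -
  have "(\<Prod>i<n. a (Suc i) ^ (n - i)) * a 0 ^ Suc n = (\<Prod>i<Suc n. a i ^ (Suc n - i))"
    by (simp only: prod.lessThan_Suc_shift) (simp add: mult.commute)
  also have "\<dots> = (\<Prod>i<Suc n. a i ^ (n - i) * a i)"
    by (intro prod.cong refl) (simp add: Suc_diff_le mult.commute)
  also have "\<dots> = (\<Prod>i<n. a i ^ (n - i)) * (\<Prod>i<Suc n. a i)"
    by (simp add: prod.distrib mult_ac)
  finally show ?thesis .
qed

lemma galois_funpow_mem:
  assumes "subfield_of_type K" "g \<in> Gal K F" "u \<in> K"
  shows "(g ^^ i) u \<in> K"
  by (induction i) (use assms(3) galois_groupD(1)[OF assms(1,2)] in auto)

lemma galois_pow_apply:
  assumes "subfield_of_type K" "F \<subseteq> K" "g \<in> Gal K F" "u \<in> K"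
  shows "(g [^]\<^bsub>galois_group K F\<^esub> n) u = (g ^^ n) u"
proof -
  interpret G: group "galois_group K F" by (rule galois_group_group[OF assms(1,2)])
  show ?thesis
    using assms(4)
  proof (induction n arbitrary: u)
    case (Suc n)
    have "(g [^]\<^bsub>galois_group K F\<^esub> Suc n) u = (g [^]\<^bsub>galois_group K F\<^esub> n) (g u)"
      using galois_mult_apply[OF G.nat_pow_closed[OF assms(3)] assms(3) Suc.prems] by simp
    then show ?case
      using Suc.IH galois_groupD(1)[OF assms(1,3) Suc.prems] by (simp add: funpow_swap1)
  qed (simp)
qed

lemma galois_funpow_root:
  assumes "subfield_of_type K" "g \<in> Gal K F" "\<xi> \<in> F" "\<xi> \<in> K" "r \<in> K" "g r = \<xi> * r"
  shows "(g ^^ i) r = \<xi> ^ i * r"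
proof (induction i)
  case (Suc i)
  note gd = galois_groupD[OF assms(1,2)]
  have "g (\<xi> ^ i * r) = \<xi> ^ i * (\<xi> * r)"
    using gd(3)[OF subfield_closed(9)[OF assms(1,4)] assms(5)] gd(10)[OF assms(4)] gd(11)[OF assms(3)] assms(6)
    by simp
  then show ?case using Suc by simp
qed simp

context kummer_base begin

text \<open>All facts about \<open>rho\<close>, \<open>field_norm\<close> and \<open>W_elem\<close> are expressed by means of an automorphism \<open>g\<close> of an
  arbitrary larger field, because the automorphisms of interest move several radicals at once.\<close>

context
  fixes r K g
  assumes r: "r ^ p \<in> E" "r \<notin> E" and K: "subfield_of_type K" "adjoin E {r} \<subseteq> K"
    and g: "g \<in> Gal K E" "g r = \<zeta> * r"
begin

lemma rho_in_galois_group: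
  "rho E \<zeta> r \<in> Gal (adjoin E {r}) E" "rho E \<zeta> r r = \<zeta> * r"
proof -
  have uniq: "\<sigma> = \<tau>" if "\<sigma> \<in> Gal (adjoin E {r}) E" "\<tau> \<in> Gal (adjoin E {r}) E"
      "\<sigma> r = \<zeta> * r" "\<tau> r = \<zeta> * r" for \<sigma> \<tau>
    using that by (intro galois_group_eq_on_gens[OF that(1,2)]) auto
  obtain \<tau> where "\<tau> \<in> Gal (adjoin E {r}) E \<and> \<tau> r = \<zeta> * r"
    using radical_generator_exists[OF r] by auto
  from theI[of "\<lambda>\<sigma>. \<sigma> \<in> Gal (adjoin E {r}) E \<and> \<sigma> r = \<zeta> * r", OF this]
  show "rho E \<zeta> r \<in> Gal (adjoin E {r}) E" "rho E \<zeta> r r = \<zeta> * r"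
    using uniq \<open>\<tau> \<in> _ \<and> _\<close> by (auto simp: rho_def)
qed

lemma rho_agrees:
  assumes u: "u \<in> adjoin E {r}" shows "rho E \<zeta> r u = g u"
proof (rule galois_group_agree_on_adjoin[OF adjoin_subfield rho_in_galois_group(1) K(1) g(1) _ _ _ u])
  show sub: "E \<union> {r} \<subseteq> adjoin E {r}" using adjoin_base[of E "{r}"] adjoin_gens[of "{r}" E] by auto
  then show "E \<union> {r} \<subseteq> K" using K(2) by blast
  show "rho E \<zeta> r u = g u" if "u \<in> E \<union> {r}" for u
    using that rho_in_galois_group(2) g(2) galois_groupD(11)[OF K(1) g(1)]
      galois_groupD(11)[OF adjoin_subfield rho_in_galois_group(1)] by auto
qed

lemma rho_funpow_agrees:
  assumes "u \<in> adjoin E {r}" shows "(rho E \<zeta> r ^^ i) u = (g ^^ i) u"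
proof (induction i)
  case (Suc i)
  have "(rho E \<zeta> r ^^ Suc i) u = g ((rho E \<zeta> r ^^ i) u)"
    using rho_agrees[OF galois_funpow_mem[OF adjoin_subfield rho_in_galois_group(1) assms]] by simp
  then show ?case using Suc by simp
qed simp

lemma field_norm_radical:
  assumes f: "f \<in> adjoin E {r}"
  shows "field_norm (adjoin E {r}) E f = (\<Prod>i<p. (g ^^ i) f)"
proof -
  let ?B = "adjoin E {r}" and ?\<rho> = "rho E \<zeta> r"
  let ?G = "galois_group ?B E"
  note \<rho> = rho_in_galois_group
  interpret G: group ?G by (rule galois_group_group[OF adjoin_subfield adjoin_base])
  have rB: "r \<in> ?B" and zB: "\<zeta> \<in> ?B" using zeta_mem by (auto intro: adjoin_gen subsetD[OF adjoin_base])
  have r0: "r \<noteq> 0" using r(2) base_closed(1) by auto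
  have pow_r: "(?\<rho> [^]\<^bsub>?G\<^esub> i) r = \<zeta> ^ i * r" for i :: nat
    using galois_pow_apply[OF adjoin_subfield adjoin_base \<rho>(1) rB]
      galois_funpow_root[OF adjoin_subfield \<rho>(1) zeta_mem zB rB \<rho>(2)] by simp
  have "bij_betw (\<lambda>i. ?\<rho> [^]\<^bsub>?G\<^esub> i) {..<p} (carrier ?G)"
  proof (rule bij_betw_imageI)
    show "inj_on (\<lambda>i. ?\<rho> [^]\<^bsub>?G\<^esub> i) {..<p}"
    proof (rule inj_onI)
      fix i j assume ij: "i \<in> {..<p}" "j \<in> {..<p}" "?\<rho> [^]\<^bsub>?G\<^esub> i = ?\<rho> [^]\<^bsub>?G\<^esub> j"
      then have "\<zeta> ^ i = \<zeta> ^ j" using pow_r[of i] pow_r[of j] r0 by simp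
      then show "i = j" using zeta_pow_inj ij(1,2) by (auto dest: inj_onD)
    qed
    show "(\<lambda>i. ?\<rho> [^]\<^bsub>?G\<^esub> i) ` {..<p} = carrier ?G"
    proof
      show "(\<lambda>i. ?\<rho> [^]\<^bsub>?G\<^esub> i) ` {..<p} \<subseteq> carrier ?G" using \<rho>(1) by auto
      show "carrier ?G \<subseteq> (\<lambda>i. ?\<rho> [^]\<^bsub>?G\<^esub> i) ` {..<p}"
      proof
        fix \<sigma> assume \<sigma>: "\<sigma> \<in> carrier ?G"
        have "\<sigma> r ^ p = r ^ p"
          using galois_groupD(10)[OF adjoin_subfield \<sigma> rB, of p] galois_groupD(11)[OF adjoin_subfield \<sigma> r(1)] by simp
        then obtain k where k: "k < p" "\<sigma> r = \<zeta> ^ k * r" using pth_roots_differ_by_zeta by blast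
        have \<rho>k: "?\<rho> [^]\<^bsub>?G\<^esub> k \<in> carrier ?G" using \<rho>(1) by simp
        have "\<sigma> = ?\<rho> [^]\<^bsub>?G\<^esub> k"
          using k pow_r by (intro galois_group_eq_on_gens[OF \<sigma> \<rho>k]) auto
        then show "\<sigma> \<in> (\<lambda>i. ?\<rho> [^]\<^bsub>?G\<^esub> i) ` {..<p}" using k(1) by auto
      qed
    qed
  qed
  then have "field_norm ?B E f = (\<Prod>i<p. (?\<rho> [^]\<^bsub>?G\<^esub> i) f)"
    unfolding field_norm_def by (rule prod.reindex_bij_betw[symmetric])
  also have "\<dots> = (\<Prod>i<p. (g ^^ i) f)"
    using galois_pow_apply[OF adjoin_subfield adjoin_base \<rho>(1) f] rho_funpow_agrees[OF f] by simp
  finally show ?thesis .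
qed

lemma W_elem_eq:
  assumes f: "f \<in> adjoin E {r}"
  shows "W_elem E \<zeta> p r f = (\<Prod>i<p - 1. (g ^^ i) f ^ (p - 1 - i))"
proof -
  have "{0..p - 2} = {..<p - 1}" using p_gt_1 by auto
  then show ?thesis unfolding W_elem_def by (simp add: rho_funpow_agrees[OF f])
qed

lemma W_elem_generator:
  assumes f: "f \<in> adjoin E {r}"
  shows "g (W_elem E \<zeta> p r f) * f ^ p = W_elem E \<zeta> p r f * field_norm (adjoin E {r}) E f"
proof -
  have mem: "(g ^^ i) f \<in> K" for i using galois_funpow_mem[OF K(1) g(1)] f K(2) by auto
  have "g (W_elem E \<zeta> p r f) = (\<Prod>i<p - 1. (g ^^ Suc i) f ^ (p - 1 - i))"
    unfolding W_elem_eq[OF f]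
    using mem by (subst galois_group_prod[OF K(1) g(1)])
      (auto simp: galois_groupD(10)[OF K(1) g(1)] intro: subfield_closed[OF K(1)])
  then show ?thesis
    using prod_shifted_powers[of "\<lambda>i. (g ^^ i) f" "p - 1"] p_gt_0
    by (simp add: field_norm_radical[OF f] W_elem_eq[OF f])
qed

end

lemma W_elem_mem:
  assumes r: "r ^ p \<in> E" "r \<notin> E" and f: "f \<in> adjoin E {r}"
  shows "W_elem E \<zeta> p r f \<in> adjoin E {r}" "f \<noteq> 0 \<Longrightarrow> W_elem E \<zeta> p r f \<noteq> 0"
proof -
  obtain g where g: "g \<in> Gal (adjoin E {r}) E" "g r = \<zeta> * r"
    using radical_generator_exists[OF r] by auto
  note eq = W_elem_eq[OF r adjoin_subfield order_refl g f]
  have mem: "(g ^^ i) f \<in> adjoin E {r}" for i by (rule galois_funpow_mem[OF adjoin_subfield g(1) f])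
  then show "W_elem E \<zeta> p r f \<in> adjoin E {r}"
    unfolding eq by (intro subfield_prod[OF adjoin_subfield] subfield_closed(9)[OF adjoin_subfield])
  have "(g ^^ i) f \<noteq> 0" if "f \<noteq> 0" for i
    using that mem by (induction i) (auto simp: galois_groupD(12)[OF adjoin_subfield g(1)])
  then show "W_elem E \<zeta> p r f \<noteq> 0" if "f \<noteq> 0" unfolding eq using that by simp
qed


section \<open>Fields generated by an eigenvector\<close>

text \<open>An automorphism of order \<open>p\<close> is diagonalisable, since \<open>p\<close> is invertible and its eigenvalues, the powers
  of \<open>\<zeta>\<close>, lie in the base field. The components of \<open>v\<close> are its Lagrange resolvents \<open>P i\<close>, with eigenvalue
  \<open>\<zeta>\<^sup>i\<close>; dividing by the eigenvector \<open>r\<^sup>i\<close> gives an element of the fixed field.\<close>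

lemma adjoin_eigenvector:
  assumes p: "of_nat p \<noteq> (0 :: 'a)" and K: "subfield_of_type K" "E \<subseteq> K"
    and g: "g \<in> Gal K E" "\<And>v. v \<in> K \<Longrightarrow> (g ^^ p) v = v"
    and r: "r \<in> K" "r \<noteq> 0" "g r = \<zeta> * r"
  shows "K = adjoin (fixed_field K {g}) {r}"
proof
  let ?L = "fixed_field K {g}"
  note Kc = subfield_closed[OF K(1)] and gd = galois_groupD[OF K(1) g(1)]
  have L: "subfield_of_type ?L" by (rule fixed_field_subfield[OF K(1)]) (use g in auto)
  note Ac = subfield_closed[OF adjoin_subfield[of ?L "{r}"]]
  show "adjoin ?L {r} \<subseteq> K" using r(1) by (intro adjoin_least[OF K(1)]) (auto simp: fixed_field_def)
  have zK: "\<zeta> \<in> K" using zeta_mem K(2) by auto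
  show "K \<subseteq> adjoin ?L {r}"
  proof
    fix v assume v: "v \<in> K"
    define \<xi> where "\<xi> = inverse \<zeta>"
    have \<xi>: "\<xi> \<in> E" "\<xi> \<in> K" "\<xi> ^ p = 1" "\<xi> * \<zeta> = 1" "\<zeta> * \<xi> = 1"
      using zeta_mem zK zeta_nonzero zeta_pow_p base_closed(6) Kc(6) by (auto simp: \<xi>_def power_inverse)
    have gv: "(g ^^ k) v \<in> K" for k by (rule galois_funpow_mem[OF K(1) g(1) v])
    define P where "P i = (\<Sum>k<p. \<xi> ^ (i * k) * (g ^^ k) v)" for i
    have PK: "P i \<in> K" for i
      unfolding P_def using \<xi> gv by (intro subfield_sum[OF K(1)] Kc)
    have gP: "g (P i) = \<zeta> ^ i * P i" for i
    proof -
      define h where "h k = \<xi> ^ (i * k) * (g ^^ k) v" for k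
      have "g (P i) = (\<Sum>k<p. g (\<xi> ^ (i * k) * (g ^^ k) v))"
        unfolding P_def using \<xi> gv by (intro galois_group_sum[OF K(1) g(1)] Kc)
      also have "\<dots> = (\<Sum>k<p. \<zeta> ^ i * h (Suc k))"
      proof (intro sum.cong refl)
        fix k
        have "g (\<xi> ^ (i * k) * (g ^^ k) v) = \<xi> ^ (i * k) * (g ^^ Suc k) v"
          using gd(3)[OF Kc(9)[OF \<xi>(2)] gv] gd(11)[OF base_closed(9)[OF \<xi>(1)]] by simp
        moreover have "\<xi> ^ (i * k) = \<zeta> ^ i * \<xi> ^ (i * Suc k)"
          using arg_cong[OF \<xi>(5), of "\<lambda>t. t ^ i * \<xi> ^ (i * k)"]
          by (simp add: power_mult_distrib power_add mult.assoc)
        ultimately show "g (\<xi> ^ (i * k) * (g ^^ k) v) = \<zeta> ^ i * h (Suc k)"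
          by (simp only: h_def mult.assoc)
      qed
      also have "\<dots> = \<zeta> ^ i * (\<Sum>k<p. h (Suc k))" by (simp add: sum_distrib_left)
      also have "(\<Sum>k<p. h (Suc k)) = (\<Sum>k<p. h k)"
      proof -
        have "\<xi> ^ (i * p) = 1" using \<xi>(3) by (metis mult.commute power_mult power_one)
        then have "h p = h 0" using g(2)[OF v] by (simp add: h_def)
        moreover have "h 0 + (\<Sum>k<p. h (Suc k)) = (\<Sum>k<p. h k) + h p"
          by (metis sum.lessThan_Suc sum.lessThan_Suc_shift)
        ultimately show ?thesis by (simp add: add.commute)
      qed
      finally show ?thesis by (simp add: P_def h_def)
    qed
    have "P i / r ^ i \<in> ?L" for i
      using gd(9)[OF PK Kc(9)[OF r(1)], of i i] gd(10)[OF r(1), of i] gP[of i] r(2,3) zeta_nonzero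
        Kc(8)[OF PK Kc(9)[OF r(1)], of i i]
      by (simp add: fixed_field_def power_mult_distrib)
    then have "P i / r ^ i * r ^ i \<in> adjoin ?L {r}" for i
      by (intro Ac(4) Ac(9) adjoin_gen subsetD[OF adjoin_base]) auto
    then have PA: "P i \<in> adjoin ?L {r}" for i using r(2) by simp
    have "(\<Sum>i<p. P i) = (\<Sum>k<p. (\<Sum>i<p. (\<xi> ^ k) ^ i) * (g ^^ k) v)"
      unfolding P_def
    proof (subst sum.swap, intro sum.cong refl)
      fix k
      have "\<xi> ^ (i * k) = (\<xi> ^ k) ^ i" for i by (metis mult.commute power_mult)
      then show "(\<Sum>i<p. \<xi> ^ (i * k) * (g ^^ k) v) = (\<Sum>i<p. (\<xi> ^ k) ^ i) * (g ^^ k) v"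
        by (simp add: sum_distrib_right)
    qed
    also have "\<dots> = (\<Sum>k<p. if k = 0 then of_nat p * v else 0)"
    proof (intro sum.cong refl)
      fix k assume k: "k \<in> {..<p}"
      show "(\<Sum>i<p. (\<xi> ^ k) ^ i) * (g ^^ k) v = (if k = 0 then of_nat p * v else 0)"
      proof (cases "k = 0")
        case False
        then have "\<zeta> ^ k \<noteq> 1" using zeta_pow_eq_1_iff[of k] k by (auto dest: dvd_imp_le)
        then have "\<xi> ^ k \<noteq> 1" by (simp add: \<xi>_def power_inverse)
        moreover have "(\<xi> ^ k) ^ p = 1" using \<xi>(3) by (metis mult.commute power_mult power_one)
        ultimately have "(\<Sum>i<p. (\<xi> ^ k) ^ i) = 0" by (simp add: geometric_sum)
        then show ?thesis using False by simp
      qed simp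
    qed
    also have "\<dots> = of_nat p * v" using p_gt_0 by simp
    finally have v_eq: "v = (\<Sum>i<p. P i) / of_nat p" using p by simp
    have "of_nat n \<in> adjoin ?L {r}" for n
      by (induction n) (use Ac(1-3) in auto)
    then have "(\<Sum>i<p. P i) / of_nat p \<in> adjoin ?L {r}"
      by (intro Ac(8) subfield_sum[OF adjoin_subfield] PA)
    then show "v \<in> adjoin ?L {r}" by (simp only: flip: v_eq)
  qed
qed

end

section \<open>Central products of Heisenberg groups\<close>

lemma carrier_heisenberg: "carrier (heisenberg p) = {0..<int p} \<times> {0..<int p} \<times> {0..<int p}"
  by (simp add: heisenberg_def)

lemma one_heisenberg [simp]: "\<one>\<^bsub>heisenberg p\<^esub> = (0, 0, 0)"
  by (simp add: heisenberg_def)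

lemma mult_heisenberg [simp]: "(x, y, z) \<otimes>\<^bsub>heisenberg p\<^esub> (x', y', z') =
    ((x + x') mod int p, (y + y') mod int p, (z + z' + x * y') mod int p)"
  by (simp add: heisenberg_def)

text \<open>Rules to remove the inner reductions from the product term of the group law of \<open>heisenberg\<close>.\<close>

lemma mod_add_mod_mult: "(i + j mod n * k) mod n = (i + j * k) mod (n :: int)"
  and mod_add_mult_mod: "(i + k * (j mod n)) mod n = (i + k * j) mod (n :: int)"
  by (metis mod_add_right_eq mod_mult_left_eq, metis mod_add_right_eq mod_mult_right_eq)

lemma heisenberg_group:
  assumes "p > 0" shows "group (heisenberg p)"
  (is "group ?H")
proof (rule groupI)
  show "u \<otimes>\<^bsub>?H\<^esub> v \<in> carrier ?H" if "u \<in> carrier ?H" "v \<in> carrier ?H" for u v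
    using that assms by (cases u; cases v) (auto simp: carrier_heisenberg)
  show "\<one>\<^bsub>?H\<^esub> \<in> carrier ?H" using assms by (simp add: carrier_heisenberg)
  show "u \<otimes>\<^bsub>?H\<^esub> v \<otimes>\<^bsub>?H\<^esub> t = u \<otimes>\<^bsub>?H\<^esub> (v \<otimes>\<^bsub>?H\<^esub> t)" for u v t
  proof (cases u; cases v; cases t)
    fix x y z x' y' z' x'' y'' z''
    have "((z + z' + x * y') mod int p + z'' + ((x + x') mod int p) * y'') mod int p
        = (z + z' + x * y' + z'' + (x + x') * y'') mod int p"
      unfolding mod_add_mod_mult by (simp add: mod_simps add.assoc)
    also have "\<dots> = (z + x * (y' + y'') + (z' + z'' + x' * y'')) mod int p"
      by (simp add: algebra_simps)
    also have "\<dots> = (z + x * (y' + y'') + (z' + z'' + x' * y'') mod int p) mod int p"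
      by (simp only: mod_add_right_eq)
    also have "\<dots> = (z + (z' + z'' + x' * y'') mod int p + x * (y' + y'')) mod int p"
      by (simp only: add_ac)
    also have "\<dots> = (z + (z' + z'' + x' * y'') mod int p + x * ((y' + y'') mod int p)) mod int p"
      by (simp only: mod_add_mult_mod)
    finally show "u \<otimes>\<^bsub>?H\<^esub> v \<otimes>\<^bsub>?H\<^esub> t = u \<otimes>\<^bsub>?H\<^esub> (v \<otimes>\<^bsub>?H\<^esub> t)"
      if "u = (x, y, z)" "v = (x', y', z')" "t = (x'', y'', z'')"
      by (simp add: that mod_simps add.assoc)
  qed
  show "\<one>\<^bsub>?H\<^esub> \<otimes>\<^bsub>?H\<^esub> u = u" if "u \<in> carrier ?H" for u
    using that by (cases u) (auto simp: carrier_heisenberg)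
  show "\<exists>v\<in>carrier ?H. v \<otimes>\<^bsub>?H\<^esub> u = \<one>\<^bsub>?H\<^esub>" for u
  proof (cases u)
    case (fields x y z)
    let ?v = "((- x) mod int p, (- y) mod int p, (- z + x * y) mod int p)"
    have "?v \<in> carrier ?H" using assms by (simp add: carrier_heisenberg)
    moreover have "?v \<otimes>\<^bsub>?H\<^esub> u = \<one>\<^bsub>?H\<^esub>"
    proof -
      have "((- z + x * y) mod int p + z + (- x) mod int p * y) mod int p
          = (- z + x * y + (z + (- x) mod int p * y)) mod int p"
        by (simp only: add.assoc mod_add_left_eq)
      also have "\<dots> = (- z + x * y + z + (- x) * y) mod int p"
        by (simp only: mod_add_mod_mult flip: add.assoc)
      finally have "((- z + x * y) mod int p + z + (- x) mod int p * y) mod int p = 0" by simp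
      then show ?thesis by (simp add: fields mod_simps)
    qed
    ultimately show ?thesis by blast
  qed
qed

lemma (in group) nat_pow_mod:
  assumes "u \<in> carrier G" "u [^] (p::nat) = \<one>" shows "u [^] (k mod p) = u [^] k"
proof -
  have "u [^] k = u [^] (p * (k div p) + k mod p)" by simp
  also have "\<dots> = (u [^] p) [^] (k div p) \<otimes> u [^] (k mod p)"
    using assms(1) by (simp only: nat_pow_mult nat_pow_pow nat_pow_closed)
  also have "\<dots> = u [^] (k mod p)" using assms by simp
  finally show ?thesis ..
qed

lemma (in group) nat_pow_commute:
  assumes "u \<in> carrier G" "v \<in> carrier G" "u \<otimes> v = v \<otimes> u"
  shows "u [^] (m::nat) \<otimes> v [^] (n::nat) = v [^] n \<otimes> u [^] m"
  using group_commutes_pow[of v "u [^] m" n] group_commutes_pow[of u v m] assms by simp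

lemma (in group) nat_pow_commutator:
  assumes "A \<in> carrier G" "B \<in> carrier G" "T \<in> carrier G"
    and AB: "A \<otimes> B = B \<otimes> A \<otimes> T" and AT: "A \<otimes> T = T \<otimes> A" and BT: "B \<otimes> T = T \<otimes> B"
  shows "A [^] (m::nat) \<otimes> B [^] (n::nat) = B [^] n \<otimes> A [^] m \<otimes> T [^] (m * n)"
proof -
  have 1: "A [^] m \<otimes> B = B \<otimes> A [^] m \<otimes> T [^] m" for m :: nat
  proof (induction m)
    case (Suc m)
    have "A [^] Suc m \<otimes> B = (A [^] m \<otimes> B) \<otimes> (A \<otimes> T)" using assms by (simp add: m_assoc)
    also have "\<dots> = B \<otimes> A [^] m \<otimes> (T [^] m \<otimes> A) \<otimes> T" using assms Suc by (simp add: m_assoc)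
    also have "T [^] m \<otimes> A = A \<otimes> T [^] m" using group_commutes_pow[of T A m] assms by simp
    finally show ?case using assms by (simp add: m_assoc)
  qed (use assms in simp)
  show ?thesis
  proof (induction n)
    case (Suc n)
    have "A [^] m \<otimes> B [^] Suc n = B [^] n \<otimes> A [^] m \<otimes> (T [^] (m * n) \<otimes> B)"
      using assms Suc by (simp flip: m_assoc)
    also have "T [^] (m * n) \<otimes> B = B \<otimes> T [^] (m * n)" using group_commutes_pow[of T B] assms by simp
    also have "B [^] n \<otimes> A [^] m \<otimes> (B \<otimes> T [^] (m * n)) = B [^] n \<otimes> (A [^] m \<otimes> B) \<otimes> T [^] (m * n)"
      using assms by (simp add: m_assoc)
    also have "\<dots> = B [^] Suc n \<otimes> A [^] m \<otimes> (T [^] m \<otimes> T [^] (m * n))"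
      unfolding 1 using assms by (simp add: m_assoc)
    also have "T [^] m \<otimes> T [^] (m * n) = T [^] (m * Suc n)" using assms by (simp add: nat_pow_mult)
    finally show ?case .
  qed (use assms in simp)
qed

text \<open>The triple \<open>(x, y, z)\<close> is the product \<open>(0, y, 0) (x, 0, 0) (0, 0, z)\<close>; in the opposite order the
  first two factors produce a further term \<open>x y\<close> in the centre. This fixes the order of \<open>A\<close> and \<open>B\<close>.\<close>

lemma (in group) heisenberg_hom:
  assumes AG: "A \<in> carrier G" "B \<in> carrier G" "T \<in> carrier G"
    and ord: "A [^] p = \<one>" "B [^] p = \<one>" "T [^] (p::nat) = \<one>"
    and AB: "A \<otimes> B = B \<otimes> A \<otimes> T" and AT: "A \<otimes> T = T \<otimes> A" and BT: "B \<otimes> T = T \<otimes> B"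
  shows "(\<lambda>(x, y, z). B [^] nat y \<otimes> A [^] nat x \<otimes> T [^] nat z) \<in> hom (heisenberg p) G"
proof (rule homI)
  fix u v assume uv: "u \<in> carrier (heisenberg p)" "v \<in> carrier (heisenberg p)"
  obtain x y z x' y' z' where u: "u = (x, y, z)" and v: "v = (x', y', z')"
    by (metis prod_cases3)
  have pos: "x \<ge> 0" "y \<ge> 0" "z \<ge> 0" "x' \<ge> 0" "y' \<ge> 0" "z' \<ge> 0"
    using uv by (auto simp: u v carrier_heisenberg)
  define k l m k' l' m' where "k = nat x" "l = nat y" "m = nat z" "k' = nat x'" "l' = nat y'" "m' = nat z'"
  note defs = this
  have TA: "T [^] i \<otimes> A [^] j = A [^] j \<otimes> T [^] i" and TB: "T [^] i \<otimes> B [^] j = B [^] j \<otimes> T [^] i"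
    for i j :: nat using nat_pow_commute[of T A i j] nat_pow_commute[of T B i j] AG AT BT by auto
  have "B [^] l \<otimes> A [^] k \<otimes> T [^] m \<otimes> (B [^] l' \<otimes> A [^] k' \<otimes> T [^] m')
     = B [^] l \<otimes> A [^] k \<otimes> (T [^] m \<otimes> B [^] l') \<otimes> A [^] k' \<otimes> T [^] m'"
    using AG by (simp add: m_assoc)
  also have "\<dots> = B [^] l \<otimes> (A [^] k \<otimes> B [^] l') \<otimes> (T [^] m \<otimes> A [^] k') \<otimes> T [^] m'"
    unfolding TB using AG by (simp add: m_assoc)
  also have "\<dots> = B [^] l \<otimes> B [^] l' \<otimes> A [^] k \<otimes> (T [^] (k * l') \<otimes> A [^] k') \<otimes> T [^] m \<otimes> T [^] m'"
    unfolding TA[of m k'] nat_pow_commutator[OF AG AB AT BT] using AG by (simp add: m_assoc)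
  also have "\<dots> = (B [^] l \<otimes> B [^] l') \<otimes> (A [^] k \<otimes> A [^] k') \<otimes> (T [^] (k * l') \<otimes> (T [^] m \<otimes> T [^] m'))"
    unfolding TA using AG by (simp add: m_assoc)
  also have "\<dots> = B [^] ((l + l') mod p) \<otimes> A [^] ((k + k') mod p) \<otimes> T [^] ((m + m' + k * l') mod p)"
    using AG ord by (simp add: nat_pow_mult nat_pow_mod add_ac)
  also have "(l + l') mod p = nat ((y + y') mod int p)"
    using pos by (simp add: defs nat_mod_distrib nat_add_distrib)
  also have "(k + k') mod p = nat ((x + x') mod int p)"
    using pos by (simp add: defs nat_mod_distrib nat_add_distrib)
  also have "(m + m' + k * l') mod p = nat ((z + z' + x * y') mod int p)"
    using pos by (simp add: defs nat_mod_distrib nat_add_distrib nat_mult_distrib)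
  finally show "(case u \<otimes>\<^bsub>heisenberg p\<^esub> v of (x, y, z) \<Rightarrow> B [^] nat y \<otimes> A [^] nat x \<otimes> T [^] nat z) =
      (case u of (x, y, z) \<Rightarrow> B [^] nat y \<otimes> A [^] nat x \<otimes> T [^] nat z) \<otimes>
      (case v of (x, y, z) \<Rightarrow> B [^] nat y \<otimes> A [^] nat x \<otimes> T [^] nat z)"
    by (simp add: u v defs)
qed (use AG in auto)

lemma (in group) elementary_abelian_hom:
  assumes UG: "U \<in> carrier G" "V \<in> carrier G" and ord: "U [^] p = \<one>" "V [^] (p::nat) = \<one>"
    and UV: "U \<otimes> V = V \<otimes> U" and p: "p > 0"
  shows "(\<lambda>f. U [^] nat (f 0) \<otimes> V [^] nat (f 1)) \<in> hom (elementary_abelian p 2) G"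
proof (rule homI)
  fix f g assume fg: "f \<in> carrier (elementary_abelian p 2)" "g \<in> carrier (elementary_abelian p 2)"
  have pos: "f i \<ge> 0" "g i \<ge> 0" if "i < 2" for i
    using fg that p by (auto simp: elementary_abelian_def carrier_integer_mod_group PiE_iff)
  have mult: "(f \<otimes>\<^bsub>elementary_abelian p 2\<^esub> g) i = (f i + g i) mod int p" if "i < 2" for i
    using that by (simp add: elementary_abelian_def)
  have eq: "Q [^] nat ((f i + g i) mod int p) = Q [^] nat (f i) \<otimes> Q [^] nat (g i)"
    if "Q \<in> carrier G" "Q [^] p = \<one>" "i < 2" for Q and i :: nat
  proof -
    have "nat ((f i + g i) mod int p) = (nat (f i) + nat (g i)) mod p"
      using pos[OF that(3)] by (simp add: nat_mod_distrib nat_add_distrib)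
    then show ?thesis using nat_pow_mod[OF that(1,2)] nat_pow_mult[OF that(1)] by metis
  qed
  have "U [^] nat (f 0) \<otimes> U [^] nat (g 0) \<otimes> (V [^] nat (f 1) \<otimes> V [^] nat (g 1))
      = U [^] nat (f 0) \<otimes> (U [^] nat (g 0) \<otimes> V [^] nat (f 1)) \<otimes> V [^] nat (g 1)"
    using UG by (simp add: m_assoc)
  also have "U [^] nat (g 0) \<otimes> V [^] nat (f 1) = V [^] nat (f 1) \<otimes> U [^] nat (g 0)"
    by (rule nat_pow_commute[OF UG UV])
  finally show "U [^] nat ((f \<otimes>\<^bsub>elementary_abelian p 2\<^esub> g) 0) \<otimes> V [^] nat ((f \<otimes>\<^bsub>elementary_abelian p 2\<^esub> g) 1) =
      U [^] nat (f 0) \<otimes> V [^] nat (f 1) \<otimes> (U [^] nat (g 0) \<otimes> V [^] nat (g 1))"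
    using UG ord by (simp add: mult eq m_assoc)
qed (use UG in auto)

lemma (in group) pair_hom:
  assumes h: "h \<in> hom H G" and k: "k \<in> hom K G"
    and comm: "\<And>u v. u \<in> carrier H \<Longrightarrow> v \<in> carrier K \<Longrightarrow> h u \<otimes> k v = k v \<otimes> h u"
  shows "(\<lambda>(u, v). h u \<otimes> k v) \<in> hom (H \<times>\<times> K) G"
proof (rule homI)
  fix s t assume st: "s \<in> carrier (H \<times>\<times> K)" "t \<in> carrier (H \<times>\<times> K)"
  obtain u v u' v' where s: "s = (u, v)" and t: "t = (u', v')" by (metis prod.exhaust)
  have c: "u \<in> carrier H" "u' \<in> carrier H" "v \<in> carrier K" "v' \<in> carrier K" using st s t by auto
  have G: "h u \<in> carrier G" "h u' \<in> carrier G" "k v \<in> carrier G" "k v' \<in> carrier G"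
    using c h k by (auto simp: hom_def)
  have "h u \<otimes> k v \<otimes> (h u' \<otimes> k v') = h u \<otimes> (k v \<otimes> h u') \<otimes> k v'" using G by (simp add: m_assoc)
  also have "k v \<otimes> h u' = h u' \<otimes> k v" using comm c by simp
  finally have "h u \<otimes> k v \<otimes> (h u' \<otimes> k v') = h u \<otimes> h u' \<otimes> (k v \<otimes> k v')" using G by (simp add: m_assoc)
  then show "(case s \<otimes>\<^bsub>H \<times>\<times> K\<^esub> t of (u, v) \<Rightarrow> h u \<otimes> k v) =
      (case s of (u, v) \<Rightarrow> h u \<otimes> k v) \<otimes> (case t of (u, v) \<Rightarrow> h u \<otimes> k v)"
    using c h k by (simp add: s t hom_def)
qed (use h k in \<open>auto simp: hom_def\<close>)

lemma isomorphic_of_equal_kernels: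
  assumes "group_hom G H h" "group_hom G K k" "h ` carrier G = carrier H" "k ` carrier G = carrier K"
    and "kernel G H h = kernel G K k"
  shows "H \<cong> K"
proof -
  interpret h: group_hom G H h by fact
  interpret k: group_hom G K k by fact
  have "group (G Mod kernel G H h)"
    using h.normal_kernel by (rule normal.factorgroup_is_group)
  then have "H \<cong> G Mod kernel G H h" using group.iso_sym h.FactGroup_iso[OF assms(3)] by blast
  also have "\<dots> \<cong> K" using k.FactGroup_iso[OF assms(4)] assms(5) by simp
  finally show ?thesis .
qed

text \<open>The maps \<open>\<alpha>\<close> and \<open>\<beta>\<close> send the two Heisenberg factors to the subgroups generated by \<open>A, B, T\<close> and by
  \<open>C, D, inv T\<close>. The second one uses \<open>inv T\<close> because the commutator of \<open>C\<close> and \<open>D\<close> is inverse to that of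
  \<open>A\<close> and \<open>B\<close>. Their product \<open>\<delta>\<close> therefore kills the pairs of equal central elements, and by the last hypothesis
  nothing else. So it induces an injective map \<open>\<eta>\<close> on the central product. Together with the map \<open>\<epsilon>\<close> onto the subgroup generated by \<open>U\<close>
  and \<open>V\<close> it gives the isomorphism \<open>\<psi>\<close>, whose inverse is the required map.\<close>

lemma (in group) recognise_central_product:
  fixes p :: nat
  assumes p: "p > 1"
    and G: "A \<in> carrier G" "B \<in> carrier G" "C \<in> carrier G" "D \<in> carrier G" "T \<in> carrier G"
      "U \<in> carrier G" "V \<in> carrier G"
    and ord: "A [^] p = \<one>" "B [^] p = \<one>" "C [^] p = \<one>" "D [^] p = \<one>" "T [^] p = \<one>"
      "U [^] p = \<one>" "V [^] p = \<one>"
    and AB: "A \<otimes> B = B \<otimes> A \<otimes> T" and DC: "D \<otimes> C = C \<otimes> D \<otimes> T"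
    and T: "A \<otimes> T = T \<otimes> A" "B \<otimes> T = T \<otimes> B" "C \<otimes> T = T \<otimes> C" "D \<otimes> T = T \<otimes> D"
    and AC: "A \<otimes> C = C \<otimes> A" and AD: "A \<otimes> D = D \<otimes> A" and BC: "B \<otimes> C = C \<otimes> B" and BD: "B \<otimes> D = D \<otimes> B"
    and U: "\<And>g. g \<in> {A, B, C, D, T, V} \<Longrightarrow> U \<otimes> g = g \<otimes> U"
    and V: "\<And>g. g \<in> {A, B, C, D, T} \<Longrightarrow> V \<otimes> g = g \<otimes> V"
    and generated: "\<And>g. g \<in> carrier G \<Longrightarrow> \<exists>(a::nat) (b::nat) (c::nat) (d::nat) (t::nat) (u::nat) (v::nat). g =
      B [^] b \<otimes> A [^] a \<otimes> (D [^] d \<otimes> C [^] c) \<otimes> T [^] t \<otimes> (U [^] u \<otimes> V [^] v)"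
    and relations: "\<And>(a::nat) (b::nat) (c::nat) (d::nat) (t::nat) (u::nat) (v::nat).
      B [^] b \<otimes> A [^] a \<otimes> (D [^] d \<otimes> C [^] c) \<otimes> T [^] t \<otimes> (U [^] u \<otimes> V [^] v) = \<one> \<Longrightarrow>
      p dvd a \<and> p dvd b \<and> p dvd c \<and> p dvd d \<and> p dvd t \<and> p dvd u \<and> p dvd v"
  shows "\<exists>\<phi> \<in> iso G (heisenberg_central_product p \<times>\<times> elementary_abelian p 2).
      \<phi> ` generate G {U, V} = {\<one>\<^bsub>heisenberg_central_product p\<^esub>} \<times> carrier (elementary_abelian p 2)"
    and "G\<lparr>carrier := generate G {U, V}\<rparr> \<cong> elementary_abelian p 2"
    and "group (heisenberg_central_product p)"
proof -
  let ?H = "heisenberg p" and ?N = "{((0 :: int, 0 :: int, t :: int), (0 :: int, 0 :: int, t)) | t. t \<in> {0..<int p}}"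
  let ?HC = "heisenberg_central_product p" and ?EA = "elementary_abelian p 2"
  have p0: "p > 0" using p by simp
  define \<alpha> where "\<alpha> = (\<lambda>(x, y, z). B [^] nat y \<otimes> A [^] nat x \<otimes> T [^] nat z)"
  define \<beta> where "\<beta> = (\<lambda>(x, y, z). D [^] nat y \<otimes> C [^] nat x \<otimes> (inv T) [^] nat z)"
  define \<epsilon> where "\<epsilon> = (\<lambda>f :: nat \<Rightarrow> int. U [^] nat (f 0) \<otimes> V [^] nat (f 1))"
  have inv_commute: "g \<otimes> inv T = inv T \<otimes> g" if "g \<in> carrier G" "g \<otimes> T = T \<otimes> g" for g
    using that G(5) by (metis inv_closed inv_solve_left inv_solve_right' m_assoc m_closed)
  have CD: "C \<otimes> D = D \<otimes> C \<otimes> inv T"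
    using DC G by (metis inv_solve_right m_closed)
  have \<alpha>: "\<alpha> \<in> hom ?H G"
    unfolding \<alpha>_def by (rule heisenberg_hom) (use G ord AB T in auto)
  have \<beta>: "\<beta> \<in> hom ?H G"
    unfolding \<beta>_def
    by (rule heisenberg_hom) (use G ord CD T inv_commute in \<open>auto simp: nat_pow_inv\<close>)
  have \<epsilon>: "\<epsilon> \<in> hom ?EA G"
    unfolding \<epsilon>_def by (rule elementary_abelian_hom) (use G ord U p0 in auto)
  have commute_mult: "g \<otimes> (h \<otimes> k) = h \<otimes> k \<otimes> g"
    if "g \<in> carrier G" "h \<in> carrier G" "k \<in> carrier G" "g \<otimes> h = h \<otimes> g" "g \<otimes> k = k \<otimes> g" for g h k
    using that by (metis m_assoc)
  have mult_commute: "h \<otimes> k \<otimes> g = g \<otimes> (h \<otimes> k)"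
    if "g \<in> carrier G" "h \<in> carrier G" "k \<in> carrier G" "h \<otimes> g = g \<otimes> h" "k \<otimes> g = g \<otimes> k" for g h k
    using that by (metis m_assoc)
  have T_inv: "T \<otimes> inv T = inv T \<otimes> T" using G(5) by simp
  have \<alpha>\<beta>_commute: "\<alpha> h \<otimes> \<beta> k = \<beta> k \<otimes> \<alpha> h" for h k
    unfolding \<alpha>_def \<beta>_def
    by (cases h; cases k)
       (simp, intro commute_mult mult_commute nat_pow_commute m_closed nat_pow_closed inv_closed;
        use G T[symmetric] AC AD BC BD T_inv inv_commute T in simp)
  define \<delta> where "\<delta> = (\<lambda>(h, k). \<alpha> h \<otimes> \<beta> k)"
  have \<delta>: "\<delta> \<in> hom (?H \<times>\<times> ?H) G"
    unfolding \<delta>_def by (rule pair_hom[OF \<alpha> \<beta> \<alpha>\<beta>_commute])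
  have group_H: "group ?H" by (rule heisenberg_group[OF p0])
  have group_EA: "group ?EA" by (simp add: elementary_abelian_def)
  interpret \<delta>: group_hom "?H \<times>\<times> ?H" G \<delta>
    using \<delta> DirProd_group[OF group_H group_H] by (simp add: group_hom_def group_hom_axioms_def is_group)
  have invT_pow: "(inv T) [^] n = T [^] ((p - 1) * n)" for n :: nat
  proof -
    have "T [^] (p - 1) \<otimes> T = \<one>" using G(5) ord(5) p0 by (metis Suc_diff_1 nat_pow_Suc)
    then have "inv T = T [^] (p - 1)" using G(5) by (intro inv_equality) auto
    then show ?thesis using G(5) by (simp add: nat_pow_pow)
  qed
  have \<delta>_eq: "\<delta> ((x, y, z), (x', y', z')) =
      B [^] nat y \<otimes> A [^] nat x \<otimes> (D [^] nat y' \<otimes> C [^] nat x') \<otimes> T [^] (nat z + (p - 1) * nat z')"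
    for x y z x' y' z'
  proof -
    have TDC: "T [^] nat z \<otimes> (D [^] nat y' \<otimes> C [^] nat x') = D [^] nat y' \<otimes> C [^] nat x' \<otimes> T [^] nat z"
      using G T by (intro commute_mult nat_pow_commute) auto
    have "\<delta> ((x, y, z), (x', y', z')) = B [^] nat y \<otimes> A [^] nat x \<otimes>
        (T [^] nat z \<otimes> (D [^] nat y' \<otimes> C [^] nat x')) \<otimes> T [^] ((p - 1) * nat z')"
      using G by (simp add: \<delta>_def \<alpha>_def \<beta>_def invT_pow m_assoc)
    also have "\<dots> = B [^] nat y \<otimes> A [^] nat x \<otimes> (D [^] nat y' \<otimes> C [^] nat x') \<otimes>
        (T [^] nat z \<otimes> T [^] ((p - 1) * nat z'))"
      unfolding TDC using G by (simp add: m_assoc)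
    finally show ?thesis using G by (simp add: nat_pow_mult)
  qed
  have small: "i = 0" if "p dvd nat i" "i \<in> {0..<int p}" for i :: int
    using that by (auto dest: dvd_imp_le)
  have trivial: "h \<in> ?N \<and> f 0 = 0 \<and> f 1 = 0"
    if h: "h \<in> carrier (?H \<times>\<times> ?H)" and f: "f \<in> carrier ?EA" and eq: "\<delta> h \<otimes> \<epsilon> f = \<one>" for h f
  proof -
    obtain x y z x' y' z' where h_eq: "h = ((x, y, z), (x', y', z'))" by (metis prod.exhaust)
    have bounds: "x \<in> {0..<int p}" "y \<in> {0..<int p}" "z \<in> {0..<int p}" "x' \<in> {0..<int p}"
        "y' \<in> {0..<int p}" "z' \<in> {0..<int p}"
      using h by (simp_all add: h_eq carrier_heisenberg)
    have f_bounds: "f i \<in> {0..<int p}" if "i < 2" for i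
      using f that p0 by (simp add: elementary_abelian_def carrier_integer_mod_group PiE_iff)
    have "B [^] nat y \<otimes> A [^] nat x \<otimes> (D [^] nat y' \<otimes> C [^] nat x') \<otimes> T [^] (nat z + (p - 1) * nat z') \<otimes>
        (U [^] nat (f 0) \<otimes> V [^] nat (f 1)) = \<one>"
      using eq by (simp only: h_eq \<delta>_eq \<epsilon>_def)
    note rel = relations[OF this]
    have "x = 0" "y = 0" "x' = 0" "y' = 0" "f 0 = 0" "f 1 = 0"
      using rel by (auto intro!: small bounds f_bounds)
    moreover have "z = z'"
    proof -
      have "int p dvd int (nat z + (p - 1) * nat z')" using rel by presburger
      also have "int (nat z + (p - 1) * nat z') = int (nat z) + int (p - 1) * int (nat z')"
        by (simp only: of_nat_add of_nat_mult)
      also have "\<dots> = z - z' + int p * z'"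
        using bounds p by (simp add: of_nat_diff algebra_simps)
      finally have "int p dvd z - z'" by (simp add: dvd_add_left_iff)
      moreover have "\<bar>z - z'\<bar> < int p" using bounds by auto
      ultimately show ?thesis using zdvd_imp_le[of "int p" "\<bar>z - z'\<bar>"] by auto
    qed
    ultimately show ?thesis using h_eq bounds by auto
  qed
  have \<epsilon>_zero: "\<epsilon> \<one>\<^bsub>?EA\<^esub> = \<one>" by (simp add: \<epsilon>_def elementary_abelian_def)
  have kernel: "kernel (?H \<times>\<times> ?H) G \<delta> = ?N"
  proof
    show "kernel (?H \<times>\<times> ?H) G \<delta> \<subseteq> ?N"
      using trivial[OF _ monoid.one_closed[OF group.is_monoid[OF group_EA]]] \<epsilon>_zero by (auto simp: kernel_def)
    have "\<delta> ((0, 0, t), (0, 0, t)) = \<one>" if "t \<ge> 0" for t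
    proof -
      have "nat t + (p - 1) * nat t = p * nat t" using p by (cases p) auto
      then have "T [^] (nat t + (p - 1) * nat t) = \<one>"
        using G(5) ord(5) by (metis nat_pow_one nat_pow_pow)
      then show ?thesis by (simp add: \<delta>_eq)
    qed
    then show "?N \<subseteq> kernel (?H \<times>\<times> ?H) G \<delta>" using p0 by (auto simp: kernel_def carrier_heisenberg)
  qed
  have HC: "?HC = (?H \<times>\<times> ?H) Mod kernel (?H \<times>\<times> ?H) G \<delta>"
    by (simp add: heisenberg_central_product_def kernel)
  show group_HC: "group ?HC"
    unfolding HC by (rule normal.factorgroup_is_group[OF \<delta>.normal_kernel])
  define \<eta> where "\<eta> = (\<lambda>S. the_elem (\<delta> ` S))"
  have \<eta>: "\<eta> \<in> hom ?HC G" unfolding HC \<eta>_def by (rule \<delta>.FactGroup_hom)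
  have \<eta>_im: "\<eta> ` carrier ?HC = \<delta> ` carrier (?H \<times>\<times> ?H)"
  proof -
    interpret im: group_hom "?H \<times>\<times> ?H" "G\<lparr>carrier := \<delta> ` carrier (?H \<times>\<times> ?H)\<rparr>" \<delta>
      using \<delta>.img_is_subgroup \<delta>.homh DirProd_group[OF group_H group_H] subgroup_imp_group
      by (auto simp: group_hom_def group_hom_axioms_def hom_def)
    have "kernel (?H \<times>\<times> ?H) (G\<lparr>carrier := \<delta> ` carrier (?H \<times>\<times> ?H)\<rparr>) \<delta> = kernel (?H \<times>\<times> ?H) G \<delta>"
      by (simp add: kernel_def)
    then show ?thesis using im.FactGroup_onto unfolding HC \<eta>_def by simp
  qed
  have \<eta>_inj: "inj_on \<eta> (carrier ?HC)" unfolding HC \<eta>_def by (rule \<delta>.FactGroup_inj_on)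
  have U_commute: "U [^] n \<otimes> g = g \<otimes> U [^] n" and V_commute: "V [^] n \<otimes> g = g \<otimes> V [^] n"
    if "g \<in> {A, B, C, D, T}" for g and n :: nat
    using group_commutes_pow[of U g n] group_commutes_pow[of V g n] U[of g] V[of g] that G by auto
  have \<epsilon>_commute: "\<epsilon> f \<otimes> g = g \<otimes> \<epsilon> f" if "g \<in> {A, B, C, D, T}" for f g
    unfolding \<epsilon>_def using that G U_commute V_commute by (intro mult_commute) auto
  have \<epsilon>_closed: "\<epsilon> f \<in> carrier G" for f using G by (simp add: \<epsilon>_def)
  have \<delta>_\<epsilon>_commute: "\<delta> h \<otimes> \<epsilon> f = \<epsilon> f \<otimes> \<delta> h" for h f
  proof -
    obtain x y z x' y' z' where h_eq: "h = ((x, y, z), (x', y', z'))" by (metis prod.exhaust)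
    have pow: "g [^] n \<otimes> \<epsilon> f = \<epsilon> f \<otimes> g [^] n" if "g \<in> {A, B, C, D, T}" for g and n :: nat
      using that G \<epsilon>_closed \<epsilon>_commute[OF that, of f] by (intro group_commutes_pow) auto
    show ?thesis
      unfolding h_eq \<delta>_eq using G \<epsilon>_closed by (intro mult_commute pow m_closed nat_pow_closed) auto
  qed
  define \<psi> where "\<psi> = (\<lambda>(s, f). \<eta> s \<otimes> \<epsilon> f)"
  have \<eta>_lift: "\<exists>h\<in>carrier (?H \<times>\<times> ?H). \<eta> s = \<delta> h" if "s \<in> carrier ?HC" for s
    using imageI[OF that, of \<eta>] unfolding \<eta>_im by blast
  have \<psi>: "\<psi> \<in> hom (?HC \<times>\<times> ?EA) G"
    unfolding \<psi>_def
  proof (rule pair_hom[OF \<eta> \<epsilon>])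
    fix s f assume "s \<in> carrier ?HC"
    then obtain h where "\<eta> s = \<delta> h" using \<eta>_lift by blast
    then show "\<eta> s \<otimes> \<epsilon> f = \<epsilon> f \<otimes> \<eta> s" using \<delta>_\<epsilon>_commute by simp
  qed
  have group_prod: "group (?HC \<times>\<times> ?EA)" by (rule DirProd_group[OF group_HC group_EA])
  interpret \<psi>: group_hom "?HC \<times>\<times> ?EA" G \<psi>
    using \<psi> group_prod by (simp add: group_hom_def group_hom_axioms_def is_group)
  have EA_zero: "f = \<one>\<^bsub>?EA\<^esub>" if "f \<in> carrier ?EA" "f 0 = 0" "f 1 = 0" for f
  proof
    fix i :: nat
    consider "i = 0" | "i = 1" | "i \<ge> 2" by linarith
    then show "f i = \<one>\<^bsub>?EA\<^esub> i"
      using that by cases (auto simp: elementary_abelian_def PiE_iff extensional_def)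
  qed
  have "inj_on \<psi> (carrier (?HC \<times>\<times> ?EA))"
    unfolding \<psi>.inj_on_one_iff
  proof (intro allI impI)
    fix k assume k: "k \<in> carrier (?HC \<times>\<times> ?EA)" "\<psi> k = \<one>"
    obtain s f where sf: "k = (s, f)" by (metis prod.exhaust)
    have s: "s \<in> carrier ?HC" and f: "f \<in> carrier ?EA" using k by (auto simp: sf)
    obtain h where h: "h \<in> carrier (?H \<times>\<times> ?H)" "\<eta> s = \<delta> h" using \<eta>_lift[OF s] by auto
    have "\<delta> h \<otimes> \<epsilon> f = \<one>" using k(2) h by (simp add: sf \<psi>_def)
    from trivial[OF h(1) f this] have hN: "h \<in> ?N" and f0: "f = \<one>\<^bsub>?EA\<^esub>" using EA_zero[OF f] by auto
    have "\<delta> h = \<one>" using hN kernel by (auto simp: kernel_def)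
    then have "\<eta> s = \<eta> \<one>\<^bsub>?HC\<^esub>"
      using h(2) hom_one[OF \<eta> group_HC is_group] by simp
    then have "s = \<one>\<^bsub>?HC\<^esub>" using \<eta>_inj s monoid.one_closed[OF group.is_monoid[OF group_HC]] by (auto dest: inj_onD)
    then show "k = \<one>\<^bsub>?HC \<times>\<times> ?EA\<^esub>" by (simp add: sf f0)
  qed
  moreover have "\<psi> ` carrier (?HC \<times>\<times> ?EA) = carrier G"
  proof
    show "\<psi> ` carrier (?HC \<times>\<times> ?EA) \<subseteq> carrier G" using \<psi>.hom_closed by auto
    show "carrier G \<subseteq> \<psi> ` carrier (?HC \<times>\<times> ?EA)"
    proof
      fix g assume "g \<in> carrier G"
      from generated[OF this] obtain a b c d t u v :: nat where
        g: "g = B [^] b \<otimes> A [^] a \<otimes> (D [^] d \<otimes> C [^] c) \<otimes> T [^] t \<otimes> (U [^] u \<otimes> V [^] v)" by blast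
      define h where "h = ((int (a mod p), int (b mod p), int (t mod p)), (int (c mod p), int (d mod p), 0 :: int))"
      define f where "f = (\<lambda>i\<in>{..<2::nat}. if i = 0 then int (u mod p) else int (v mod p))"
      have f: "f \<in> carrier ?EA"
        using p0 by (auto simp: f_def elementary_abelian_def carrier_integer_mod_group)
      have "h \<in> carrier (?H \<times>\<times> ?H)" using p0 by (simp add: h_def carrier_heisenberg)
      then have "\<delta> h \<in> \<eta> ` carrier ?HC" unfolding \<eta>_im by (rule imageI)
      then obtain s where s: "s \<in> carrier ?HC" "\<eta> s = \<delta> h" by (metis imageE)
      have "g = \<delta> h \<otimes> \<epsilon> f"
        using G ord by (simp add: g h_def \<delta>_eq \<epsilon>_def f_def nat_pow_mod nat_int del: int_ops)
      then have "g = \<psi> (s, f)" using s by (simp add: \<psi>_def)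
      then show "g \<in> \<psi> ` carrier (?HC \<times>\<times> ?EA)" using s f by auto
    qed
  qed
  ultimately have \<psi>_iso: "\<psi> \<in> iso (?HC \<times>\<times> ?EA) G"
    using \<psi> by (simp add: iso_def bij_betw_def)
  define \<phi> where "\<phi> = inv_into (carrier (?HC \<times>\<times> ?EA)) \<psi>"
  have \<phi>: "\<phi> \<in> iso G (?HC \<times>\<times> ?EA)"
    unfolding \<phi>_def by (rule group.iso_set_sym[OF group_prod \<psi>_iso])
  interpret \<epsilon>: group_hom ?EA G \<epsilon>
    using \<epsilon> group_EA by (simp add: group_hom_def group_hom_axioms_def is_group)
  have gen: "generate G {U, V} = \<epsilon> ` carrier ?EA"
  proof
    have unit: "(\<lambda>i\<in>{..<2::nat}. if i = j then 1 else 0) \<in> carrier ?EA" for j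
      using p by (auto simp: elementary_abelian_def carrier_integer_mod_group)
    have "U = \<epsilon> (\<lambda>i\<in>{..<2::nat}. if i = 0 then 1 else 0)" "V = \<epsilon> (\<lambda>i\<in>{..<2::nat}. if i = 1 then 1 else 0)"
      using G by (auto simp: \<epsilon>_def)
    then have "{U, V} \<subseteq> \<epsilon> ` carrier ?EA" using unit by blast
    then show "generate G {U, V} \<subseteq> \<epsilon> ` carrier ?EA"
      using generate_subgroup_incl \<epsilon>.img_is_subgroup by blast
    have "subgroup (generate G {U, V}) G" using G by (intro generate_is_subgroup) auto
    moreover have "U \<in> generate G {U, V}" "V \<in> generate G {U, V}" by (auto intro: generate.incl)
    moreover from calculation have "U [^] n \<in> generate G {U, V}" "V [^] n \<in> generate G {U, V}" for n :: nat
      by (induction n) (auto simp: subgroup.one_closed subgroup.m_closed)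
    ultimately show "\<epsilon> ` carrier ?EA \<subseteq> generate G {U, V}"
      by (auto simp: \<epsilon>_def subgroup.m_closed)
  qed
  have \<psi>_one: "\<psi> (\<one>\<^bsub>?HC\<^esub>, f) = \<epsilon> f" for f
    using hom_one[OF \<eta> group_HC is_group] \<epsilon>_closed by (simp add: \<psi>_def)
  have "\<phi> ` generate G {U, V} = {\<one>\<^bsub>?HC\<^esub>} \<times> carrier ?EA"
  proof -
    let ?S = "{\<one>\<^bsub>?HC\<^esub>} \<times> carrier ?EA"
    have "\<psi> ` ?S = (\<lambda>f. \<psi> (\<one>\<^bsub>?HC\<^esub>, f)) ` carrier ?EA" by auto
    then have "generate G {U, V} = \<psi> ` ?S" by (simp only: gen \<psi>_one)
    moreover have "?S \<subseteq> carrier (?HC \<times>\<times> ?EA)" using monoid.one_closed[OF group.is_monoid[OF group_HC]] by auto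
    ultimately show ?thesis
      unfolding \<phi>_def using \<psi>_iso by (simp add: iso_def bij_betw_def inv_into_image_cancel)
  qed
  then show "\<exists>\<phi> \<in> iso G (?HC \<times>\<times> ?EA). \<phi> ` generate G {U, V} = {\<one>\<^bsub>?HC\<^esub>} \<times> carrier ?EA"
    using \<phi> by blast
  have "inj_on \<epsilon> (carrier ?EA)"
    unfolding \<epsilon>.inj_on_one_iff
  proof (intro allI impI)
    fix f assume f: "f \<in> carrier ?EA" "\<epsilon> f = \<one>"
    have "\<delta> \<one>\<^bsub>?H \<times>\<times> ?H\<^esub> \<otimes> \<epsilon> f = \<one>" unfolding \<delta>.hom_one f(2) by simp
    from trivial[OF monoid.one_closed[OF group.is_monoid[OF DirProd_group[OF group_H group_H]]] f(1) this]
    show "f = \<one>\<^bsub>?EA\<^esub>" using EA_zero[OF f(1)] by auto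
  qed
  then have "\<epsilon> \<in> iso ?EA (G\<lparr>carrier := generate G {U, V}\<rparr>)"
    using \<epsilon> by (auto simp: iso_def hom_def bij_betw_def gen)
  then show "G\<lparr>carrier := generate G {U, V}\<rparr> \<cong> ?EA"
    using group.iso_sym[OF group_EA] by (auto simp: is_iso_def)
qed

section \<open>Six independent radicals\<close>

text \<open>The radicals \<open>ra, rb, \<dots>\<close> are the basic data here; the elements \<open>a, b, \<dots>\<close> are written as their \<open>p\<close>-th
  powers.\<close>

locale six_radicals = kummer_base p \<zeta> F for p \<zeta> and F :: "'a::alg_closed_field set" +
  fixes ra rb rc rd rx ry f1 f2 f3 f4 :: 'a
  assumes independent: "independent_mod_powers p F (map (\<lambda>r. r ^ p) [ra, rb, rc, rd, rx, ry])"
    and radicals: "\<And>r. r \<in> {ra, rb, rc, rd, rx, ry} \<Longrightarrow> r ^ p \<in> F \<and> r \<noteq> 0"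
    and f_mem: "f1 \<in> adjoin F {rb} - {0}" "f2 \<in> adjoin F {rb * ry} - {0}"
      "f3 \<in> adjoin F {rx * rc} - {0}" "f4 \<in> adjoin F {rc} - {0}"
    and norms: "field_norm (adjoin F {rb}) F f1 = ra ^ p * rx ^ p"
      "field_norm (adjoin F {rb * ry}) F f2 = inverse (rx ^ p)"
      "field_norm (adjoin F {rx * rc}) F f3 = inverse (ry ^ p)"
      "field_norm (adjoin F {rc}) F f4 = ry ^ p * rd ^ p"
begin

definition rs :: "'a list" where "rs = [ra, rb, rc, rd, rx, ry]"

definition M :: "'a set" where "M = adjoin F (set rs)"

definition w :: 'a where
  "w = W_elem F \<zeta> p rb f1 * W_elem F \<zeta> p (rb * ry) f2 * W_elem F \<zeta> p (rx * rc) f3 * W_elem F \<zeta> p rc f4"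

text \<open>An automorphism over \<open>F\<close> multiplies each of the six radicals by a power of \<open>\<zeta>\<close>. The exponents determine
  its restriction to \<open>M\<close>.\<close>

definition acts :: "('a \<Rightarrow> 'a) \<Rightarrow> (nat \<Rightarrow> nat) \<Rightarrow> bool" where
  "acts g e \<longleftrightarrow> (\<forall>i<6. g (rs ! i) = \<zeta> ^ e i * rs ! i)"

definition unit_exp :: "nat \<Rightarrow> nat \<Rightarrow> nat" where "unit_exp j i = (if i = j then 1 else 0)"

lemma length_rs: "length rs = 6" by (simp add: rs_def)

lemma set_rs: "set rs = {ra, rb, rc, rd, rx, ry}" by (auto simp: rs_def)

lemma all_less_6: "(\<forall>i<6. P i) \<longleftrightarrow> P 0 \<and> P 1 \<and> P 2 \<and> P 3 \<and> P 4 \<and> P (5::nat)"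
  by (simp add: numeral_eq_Suc All_less_Suc conj_ac)

lemma rs_nth: "rs ! 0 = ra" "rs ! 1 = rb" "rs ! 2 = rc" "rs ! 3 = rd" "rs ! 4 = rx" "rs ! 5 = ry"
  by (simp_all add: rs_def)

lemma acts_iff: "acts g e \<longleftrightarrow> g ra = \<zeta> ^ e 0 * ra \<and> g rb = \<zeta> ^ e 1 * rb \<and> g rc = \<zeta> ^ e 2 * rc \<and>
    g rd = \<zeta> ^ e 3 * rd \<and> g rx = \<zeta> ^ e 4 * rx \<and> g ry = \<zeta> ^ e 5 * ry"
  by (simp add: acts_def all_less_6 rs_nth del: One_nat_def)

lemma radical_nonzero: "ra \<noteq> 0" "rb \<noteq> 0" "rc \<noteq> 0" "rd \<noteq> 0" "rx \<noteq> 0" "ry \<noteq> 0"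
  and radical_power_mem: "ra ^ p \<in> F" "rb ^ p \<in> F" "rc ^ p \<in> F" "rd ^ p \<in> F" "rx ^ p \<in> F" "ry ^ p \<in> F"
  using radicals by auto

lemma M_subfield: "subfield_of_type M" and F_subset_M: "F \<subseteq> M"
  and radical_mem: "ra \<in> M" "rb \<in> M" "rc \<in> M" "rd \<in> M" "rx \<in> M" "ry \<in> M"
  unfolding M_def by (simp_all add: adjoin_subfield adjoin_base adjoin_gen set_rs)

lemma tower: "finite_galois M F"
  "\<exists>\<sigma>\<in>Gal M F. acts \<sigma> e"
  using kummer_tower[of rs] independent radicals unfolding M_def acts_def length_rs
  by (auto simp: rs_def)

text \<open>Independence modulo \<open>p\<close>-th powers, in the form needed to see that \<open>rb\<close>, \<open>rb ry\<close>, \<open>rx rc\<close> and \<open>rc\<close>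
  generate extensions of degree \<open>p\<close>: the \<open>p\<close>-th power of a monomial in \<open>F\<close> is a \<open>p\<close>-th power of \<open>F\<close>.\<close>

lemma monomial_notin_base:
  assumes "(\<Prod>i<6. rs ! i ^ e i) \<in> F" "i < 6" shows "p dvd e i"
proof -
  have "(\<Prod>i<6. (rs ! i ^ p) ^ e i) = (\<Prod>i<6. rs ! i ^ e i) ^ p"
    by (simp add: prod_power_distrib mult.commute flip: power_mult)
  moreover have "(\<Prod>i<6. rs ! i ^ e i) \<noteq> 0"
    using radicals nth_mem[of _ rs] by (auto simp: set_rs length_rs)
  ultimately have "(\<Prod>i<6. (rs ! i ^ p) ^ e i) \<in> power_units p F"
    using assms(1) unfolding power_units_def by blast
  moreover have "(\<Prod>i<6. map (\<lambda>r. r ^ p) rs ! i ^ e i) = (\<Prod>i<6. (rs ! i ^ p) ^ e i)"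
    by (intro prod.cong) (auto simp: length_rs)
  ultimately show ?thesis
    using independent[folded rs_def, unfolded independent_mod_powers_def length_map length_rs,
        rule_format, of e i] assms(2) by simp
qed

lemma prod_rs: "(\<Prod>i<6. rs ! i ^ e i) = ra ^ e 0 * rb ^ e 1 * rc ^ e 2 * rd ^ e 3 * rx ^ e 4 * ry ^ e 5"
  by (simp add: rs_def numeral_eq_Suc mult_ac)

lemma not_mem_base: "rb \<notin> F" "rb * ry \<notin> F" "rx * rc \<notin> F" "rc \<notin> F"
  using monomial_notin_base[of "unit_exp 1" 1] monomial_notin_base[of "\<lambda>i. unit_exp 1 i + unit_exp 5 i" 1]
    monomial_notin_base[of "\<lambda>i. unit_exp 2 i + unit_exp 4 i" 2] monomial_notin_base[of "unit_exp 2" 2] p_gt_1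
  by (auto simp: prod_rs unit_exp_def mult.commute)

lemma product_power_mem: "(rb * ry) ^ p \<in> F" "(rx * rc) ^ p \<in> F"
  using radical_power_mem base_closed(4) by (auto simp: power_mult_distrib)

lemmas radical_b = radical_power_mem(2) not_mem_base(1)
lemmas radical_by = product_power_mem(1) not_mem_base(2)
lemmas radical_xc = product_power_mem(2) not_mem_base(3)
lemmas radical_c = radical_power_mem(3) not_mem_base(4)

lemma subextension: "adjoin F {rb} \<subseteq> M" "adjoin F {rb * ry} \<subseteq> M" "adjoin F {rx * rc} \<subseteq> M" "adjoin F {rc} \<subseteq> M"
  by (intro adjoin_least[OF M_subfield F_subset_M]; use radical_mem subfield_closed(4)[OF M_subfield] in simp)+

lemma f_mem_M: "f1 \<in> M" "f2 \<in> M" "f3 \<in> M" "f4 \<in> M"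
  using f_mem subextension by auto

lemma f_nonzero: "f1 \<noteq> 0" "f2 \<noteq> 0" "f3 \<noteq> 0" "f4 \<noteq> 0"
  using f_mem by auto

lemma W_mem:
  "W_elem F \<zeta> p rb f1 \<in> adjoin F {rb} - {0}" "W_elem F \<zeta> p (rb * ry) f2 \<in> adjoin F {rb * ry} - {0}"
  "W_elem F \<zeta> p (rx * rc) f3 \<in> adjoin F {rx * rc} - {0}" "W_elem F \<zeta> p rc f4 \<in> adjoin F {rc} - {0}"
  using W_elem_mem[OF radical_b] W_elem_mem[OF radical_by] W_elem_mem[OF radical_xc] W_elem_mem[OF radical_c]
    f_mem by blast+

lemma w_mem: "w \<in> M" and w_nonzero: "w \<noteq> 0"
proof -
  show "w \<in> M"
    unfolding w_def using W_mem subextension by (intro subfield_closed(4)[OF M_subfield]) auto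
  show "w \<noteq> 0" unfolding w_def using W_mem by simp
qed

text \<open>The facts below are stated for automorphisms of any field containing all radicals, since they
  are used both for \<open>M\<close> itself and for the extension of \<open>M\<close> by a \<open>p\<close>-th root.\<close>

context
  fixes K assumes K: "subfield_of_type K" "M \<subseteq> K"
begin

lemma radical_mem_K: "r \<in> set rs \<Longrightarrow> r \<in> K"
  using K(2) by (auto simp: M_def intro: adjoin_gen)

lemma F_subset_K: "F \<subseteq> K"
  using F_subset_M K(2) by blast

lemma acts_exists:
  assumes g: "g \<in> Gal K F" shows "\<exists>e. acts g e"
proof -
  have "\<exists>k. g (rs ! i) = \<zeta> ^ k * rs ! i" if "i < 6" for i
  proof -
    have r: "rs ! i \<in> set rs" using that by (simp add: length_rs)
    then have "rs ! i ^ p \<in> F" using radicals by (simp add: set_rs)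
    then have "g (rs ! i) ^ p = rs ! i ^ p"
      using galois_groupD(10)[OF K(1) g radical_mem_K[OF r], of p] galois_groupD(11)[OF K(1) g, of "rs ! i ^ p"] by simp
    then show ?thesis using pth_roots_differ_by_zeta by blast
  qed
  then show ?thesis unfolding acts_def by metis
qed

lemma zeta_power_fixed: "g \<in> Gal K F \<Longrightarrow> g (\<zeta> ^ n) = \<zeta> ^ n"
  using galois_groupD(11)[OF K(1)] zeta_mem base_closed(9) by blast

lemma zeta_power_mem_K: "\<zeta> ^ n \<in> K"
  using F_subset_K zeta_mem base_closed(9) by blast

lemma acts_mult:
  assumes g: "g \<in> Gal K F" "acts g e" and h: "h \<in> Gal K F" "acts h e'"
  shows "acts (g \<otimes>\<^bsub>galois_group K F\<^esub> h) (\<lambda>i. e i + e' i)"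
  unfolding acts_def
proof (intro allI impI)
  fix i :: nat assume i: "i < 6"
  then have r: "rs ! i \<in> K" by (intro radical_mem_K) (simp add: length_rs)
  have "(g \<otimes>\<^bsub>galois_group K F\<^esub> h) (rs ! i) = g (\<zeta> ^ e' i * rs ! i)"
    using h(2) i by (simp add: galois_mult_apply[OF g(1) h(1) r] acts_def)
  also have "\<dots> = \<zeta> ^ e' i * (\<zeta> ^ e i * rs ! i)"
    using g(2) i galois_groupD(3)[OF K(1) g(1) zeta_power_mem_K r] zeta_power_fixed[OF g(1)]
    by (simp add: acts_def)
  finally show "(g \<otimes>\<^bsub>galois_group K F\<^esub> h) (rs ! i) = \<zeta> ^ (e i + e' i) * rs ! i"
    by (simp add: power_add mult_ac)
qed

lemma acts_pow:
  assumes g: "g \<in> Gal K F" "acts g e"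
  shows "acts (g [^]\<^bsub>galois_group K F\<^esub> (n::nat)) (\<lambda>i. n * e i)"
proof -
  interpret G: group "galois_group K F" by (rule galois_group_group[OF K(1) F_subset_K])
  show ?thesis
  proof (induction n)
    case 0
    have "rs ! i \<in> K" if "i < 6" for i using that by (intro radical_mem_K) (simp add: length_rs)
    then show ?case by (simp add: acts_def)
  next
    case (Suc n)
    then show ?case using acts_mult[OF G.nat_pow_closed[OF g(1)] Suc g] by (simp add: add.commute)
  qed
qed

lemma agree_on_M:
  assumes g: "g \<in> Gal K F" "acts g e" and h: "h \<in> Gal K F" "acts h e'"
    and eq: "\<And>i. i < 6 \<Longrightarrow> \<zeta> ^ e i = \<zeta> ^ e' i" and u: "u \<in> M"
  shows "g u = h u"
proof -
  have sub: "F \<union> set rs \<subseteq> K" using F_subset_K radical_mem_K by auto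
  have "g v = h v" if "v \<in> F \<union> set rs" for v
    using that galois_groupD(11)[OF K(1) g(1)] galois_groupD(11)[OF K(1) h(1)] g(2) h(2) eq
    by (auto simp: acts_def in_set_conv_nth length_rs)
  then show ?thesis
    using galois_group_agree_on_adjoin[OF K(1) g(1) K(1) h(1) sub sub _ u[unfolded M_def]] by blast
qed

lemma agree_on_radical_field:
  assumes g: "g \<in> Gal K F" and h: "h \<in> Gal K F"
    and r: "r \<in> K" "g r = h r" and u: "u \<in> adjoin F {r}"
  shows "g u = h u"
  using galois_groupD(11)[OF K(1) g] galois_groupD(11)[OF K(1) h] F_subset_K r
  by (intro galois_group_agree_on_adjoin[OF K(1) g K(1) h _ _ _ u]) auto

lemma fixes_radical_field:
  assumes g: "g \<in> Gal K F" and r: "r \<in> K" "g r = r" and u: "u \<in> adjoin F {r}"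
  shows "g u = u"
proof -
  interpret G: group "galois_group K F" by (rule galois_group_group[OF K(1) F_subset_K])
  have "adjoin F {r} \<subseteq> K" using r(1) by (intro adjoin_least[OF K(1) F_subset_K]) auto
  then show ?thesis
    using agree_on_radical_field[OF g G.one_closed r(1) _ u] r u by auto
qed

lemma acts_products:
  assumes g: "g \<in> Gal K F" "acts g e"
  shows "g (rb * ry) = \<zeta> ^ (e 1 + e 5) * (rb * ry)" "g (rx * rc) = \<zeta> ^ (e 4 + e 2) * (rx * rc)"
  using g(2) galois_groupD(3)[OF K(1) g(1)] radical_mem_K
  by (simp_all add: acts_iff set_rs power_add mult_ac)

lemma subextension_K: "adjoin F {rb} \<subseteq> K" "adjoin F {rb * ry} \<subseteq> K" "adjoin F {rx * rc} \<subseteq> K" "adjoin F {rc} \<subseteq> K"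
  using subextension K(2) by auto

lemma f_fixed:
  assumes g: "g \<in> Gal K F" "acts g e"
  shows "e 1 = 0 \<Longrightarrow> u \<in> adjoin F {rb} \<Longrightarrow> g u = u"
    "e 1 = 0 \<Longrightarrow> e 5 = 0 \<Longrightarrow> u \<in> adjoin F {rb * ry} \<Longrightarrow> g u = u"
    "e 4 = 0 \<Longrightarrow> e 2 = 0 \<Longrightarrow> u \<in> adjoin F {rx * rc} \<Longrightarrow> g u = u"
    "e 2 = 0 \<Longrightarrow> u \<in> adjoin F {rc} \<Longrightarrow> g u = u"
  using fixes_radical_field[OF g(1)] acts_products[OF g] g(2) subextension_K
    adjoin_gen[of rb "{rb}" F] adjoin_gen[of "rb * ry" "{rb * ry}" F]
    adjoin_gen[of "rx * rc" "{rx * rc}" F] adjoin_gen[of rc "{rc}" F]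
  by (auto simp: acts_iff)

lemma norm_as_orbit_product:
  assumes g: "g \<in> Gal K F" "acts g e"
  shows "e 1 = 1 \<Longrightarrow> (\<Prod>i<p. (g ^^ i) f1) = ra ^ p * rx ^ p"
    "e 1 + e 5 = 1 \<Longrightarrow> (\<Prod>i<p. (g ^^ i) f2) = inverse (rx ^ p)"
    "e 4 + e 2 = 1 \<Longrightarrow> (\<Prod>i<p. (g ^^ i) f3) = inverse (ry ^ p)"
    "e 2 = 1 \<Longrightarrow> (\<Prod>i<p. (g ^^ i) f4) = ry ^ p * rd ^ p"
  using field_norm_radical[OF radical_b K(1) subextension_K(1) g(1) _, of f1]
    field_norm_radical[OF radical_by K(1) subextension_K(2) g(1) _, of f2]
    field_norm_radical[OF radical_xc K(1) subextension_K(3) g(1) _, of f3]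
    field_norm_radical[OF radical_c K(1) subextension_K(4) g(1) _, of f4]
    acts_products[OF g] g(2) f_mem norms
  by (simp_all add: acts_iff)

text \<open>How the basic automorphisms move \<open>w\<close>: each factor \<open>W(f)\<close> is multiplied by \<open>N(f) / f ^ p\<close> or fixed,
  and the norms are prescribed so that the product of these factors is a \<open>p\<close>-th power.\<close>

lemma w_moved:
  assumes g: "g \<in> Gal K F" and j: "acts g (unit_exp j)"
  shows "j = 0 \<Longrightarrow> g w = w" "j = 1 \<Longrightarrow> g w = (ra / (f1 * f2)) ^ p * w"
    "j = 2 \<Longrightarrow> g w = (rd / (f3 * f4)) ^ p * w" "j = 3 \<Longrightarrow> g w = w"
    "j = 4 \<Longrightarrow> g w = (1 / (ry * f3)) ^ p * w" "j = 5 \<Longrightarrow> g w = (1 / (rx * f2)) ^ p * w"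
proof -
  let ?W1 = "W_elem F \<zeta> p rb f1" and ?W2 = "W_elem F \<zeta> p (rb * ry) f2"
    and ?W3 = "W_elem F \<zeta> p (rx * rc) f3" and ?W4 = "W_elem F \<zeta> p rc f4"
  have W: "?W1 \<in> adjoin F {rb}" "?W2 \<in> adjoin F {rb * ry}" "?W3 \<in> adjoin F {rx * rc}" "?W4 \<in> adjoin F {rc}"
    using W_mem by blast+
  then have WK: "?W1 \<in> K" "?W2 \<in> K" "?W3 \<in> K" "?W4 \<in> K" using subextension_K by blast+
  have gw: "g w = g ?W1 * g ?W2 * g ?W3 * g ?W4"
    unfolding w_def using WK by (simp add: galois_groupD(3)[OF K(1) g] subfield_closed(4)[OF K(1)])
  note fixed = f_fixed[OF g j, unfolded unit_exp_def]
  have m1: "g ?W1 * f1 ^ p = ?W1 * (ra ^ p * rx ^ p)" if "j = 1"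
    using W_elem_generator[OF radical_b K(1) subextension_K(1) g, of f1] j f_mem norms that
    by (simp add: acts_iff unit_exp_def)
  have m2: "g ?W2 * f2 ^ p = ?W2 * inverse (rx ^ p)" if "j = 1 \<or> j = 5"
    using W_elem_generator[OF radical_by K(1) subextension_K(2) g, of f2]
      acts_products(1)[OF g j] f_mem norms that
    by (auto simp add: unit_exp_def)
  have m3: "g ?W3 * f3 ^ p = ?W3 * inverse (ry ^ p)" if "j = 4 \<or> j = 2"
    using W_elem_generator[OF radical_xc K(1) subextension_K(3) g, of f3]
      acts_products(2)[OF g j] f_mem norms that
    by (auto simp add: unit_exp_def)
  have m4: "g ?W4 * f4 ^ p = ?W4 * (ry ^ p * rd ^ p)" if "j = 2"
    using W_elem_generator[OF radical_c K(1) subextension_K(4) g, of f4] j f_mem norms that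
    by (simp add: acts_iff unit_exp_def)
  have div: "u = v / f ^ p" if "u * f ^ p = v" "f \<noteq> 0" for u v f :: 'a using that by (simp add: field_simps)
  note nz = radical_nonzero f_nonzero
  show "g w = w" if "j = 0" using fixed W that by (simp add: gw) (simp add: w_def)
  show "g w = w" if "j = 3" using fixed W that by (simp add: gw) (simp add: w_def)
  show "g w = (ra / (f1 * f2)) ^ p * w" if "j = 1"
    using fixed(3,4) W that div[OF m1] div[OF m2] nz
    by (simp add: gw) (simp add: w_def field_simps power_mult_distrib)
  show "g w = (rd / (f3 * f4)) ^ p * w" if "j = 2"
    using fixed(1,2) W that div[OF m3] div[OF m4] nz
    by (simp add: gw) (simp add: w_def field_simps power_mult_distrib)
  show "g w = (1 / (ry * f3)) ^ p * w" if "j = 4"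
    using fixed(1,2,4) W that div[OF m3] nz
    by (simp add: gw) (simp add: w_def field_simps power_mult_distrib)
  show "g w = (1 / (rx * f2)) ^ p * w" if "j = 5"
    using fixed(1,3,4) W that div[OF m2] nz
    by (simp add: gw) (simp add: w_def field_simps power_mult_distrib)
qed

end

end

section \<open>Fixed fields of central pairs\<close>

lemma restrict_to_fixed_field:
  assumes K: "subfield_of_type K" "E \<subseteq> K" and S: "S \<subseteq> Gal K E"
    and g: "g \<in> Gal K E"
    and comm: "\<And>h. h \<in> S \<Longrightarrow> g \<otimes>\<^bsub>galois_group K E\<^esub> h = h \<otimes>\<^bsub>galois_group K E\<^esub> g"
  shows "restrict g (fixed_field K S) \<in> Gal (fixed_field K S) E"
proof -
  let ?L = "fixed_field K S"
  interpret G: group "galois_group K E" by (rule galois_group_group[OF K])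
  have L: "subfield_of_type ?L" by (rule fixed_field_subfield[OF K(1) S])
  note Lc = subfield_closed[OF L] and gd = galois_groupD[OF K(1) g]
  have LK: "t \<in> K" if "t \<in> ?L" for t using that by (simp add: fixed_field_def)
  have fixed: "h t = t" if "t \<in> ?L" "h \<in> S" for h t using that by (simp add: fixed_field_def)
  have stable: "g t \<in> ?L" if t: "t \<in> ?L" for t
  proof -
    have "h (g t) = g t" if h: "h \<in> S" for h
      using galois_mult_apply[OF subsetD[OF S h] g LK[OF t]] galois_mult_apply[OF g subsetD[OF S h] LK[OF t]]
        comm[OF h] fixed[OF t h] by simp
    then show ?thesis using gd(1)[OF LK[OF t]] by (simp add: fixed_field_def)
  qed
  have onto: "\<exists>v\<in>?L. g v = t" if t: "t \<in> ?L" for t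
  proof -
    let ?v = "(inv\<^bsub>galois_group K E\<^esub> g) t"
    have g': "inv\<^bsub>galois_group K E\<^esub> g \<in> Gal K E" using g by simp
    have v: "?v \<in> K" by (rule galois_groupD(1)[OF K(1) g' LK[OF t]])
    have gv: "g ?v = t"
      using galois_mult_apply[OF g g' LK[OF t]] G.r_inv[OF g] LK[OF t] by simp
    have "h ?v = ?v" if h: "h \<in> S" for h
    proof -
      have hc: "h \<in> Gal K E" using S h by auto
      have "g (h ?v) = h (g ?v)"
        using galois_mult_apply[OF hc g v] galois_mult_apply[OF g hc v] comm[OF h] by simp
      also have "\<dots> = g ?v" using fixed[OF t h] by (simp add: gv)
      finally have "g (h ?v) = g ?v" .
      moreover have "inj_on g K" using g by (auto simp: galois_group_iff bij_betw_def)
      ultimately show ?thesis using v galois_groupD(1)[OF K(1) hc v] by (auto dest: inj_onD)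
    qed
    then show ?thesis using v gv by (auto simp: fixed_field_def)
  qed
  have EL: "E \<subseteq> ?L"
    using K(2) S galois_groupD(11)[OF K(1)] by (auto simp: fixed_field_def)
  have "inj_on g ?L"
    using g LK by (auto simp: galois_group_iff bij_betw_def intro: inj_on_subset)
  then have bij: "bij_betw (restrict g ?L) ?L ?L"
    using stable onto by (intro bij_betw_imageI) (auto simp: image_iff inj_on_def, metis)
  show ?thesis
    unfolding galois_group_iff
    using bij LK Lc(2-4) EL by (auto simp: gd(2-4,11))
qed

lemma fixed_field_generate:
  assumes K: "subfield_of_type K" "E \<subseteq> K" and S: "S \<subseteq> Gal K E"
  shows "fixed_field K (generate (galois_group K E) S) = fixed_field K S"
proof
  let ?G = "galois_group K E"
  interpret G: group ?G by (rule galois_group_group[OF K])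
  show "fixed_field K (generate ?G S) \<subseteq> fixed_field K S"
    by (auto simp: fixed_field_def intro: generate.incl)
  have "h t = t" if "h \<in> generate ?G S" "t \<in> fixed_field K S" for h t
    using that(1)
  proof (induction rule: generate.induct)
    case one
    then show ?case using that(2) by (simp add: fixed_field_def)
  next
    case (incl h)
    then show ?case using that(2) by (simp add: fixed_field_def)
  next
    case (inv h)
    then have h: "h \<in> carrier ?G" "h t = t" "t \<in> K" using S that(2) by (auto simp: fixed_field_def)
    have "(inv\<^bsub>?G\<^esub> h) (h t) = (inv\<^bsub>?G\<^esub> h \<otimes>\<^bsub>?G\<^esub> h) t"
      by (rule galois_mult_apply[symmetric, OF G.inv_closed[OF h(1)] h(1,3)])
    also have "\<dots> = t" using h by simp
    finally show ?case by (simp add: h(2))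
  next
    case (eng h1 h2)
    then have "h1 \<in> carrier ?G" "h2 \<in> carrier ?G" using G.generate_incl[OF S] by auto
    then show ?case using eng.IH that(2) by (simp add: fixed_field_def)
  qed
  then show "fixed_field K S \<subseteq> fixed_field K (generate ?G S)" by (auto simp: fixed_field_def)
qed

context kummer_base begin

text \<open>Lagrange resolvents for \<open>V\<close> and then for \<open>U\<close> show \<open>K = L(u, v)\<close>. Since \<open>u\<^sup>p\<close> and \<open>v\<^sup>p\<close> lie in \<open>E\<close>, an
  automorphism of \<open>L\<close> extends to \<open>K\<close> by fixing \<open>u\<close> and \<open>v\<close>, so restriction to \<open>L\<close> is onto. An automorphism
  that is trivial on \<open>L\<close> multiplies \<open>u\<close> and \<open>v\<close> by powers of \<open>\<zeta>\<close>, and so agrees with a product of powers of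
  \<open>U\<close> and \<open>V\<close>. Restriction is possible in the first place because \<open>U\<close> and \<open>V\<close> are central.\<close>

lemma fixed_field_of_central_pair:
  fixes K U V u v
  defines "G \<equiv> galois_group K E"
  defines "A \<equiv> generate G {U, V}"
  defines "L \<equiv> fixed_field K A"
  assumes p: "of_nat p \<noteq> (0 :: 'a)" and gal: "finite_galois K E"
    and UV: "U \<in> carrier G" "V \<in> carrier G"
    and central: "\<And>g. g \<in> carrier G \<Longrightarrow> U \<otimes>\<^bsub>G\<^esub> g = g \<otimes>\<^bsub>G\<^esub> U" "\<And>g. g \<in> carrier G \<Longrightarrow> V \<otimes>\<^bsub>G\<^esub> g = g \<otimes>\<^bsub>G\<^esub> V"
    and ord: "U [^]\<^bsub>G\<^esub> p = \<one>\<^bsub>G\<^esub>" "V [^]\<^bsub>G\<^esub> p = \<one>\<^bsub>G\<^esub>"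
    and u: "u \<in> K" "u \<noteq> 0" "u ^ p \<in> E" "U u = \<zeta> * u" "V u = u"
    and v: "v \<in> K" "v \<noteq> 0" "v ^ p \<in> E" "V v = \<zeta> * v" "U v = v"
  shows "finite_galois L E" and "group_hom G (galois_group L E) (\<lambda>g. restrict g L)"
    and "(\<lambda>g. restrict g L) ` carrier G = Gal L E"
    and "kernel G (galois_group L E) (\<lambda>g. restrict g L) = A"
proof -
  have K: "subfield_of_type K" "E \<subseteq> K" using gal by (auto simp: finite_galois_def)
  note UV' = UV[unfolded G_def]
  interpret G: group G unfolding G_def by (rule galois_group_group[OF K])
  have A_sub: "A \<subseteq> carrier G" unfolding A_def using UV by (intro G.generate_incl) auto
  have A_central: "g \<otimes>\<^bsub>G\<^esub> h = h \<otimes>\<^bsub>G\<^esub> g" if g: "g \<in> carrier G" and h: "h \<in> A" for g h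
    using h unfolding A_def
  proof (induction rule: generate.induct)
    case (inv h)
    then have "h \<in> carrier G" "g \<otimes>\<^bsub>G\<^esub> h = h \<otimes>\<^bsub>G\<^esub> g" using UV central g by auto
    then show ?case using g
      by (metis G.inv_closed G.inv_solve_left G.inv_solve_right' G.m_assoc G.m_closed)
  next
    case (eng h1 h2)
    then have "h1 \<in> carrier G" "h2 \<in> carrier G" using A_sub by (auto simp: A_def)
    then show ?case using eng.IH g by (metis G.m_assoc)
  qed (use g central UV in auto)
  have L: "subfield_of_type L"
    unfolding L_def by (rule fixed_field_subfield[OF K(1)]) (use A_sub in \<open>simp add: G_def\<close>)
  have LK: "L \<subseteq> K" by (auto simp: L_def fixed_field_def)
  have EL: "E \<subseteq> L"
    using K A_sub galois_groupD(11)[OF K(1)] by (auto simp: L_def fixed_field_def G_def)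
  have L_iff: "t \<in> L \<longleftrightarrow> t \<in> K \<and> U t = t \<and> V t = t" for t
    using fixed_field_generate[OF K, of "{U, V}"] UV' by (auto simp: L_def A_def G_def fixed_field_def)
  have res: "restrict g L \<in> Gal L E" if "g \<in> carrier G" for g
    unfolding L_def
    by (rule restrict_to_fixed_field[OF K]) (use that A_sub A_central in \<open>auto simp: G_def\<close>)
  interpret GL: group "galois_group L E" by (rule galois_group_group[OF L EL])
  show hom: "group_hom G (galois_group L E) (\<lambda>g. restrict g L)"
  proof (intro group_hom.intro group_hom_axioms.intro homI G.is_group GL.is_group res)
    fix g h assume g: "g \<in> carrier G" and h: "h \<in> carrier G"
    show "restrict (g \<otimes>\<^bsub>G\<^esub> h) L = restrict g L \<otimes>\<^bsub>galois_group L E\<^esub> restrict h L"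
    proof (rule galois_group_eqI[OF res[OF G.m_closed[OF g h]] GL.m_closed[OF res[OF g] res[OF h]]])
      fix t assume t: "t \<in> L"
      have "h t \<in> L" using galois_groupD(1)[OF L res[OF h] t] t by simp
      then show "restrict (g \<otimes>\<^bsub>G\<^esub> h) L t = (restrict g L \<otimes>\<^bsub>galois_group L E\<^esub> restrict h L) t"
        using t LK galois_mult_apply[OF res[OF g] res[OF h] t]
          galois_mult_apply[OF g[unfolded G_def] h[unfolded G_def], of t]
        by (auto simp: G_def)
    qed
  qed
  define L1 where "L1 = fixed_field K {V}"
  have L1: "subfield_of_type L1" unfolding L1_def by (rule fixed_field_subfield[OF K(1)]) (use UV' in auto)
  have L1_iff: "t \<in> L1 \<longleftrightarrow> t \<in> K \<and> V t = t" for t by (auto simp: L1_def fixed_field_def)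
  have L1K: "L1 \<subseteq> K" and LL1: "L \<subseteq> L1" and EL1: "E \<subseteq> L1" using L1_iff L_iff EL by auto
  have period: "(g ^^ p) t = t" if "g \<in> carrier G" "g [^]\<^bsub>G\<^esub> p = \<one>\<^bsub>G\<^esub>" "t \<in> K" for g t
    using galois_pow_apply[OF K, of g t p] that by (simp add: G_def)
  have K_eq: "K = adjoin L1 {v}"
    unfolding L1_def using period[OF UV(2) ord(2)] UV' v by (intro adjoin_eigenvector[OF p K]) auto
  define U1 where "U1 = restrict U L1"
  have U1: "U1 \<in> Gal L1 E"
    unfolding U1_def L1_def
    by (rule restrict_to_fixed_field[OF K]) (use UV' central(2)[OF UV(1)] in \<open>auto simp: G_def\<close>)
  have uL1: "u \<in> L1" using u L1_iff by auto
  have "(U1 ^^ n) t = (U ^^ n) t" if t: "t \<in> L1" for n t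
  proof (induction n)
    case (Suc n)
    have "(U1 ^^ Suc n) t = U ((U1 ^^ n) t)"
      using galois_funpow_mem[OF L1 U1 t, of n] by (simp add: U1_def)
    then show ?case using Suc by simp
  qed simp
  then have "(U1 ^^ p) t = t" if "t \<in> L1" for t using that period[OF UV(1) ord(1)] L1K by auto
  then have "L1 = adjoin (fixed_field L1 {U1}) {u}"
    using U1 uL1 u by (intro adjoin_eigenvector[OF p L1 EL1]) (auto simp: U1_def)
  moreover have "fixed_field L1 {U1} = L"
    using L1_iff L_iff by (auto simp: fixed_field_def U1_def)
  ultimately have L1_eq: "L1 = adjoin L {u}" by simp
  have zeta_1: "\<zeta> \<noteq> 1" using zeta_pow_eq_1_iff[of 1] p_gt_1 by auto
  have uL: "u \<notin> L" and vL1: "v \<notin> L1" using u v zeta_1 by (auto simp: L_iff L1_iff)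
  have surj: "\<exists>g\<in>carrier G. restrict g L = \<theta>" if \<theta>: "\<theta> \<in> Gal L E" for \<theta>
  proof -
    interpret L: kummer_base p \<zeta> L by (rule kummer_base_extend[OF L EL])
    interpret L1: kummer_base p \<zeta> L1 by (rule kummer_base_extend[OF L1 EL1])
    have "\<theta> (u ^ p) = 1 ^ p * u ^ p" using galois_groupD(11)[OF L \<theta> u(3)] by simp
    then obtain \<theta>1 where \<theta>1: "\<theta>1 \<in> Gal L1 E" "\<And>t. t \<in> L \<Longrightarrow> \<theta>1 t = \<theta> t"
      using L.galois_extend_to_radical[OF _ uL EL \<theta> L.base_closed(2)] u(3) EL unfolding L1_eq by auto
    have "\<theta>1 (v ^ p) = 1 ^ p * v ^ p" using galois_groupD(11)[OF L1 \<theta>1(1) v(3)] by simp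
    then obtain g where g: "g \<in> carrier G" "\<And>t. t \<in> L1 \<Longrightarrow> g t = \<theta>1 t"
      using L1.galois_extend_to_radical[OF _ vL1 EL1 \<theta>1(1) L1.base_closed(2)] v(3) EL1
      unfolding K_eq[symmetric] G_def by auto
    have "restrict g L = \<theta>"
      by (rule galois_group_eqI[OF res[OF g(1)] \<theta>]) (use g(2) \<theta>1(2) LL1 in auto)
    then show ?thesis using g(1) by blast
  qed
  then show image: "(\<lambda>g. restrict g L) ` carrier G = Gal L E"
    using res by (auto simp: image_iff)
  show "kernel G (galois_group L E) (\<lambda>g. restrict g L) = A"
  proof
    show "A \<subseteq> kernel G (galois_group L E) (\<lambda>g. restrict g L)"
    proof
      fix g assume g: "g \<in> A"
      have "restrict g L = (\<lambda>t\<in>L. t)" using g by (auto simp: L_def fixed_field_def)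
      then show "g \<in> kernel G (galois_group L E) (\<lambda>g. restrict g L)"
        using g A_sub by (auto simp: kernel_def galois_one)
    qed
    show "kernel G (galois_group L E) (\<lambda>g. restrict g L) \<subseteq> A"
    proof
      fix g assume "g \<in> kernel G (galois_group L E) (\<lambda>g. restrict g L)"
      then have g: "g \<in> Gal K E" and one: "restrict g L = (\<lambda>t\<in>L. t)"
        by (auto simp: kernel_def galois_one G_def)
      have gL: "g t = t" if "t \<in> L" for t using fun_cong[OF one, of t] that by simp
      have root: "\<exists>k. g t = \<zeta> ^ k * t" if "t \<in> K" "t ^ p \<in> E" for t
      proof -
        have "g t ^ p = t ^ p" using galois_groupD(10,11)[OF K(1) g] that by metis
        then show ?thesis using pth_roots_differ_by_zeta by blast
      qed
      obtain i where i: "g u = \<zeta> ^ i * u" using root u by blast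
      obtain j where j: "g v = \<zeta> ^ j * v" using root v by blast
      define h where "h = U [^]\<^bsub>G\<^esub> i \<otimes>\<^bsub>G\<^esub> V [^]\<^bsub>G\<^esub> j"
      have pow_A: "U [^]\<^bsub>G\<^esub> n \<in> A" "V [^]\<^bsub>G\<^esub> n \<in> A" for n :: nat
        unfolding A_def
        by (induction n) (auto intro: generate.intros)
      then have hA: "h \<in> A" unfolding h_def A_def by (auto intro: generate.eng)
      have h: "h \<in> Gal K E" using hA A_sub by (auto simp: G_def)
      have zK: "\<zeta> \<in> K" using zeta_mem K(2) by auto
      have h_apply: "h t = (U ^^ i) ((V ^^ j) t)" if t: "t \<in> K" for t
        unfolding h_def G_def
        using galois_mult_apply[OF subsetD[OF A_sub pow_A(1), unfolded G_def] subsetD[OF A_sub pow_A(2), unfolded G_def] t]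
          galois_pow_apply[OF K UV'(2) t] galois_pow_apply[OF K UV'(1) galois_funpow_mem[OF K(1) UV'(2) t]]
        by simp
      have V_u: "(V ^^ n) u = u" and U_v: "(U ^^ n) v = v" for n
        by (induction n) (use u v in auto)
      have hu: "h u = \<zeta> ^ i * u"
        using h_apply[OF u(1)] galois_funpow_root[OF K(1) UV'(1) zeta_mem zK u(1,4)] by (simp add: V_u)
      have zjK: "\<zeta> ^ j \<in> E" using zeta_mem base_closed(9) by blast
      have Uz: "(U ^^ i) t = t" if "t \<in> E" for t
        by (induction i) (use that galois_groupD(11)[OF K(1) UV'(1)] in auto)
      have hv: "h v = \<zeta> ^ j * v"
      proof -
        have "h v = (U [^]\<^bsub>G\<^esub> i) (\<zeta> ^ j * v)"
          using h_apply[OF v(1)] galois_funpow_root[OF K(1) UV'(2) zeta_mem zK v(1,4)]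
            galois_pow_apply[OF K UV'(1), of "\<zeta> ^ j * v"] K(2) zjK v(1) subfield_closed(4)[OF K(1)]
          by (auto simp: G_def)
        also have "\<dots> = \<zeta> ^ j * v"
          using galois_groupD(3)[OF K(1) subsetD[OF A_sub pow_A(1), unfolded G_def], of "\<zeta> ^ j" v] zjK K(2) v(1)
            galois_groupD(11)[OF K(1) subsetD[OF A_sub pow_A(1), unfolded G_def] zjK]
            galois_pow_apply[OF K UV'(1) v(1)] U_v
          by (auto simp: G_def)
        finally show ?thesis .
      qed
      have hL: "h t = t" if "t \<in> L" for t using hA that by (auto simp: L_def fixed_field_def)
      have sub: "L \<union> {u, v} \<subseteq> K" using LK u v by auto
      have agree: "g t = h t" if "t \<in> L \<union> {u, v}" for t
        using that gL hL hu hv i j by auto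
      have "K = adjoin L {u, v}" using K_eq L1_eq adjoin_adjoin[of L "{u}" "{v}"] by (metis insert_is_Un)
      then have "g t = h t" if "t \<in> K" for t
        using galois_group_agree_on_adjoin[OF K(1) g K(1) h sub sub agree, of t] that by auto
      then have "g = h" by (intro galois_group_eqI[OF g h])
      then show "g \<in> A" using hA by simp
    qed
  qed
  interpret R: ring "ring_of_type_algebra :: 'a ring" by (rule ring_from_type_algebra)
  have "R.finite_dimension E L"
  proof (rule R.subalbegra_incl_imp_finite_dimension[OF base_subfield _ _ LK])
    show "R.finite_dimension E K" using gal by (simp add: finite_galois_def)
    have "subgroup L (add_monoid ring_of_type_algebra)"
      using subfieldE(1)[OF L] subring.axioms(1) by blast
    then show "subalgebra E L ring_of_type_algebra"
      using EL subfield_closed(4)[OF L] by (auto simp: subalgebra_def subalgebra_axioms_def)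
  qed
  moreover have "fixed_field L (Gal L E) = E"
  proof
    show "fixed_field L (Gal L E) \<subseteq> E"
    proof
      fix t assume t: "t \<in> fixed_field L (Gal L E)"
      then have tL: "t \<in> L" by (simp add: fixed_field_def)
      have "g t = t" if "g \<in> carrier G" for g
        using res[OF that] t tL by (auto simp: fixed_field_def)
      then have "t \<in> fixed_field K (Gal K E)"
        using tL LK by (auto simp: fixed_field_def G_def)
      then show "t \<in> E" using gal by (simp add: finite_galois_def)
    qed
    show "E \<subseteq> fixed_field L (Gal L E)"
      using EL galois_groupD(11)[OF L] by (auto simp: fixed_field_def)
  qed
  ultimately show "finite_galois L E" using base_subfield L EL by (simp add: finite_galois_def)
qed

end

context six_radicals begin

text \<open>The \<open>j\<close>-th basic automorphism multiplies \<open>w\<close> by the \<open>p\<close>-th power of \<open>multiplier j\<close>.\<close>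

definition multiplier :: "nat \<Rightarrow> 'a" where
  "multiplier j = [1, ra / (f1 * f2), rd / (f3 * f4), 1, 1 / (ry * f3), 1 / (rx * f2)] ! j"

text \<open>The value at \<open>1\<close> appears twice because the simplifier turns \<open>1\<close> into \<open>Suc 0\<close>.\<close>

lemma multiplier_simps:
  "multiplier 0 = 1" "multiplier 1 = ra / (f1 * f2)" "multiplier 2 = rd / (f3 * f4)"
  "multiplier (Suc 0) = ra / (f1 * f2)" "multiplier 3 = 1" "multiplier 4 = 1 / (ry * f3)" "multiplier 5 = 1 / (rx * f2)"
  by (simp_all add: multiplier_def)

lemma less_6_cases: "j < (6::nat) \<Longrightarrow> j = 0 \<or> j = 1 \<or> j = 2 \<or> j = 3 \<or> j = 4 \<or> j = 5"
  by linarith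

lemma multiplier_mem: "j < 6 \<Longrightarrow> multiplier j \<in> M" and multiplier_nonzero: "j < 6 \<Longrightarrow> multiplier j \<noteq> 0"
proof -
  have "\<forall>j<6. multiplier j \<in> M \<and> multiplier j \<noteq> 0"
    unfolding all_less_6 multiplier_simps
    by (simp add: radical_mem f_mem_M radical_nonzero f_nonzero subfield_closed(2,4,8)[OF M_subfield])
  then show "j < 6 \<Longrightarrow> multiplier j \<in> M" "j < 6 \<Longrightarrow> multiplier j \<noteq> 0" by auto
qed

lemmas M_over_M = M_subfield order_refl[of M]

lemma w_moved_multiplier:
  assumes "subfield_of_type K" "M \<subseteq> K" "g \<in> Gal K F" "acts g (unit_exp j)" "j < 6"
  shows "g w = multiplier j ^ p * w"
  using w_moved[OF assms(1-4)] less_6_cases[OF assms(5)]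
  by (auto simp: multiplier_simps simp del: One_nat_def)

text \<open>A \<open>p\<close>-th root \<open>m\<close> of \<open>s * w\<close> in \<open>M\<close> would be multiplied by the automorphisms for \<open>a\<close> and \<open>b\<close> by \<open>1\<close> and
  by \<open>multiplier 1\<close>, up to roots of unity. The first of them multiplies \<open>multiplier 1\<close> by \<open>\<zeta>\<close>, so they would
  not commute on \<open>m\<close>, although they commute on \<open>M\<close>.\<close>

lemma w_not_power:
  assumes s: "s \<in> F - {0}" shows "s * w \<notin> power_units p M"
proof
  assume "s * w \<in> power_units p M"
  then obtain m where m: "m \<in> M" "m \<noteq> 0" "s * w = m ^ p" by (auto simp: power_units_def)
  obtain g where g: "g \<in> Gal M F" "acts g (unit_exp 0)" using tower(2) by blast
  obtain h where h: "h \<in> Gal M F" "acts h (unit_exp 1)" using tower(2) by blast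
  note gd = galois_groupD[OF M_subfield g(1)] and hd = galois_groupD[OF M_subfield h(1)]
  define \<gamma> where "\<gamma> = multiplier 1"
  have \<gamma>: "\<gamma> \<in> M" "\<gamma> \<noteq> 0" using multiplier_mem multiplier_nonzero by (auto simp: \<gamma>_def)
  have sM: "s \<in> M" using s F_subset_M by auto
  have power_moved: "k m ^ p = (\<mu> * m) ^ p"
    if k: "k \<in> Gal M F" "k w = \<mu> ^ p * w" for k \<mu>
  proof -
    note kd = galois_groupD[OF M_subfield k(1)]
    have "k m ^ p = k (s * w)" by (simp add: m(3) kd(10)[OF m(1)])
    also have "\<dots> = s * (\<mu> ^ p * w)" using kd(3)[OF sM w_mem] kd(11)[of s] s k(2) by simp
    also have "\<dots> = \<mu> ^ p * (s * w)" by (simp only: mult.left_commute)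
    also have "\<dots> = (\<mu> * m) ^ p" by (simp only: m(3) power_mult_distrib)
    finally show ?thesis .
  qed
  have "g m ^ p = m ^ p"
    using power_moved[OF g(1), of 1] w_moved_multiplier[OF M_over_M g]
    by (simp add: multiplier_simps)
  then obtain i where i: "g m = \<zeta> ^ i * m" using pth_roots_differ_by_zeta by blast
  have "h m ^ p = (\<gamma> * m) ^ p"
    unfolding \<gamma>_def by (rule power_moved[OF h(1) w_moved_multiplier[OF M_over_M h]]) simp
  then obtain j where j: "h m = \<zeta> ^ j * (\<gamma> * m)" using pth_roots_differ_by_zeta by blast
  have g\<gamma>: "g \<gamma> = \<zeta> * \<gamma>"
    using f_fixed[OF M_over_M g] f_mem f_mem_M radical_mem g(2)
    by (simp add: \<gamma>_def multiplier_simps gd(3,9) subfield_closed(4)[OF M_subfield] acts_iff unit_exp_def)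
  have zM: "\<zeta> ^ n \<in> M" for n by (rule zeta_power_mem_K[OF M_over_M])
  have z_fixed: "g (\<zeta> ^ n) = \<zeta> ^ n" "h (\<zeta> ^ n) = \<zeta> ^ n" for n
    using zeta_power_fixed[OF M_over_M] g h by auto
  let ?G = "galois_group M F"
  interpret G: group ?G by (rule galois_group_group[OF M_subfield F_subset_M])
  have "(g \<otimes>\<^bsub>?G\<^esub> h) m = (h \<otimes>\<^bsub>?G\<^esub> g) m"
    by (rule agree_on_M[OF M_over_M _ acts_mult[OF M_over_M g h]
          _ acts_mult[OF M_over_M h g] _ m(1)])
       (use g h in \<open>auto simp: add.commute\<close>)
  moreover have "(g \<otimes>\<^bsub>?G\<^esub> h) m = \<zeta> * (\<zeta> ^ j * \<zeta> ^ i * \<gamma> * m)"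
    using g h m(1) by (simp add: i j g\<gamma> gd(3) zM \<gamma> z_fixed subfield_closed(4)[OF M_subfield])
  moreover have "(h \<otimes>\<^bsub>?G\<^esub> g) m = \<zeta> ^ j * \<zeta> ^ i * \<gamma> * m"
    using g h m(1) by (simp add: i j hd(3) zM z_fixed)
  ultimately have "\<zeta> = 1" using \<gamma> m(2) zeta_nonzero by simp
  then show False using zeta_pow_eq_1_iff[of 1] p_gt_1 by simp
qed

text \<open>The automorphisms with this property are closed under composition, and \<open>w_moved\<close> provides the basic ones.\<close>

lemma w_quotient_is_power:
  assumes \<sigma>: "\<sigma> \<in> Gal M F"
  shows "\<exists>\<gamma>\<in>M - {0}. \<sigma> w = \<gamma> ^ p * w"
proof -
  let ?G = "galois_group M F"
  interpret G: group ?G by (rule galois_group_group[OF M_subfield F_subset_M])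
  define S where "S = {\<sigma> \<in> carrier ?G. \<exists>\<gamma>\<in>M - {0}. \<sigma> w = \<gamma> ^ p * w}"
  note Mc = subfield_closed[OF M_subfield]
  have one: "\<one>\<^bsub>?G\<^esub> \<in> S" using w_mem Mc(2) by (auto simp: S_def intro!: bexI[of _ 1])
  have mult: "g \<otimes>\<^bsub>?G\<^esub> h \<in> S" if g: "g \<in> S" and h: "h \<in> S" for g h
  proof -
    have gc: "g \<in> carrier ?G" and hc: "h \<in> carrier ?G" using g h by (auto simp: S_def)
    obtain \<gamma> \<delta> where \<gamma>: "\<gamma> \<in> M" "\<gamma> \<noteq> 0" "g w = \<gamma> ^ p * w" and \<delta>: "\<delta> \<in> M" "\<delta> \<noteq> 0" "h w = \<delta> ^ p * w"
      using g h by (auto simp: S_def)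
    note gd = galois_groupD[OF M_subfield gc]
    have "(g \<otimes>\<^bsub>?G\<^esub> h) w = g \<delta> ^ p * (\<gamma> ^ p * w)"
      using gc hc \<delta> \<gamma>(3) w_mem by (simp add: gd(3,10) Mc(9))
    then have "(g \<otimes>\<^bsub>?G\<^esub> h) w = (g \<delta> * \<gamma>) ^ p * w" by (simp add: power_mult_distrib)
    moreover have "g \<delta> * \<gamma> \<in> M - {0}" using \<gamma> \<delta> gd(1,12) Mc(4) by simp
    ultimately show ?thesis using gc hc by (auto simp: S_def)
  qed
  have pow: "g [^]\<^bsub>?G\<^esub> (n::nat) \<in> S" if "g \<in> S" for g n
    by (induction n) (use one mult that in auto)
  have "\<forall>j. \<exists>\<sigma>. \<sigma> \<in> carrier ?G \<and> acts \<sigma> (unit_exp j)" using tower(2) by blast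
  then obtain b where b: "b j \<in> carrier ?G" "acts (b j) (unit_exp j)" for j by metis
  have bS: "b j \<in> S" if "j < 6" for j
    using b w_moved_multiplier[OF M_over_M b that] that multiplier_mem[OF that] multiplier_nonzero[OF that]
    unfolding S_def by blast
  obtain e where e: "acts \<sigma> e" using acts_exists[OF M_over_M \<sigma>] by blast
  have acts_b: "acts (b j [^]\<^bsub>?G\<^esub> n) (\<lambda>i. n * unit_exp j i)" for j and n :: nat
    by (rule acts_pow[OF M_over_M b])
  \<comment> \<open>An automorphism of \<open>M\<close> is determined by its exponents, hence a product of powers of the basic ones.\<close>
  have "\<exists>\<tau>\<in>S. acts \<tau> (\<lambda>i. if i < n then e i else 0)" if "n \<le> 6" for n
    using that
  proof (induction n)
    case 0
    have "acts \<one>\<^bsub>?G\<^esub> (\<lambda>i. 0)" using radical_mem by (simp add: acts_iff)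
    then show ?case using one by auto
  next
    case (Suc n)
    then obtain \<tau> where \<tau>: "\<tau> \<in> S" "acts \<tau> (\<lambda>i. if i < n then e i else 0)" by auto
    have "acts (\<tau> \<otimes>\<^bsub>?G\<^esub> b n [^]\<^bsub>?G\<^esub> e n) (\<lambda>i. (if i < n then e i else 0) + e n * unit_exp n i)"
      by (rule acts_mult[OF M_over_M _ \<tau>(2) _ acts_b]) (use \<tau> b in \<open>auto simp: S_def\<close>)
    moreover have "(\<lambda>i. (if i < n then e i else 0) + e n * unit_exp n i) = (\<lambda>i. if i < Suc n then e i else 0)"
      by (auto simp: unit_exp_def fun_eq_iff less_Suc_eq)
    ultimately show ?case using mult[OF \<tau>(1) pow[OF bS]] Suc.prems by force
  qed
  then obtain \<tau> where \<tau>: "\<tau> \<in> S" "acts \<tau> (\<lambda>i. if i < 6 then e i else 0)" by auto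
  then have "\<sigma> w = \<tau> w"
    by (intro agree_on_M[OF M_over_M \<sigma> e _ \<tau>(2) _ w_mem]) (auto simp: S_def)
  then show ?thesis using \<tau>(1) by (auto simp: S_def)
qed

end


section \<open>The extension of degree \<open>p\<^sup>7\<close>\<close>

locale six_radicals_root = six_radicals +
  fixes s z :: 'a
  assumes s: "s \<in> F - {0}" and z: "z ^ p = s * w"
begin

definition Lt :: "'a set" where "Lt = adjoin M {z}"

abbreviation G :: "('a \<Rightarrow> 'a) monoid" where "G \<equiv> galois_group Lt F"

abbreviation compose_G (infixl \<open>\<cdot>\<close> 70) where "g \<cdot> h \<equiv> g \<otimes>\<^bsub>G\<^esub> h"

abbreviation power_G (infixr \<open>\<up>\<close> 75) where "g \<up> (n :: nat) \<equiv> g [^]\<^bsub>G\<^esub> n"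

lemma M_base: "kummer_base p \<zeta> M"
  by (rule kummer_base_extend[OF M_subfield F_subset_M])

lemma s_mem_M: "s \<in> M" using s F_subset_M by auto

lemma z_power_mem: "z ^ p \<in> M"
  using z s_mem_M w_mem subfield_closed(4)[OF M_subfield] by simp

lemma z_nonzero: "z \<noteq> 0"
  using z s w_nonzero p_gt_0 by (auto simp: power_0_left)

lemma z_notin_M: "z \<notin> M"
  using w_not_power[OF s] z z_nonzero unfolding power_units_def by auto

lemma Lt_subfield: "subfield_of_type Lt" and M_subset_Lt: "M \<subseteq> Lt" and z_mem: "z \<in> Lt"
  unfolding Lt_def by (auto intro: adjoin_subfield subsetD[OF adjoin_base] adjoin_gen)

lemmas Lt_over_M = Lt_subfield M_subset_Lt

lemma F_subset_Lt: "F \<subseteq> Lt" using F_subset_M M_subset_Lt by blast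

lemma z_power_moved:
  assumes g: "g \<in> Gal M F" "g w = \<gamma> ^ p * w"
  shows "g (z ^ p) = \<gamma> ^ p * z ^ p"
  using galois_groupD(3)[OF M_subfield g(1) s_mem_M w_mem] galois_groupD(11)[OF M_subfield g(1), of s] g(2) s
  by (simp add: z)

lemma Lt_galois: "finite_galois Lt F"
  unfolding Lt_def
proof (rule kummer_base.galois_radical_step[OF M_base tower(1) z_power_mem z_notin_M])
  fix \<sigma> assume "\<sigma> \<in> Gal M F"
  then show "\<exists>\<gamma>\<in>M - {0}. \<sigma> (z ^ p) = \<gamma> ^ p * z ^ p"
    using w_quotient_is_power z_power_moved by blast
qed

sublocale G: group G by (rule galois_group_group[OF Lt_subfield F_subset_Lt])

lemma G_eqI:
  assumes g: "g \<in> carrier G" and h: "h \<in> carrier G" and eq: "\<And>u. u \<in> M \<Longrightarrow> g u = h u" "g z = h z"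
  shows "g = h"
proof (rule galois_group_eqI[OF g h])
  have sub: "M \<union> {z} \<subseteq> Lt" using M_subset_Lt z_mem by auto
  have "g u = h u" if "u \<in> M \<union> {z}" for u using that eq by auto
  then show "g u = h u" if "u \<in> Lt" for u
    using galois_group_agree_on_adjoin[OF Lt_subfield g Lt_subfield h sub sub, of u] that
    by (auto simp: Lt_def)
qed

lemma G_eqI_acts:
  assumes g: "g \<in> carrier G" "acts g e" and h: "h \<in> carrier G" "acts h e'"
    and eq: "\<And>i. i < 6 \<Longrightarrow> \<zeta> ^ e i = \<zeta> ^ e' i" "g z = h z"
  shows "g = h"
  by (rule G_eqI[OF g(1) h(1) agree_on_M[OF Lt_over_M g h eq(1)] eq(2)])

lemma lift_exists:
  assumes j: "j < 6" shows "\<exists>g\<in>carrier G. acts g (unit_exp j) \<and> g z = multiplier j * z"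
proof -
  obtain \<sigma> where \<sigma>: "\<sigma> \<in> Gal M F" "acts \<sigma> (unit_exp j)" using tower(2) by blast
  have "\<sigma> (z ^ p) = multiplier j ^ p * z ^ p"
    by (rule z_power_moved[OF \<sigma>(1) w_moved_multiplier[OF M_over_M \<sigma> j]])
  from kummer_base.galois_extend_to_radical[OF M_base z_power_mem z_notin_M F_subset_M \<sigma>(1)
      multiplier_mem[OF j] multiplier_nonzero[OF j] this]
  obtain g where g: "g \<in> carrier G" "\<And>u. u \<in> M \<Longrightarrow> g u = \<sigma> u" "g z = multiplier j * z"
    unfolding Lt_def by blast
  then have "acts g (unit_exp j)" using \<sigma>(2) radical_mem by (simp add: acts_iff)
  then show ?thesis using g by blast
qed

lemma central_generator_exists: "\<exists>g\<in>carrier G. acts g (\<lambda>_. 0) \<and> g z = \<zeta> * z"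
proof -
  obtain g where g: "g \<in> Gal Lt M" "g z = \<zeta> * z"
    using kummer_base.radical_generator_exists[OF M_base z_power_mem z_notin_M] unfolding Lt_def by blast
  then have "g \<in> carrier G" using F_subset_M by (auto simp: galois_group_iff)
  moreover have "acts g (\<lambda>_. 0)"
    using galois_groupD(11)[OF Lt_subfield g(1)] radical_mem by (simp add: acts_iff)
  ultimately show ?thesis using g(2) by blast
qed

end

context six_radicals_root begin

lemma M_closed_Lt: "u \<in> M \<Longrightarrow> u \<in> Lt" using M_subset_Lt by blast

lemma restrict_to_M:
  assumes g: "g \<in> carrier G" shows "restrict g M \<in> Gal M F"
proof -
  obtain e where e: "acts g e" using acts_exists[OF Lt_over_M g] by blast
  obtain \<sigma> where \<sigma>: "\<sigma> \<in> Gal M F" "acts \<sigma> e" using tower(2) by blast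
  have sub: "F \<union> set rs \<subseteq> M" using F_subset_M radical_mem by (auto simp: set_rs)
  have "g v = \<sigma> v" if "v \<in> F \<union> set rs" for v
    using that galois_groupD(11)[OF Lt_subfield g] galois_groupD(11)[OF M_subfield \<sigma>(1)] e \<sigma>(2)
    by (auto simp: acts_iff set_rs)
  then have "g u = \<sigma> u" if "u \<in> M" for u
    using galois_group_agree_on_adjoin[OF Lt_subfield g M_subfield \<sigma>(1) order.trans[OF sub M_subset_Lt] sub, of u] that
    by (auto simp: M_def)
  then have "restrict g M = \<sigma>" using \<sigma>(1) by (auto simp: galois_group_iff extensional_def)
  then show ?thesis using \<sigma>(1) by simp
qed

lemma radical_aut_x_iff:
  assumes "g \<in> carrier G"
  shows "radical_aut M F \<zeta> rx {ra, rb, rc, rd, ry} (restrict g M) \<longleftrightarrow> acts g (unit_exp 4)"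
  using restrict_to_M[OF assms] radical_mem by (auto simp: radical_aut_def acts_iff unit_exp_def)

lemma radical_aut_y_iff:
  assumes "g \<in> carrier G"
  shows "radical_aut M F \<zeta> ry {ra, rb, rc, rd, rx} (restrict g M) \<longleftrightarrow> acts g (unit_exp 5)"
  using restrict_to_M[OF assms] radical_mem by (auto simp: radical_aut_def acts_iff unit_exp_def)

text \<open>In particular the \<open>p\<close>-th power of a lift multiplies \<open>z\<close> by an orbit product, whose value follows
  from the norm conditions.\<close>

lemma funpow_multiplier:
  assumes g: "g \<in> carrier G" "g z = \<gamma> * z" and \<gamma>: "\<gamma> \<in> Lt"
  shows "(g ^^ n) z = (\<Prod>i<n. (g ^^ i) \<gamma>) * z"
proof (induction n)
  case (Suc n)
  note gd = galois_groupD[OF Lt_subfield g(1)]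
  have mem: "(g ^^ i) \<gamma> \<in> Lt" for i by (rule galois_funpow_mem[OF Lt_subfield g(1) \<gamma>])
  have "(g ^^ Suc n) z = (\<Prod>i<n. (g ^^ Suc i) \<gamma>) * (\<gamma> * z)"
    using Suc mem z_mem g(2)
    by (simp add: gd(3) subfield_prod[OF Lt_subfield] galois_group_prod[OF Lt_subfield g(1)])
  also have "\<dots> = (\<Prod>i<Suc n. (g ^^ i) \<gamma>) * z"
    by (simp only: prod.lessThan_Suc_shift) (simp add: mult_ac)
  finally show ?case .
qed simp

lemma orbit_product_quotient:
  assumes g: "g \<in> carrier G" and mem: "u \<in> Lt" "v \<in> Lt" "t \<in> Lt"
  shows "(\<Prod>i<n. (g ^^ i) (u / (v * t))) =
    (\<Prod>i<n. (g ^^ i) u) / ((\<Prod>i<n. (g ^^ i) v) * (\<Prod>i<n. (g ^^ i) t))"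
proof -
  have "(g ^^ i) (u / (v * t)) = (g ^^ i) u / ((g ^^ i) v * (g ^^ i) t)" for i
  proof -
    have gi: "g \<up> i \<in> carrier G" using g by simp
    note gd = galois_groupD[OF Lt_subfield gi]
    have eq: "(g ^^ i) r = (g \<up> i) r" if "r \<in> Lt" for r
      using galois_pow_apply[OF Lt_subfield F_subset_Lt g that] by simp
    show ?thesis
      using mem subfield_closed(4,8)[OF Lt_subfield] by (simp add: eq gd(3,9))
  qed
  then show ?thesis by (simp add: prod_dividef prod.distrib)
qed

lemma order_p:
  assumes g: "g \<in> carrier G" "acts g e" "g z = \<gamma> * z" and \<gamma>: "\<gamma> \<in> Lt" "(\<Prod>i<p. (g ^^ i) \<gamma>) = 1"
  shows "g \<up> p = \<one>\<^bsub>G\<^esub>"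
proof -
  have one: "acts \<one>\<^bsub>G\<^esub> (\<lambda>_. 0)" using radical_mem M_closed_Lt by (simp add: acts_iff)
  have "(g \<up> p) z = z"
    using galois_pow_apply[OF Lt_subfield F_subset_Lt g(1) z_mem] funpow_multiplier[OF g(1,3) \<gamma>(1)] \<gamma>(2) by simp
  then show ?thesis
    using g(1) z_mem zeta_pow_p
    by (intro G_eqI_acts[OF _ acts_pow[OF Lt_over_M g(1,2)] G.one_closed one])
       (auto simp: power_mult)
qed

context
  fixes \<tau>
  assumes \<tau>: "\<tau> \<in> carrier G" "acts \<tau> (\<lambda>_. 0)" "\<tau> z = \<zeta> * z"
begin

lemma tau_fixes_M: assumes u: "u \<in> M" shows "\<tau> u = u"
proof -
  have "acts \<one>\<^bsub>G\<^esub> (\<lambda>_. 0)" using radical_mem M_closed_Lt by (simp add: acts_iff)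
  then show ?thesis
    using agree_on_M[OF Lt_over_M \<tau>(1,2) G.one_closed _ _ u] M_closed_Lt[OF u] by auto
qed

lemma tau_pow_z: "(\<tau> \<up> (n::nat)) z = \<zeta> ^ n * z"
  using galois_pow_apply[OF Lt_subfield F_subset_Lt \<tau>(1) z_mem]
    galois_funpow_root[OF Lt_subfield \<tau>(1) zeta_mem _ z_mem \<tau>(3)] F_subset_Lt zeta_mem by auto

text \<open>Two lifts commute up to a power of \<open>\<tau>\<close>, which is read off from their values at \<open>z\<close>.\<close>

lemma commutation:
  assumes g: "g \<in> carrier G" "acts g e" "g z = \<gamma> * z" and h: "h \<in> carrier G" "acts h e'" "h z = \<delta> * z"
    and mem: "\<gamma> \<in> Lt" "\<delta> \<in> Lt" and eq: "g \<delta> * \<gamma> = \<zeta> ^ n * (h \<gamma> * \<delta>)"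
  shows "g \<cdot> h = h \<cdot> g \<cdot> \<tau> \<up> (n::nat)"
proof -
  note gd = galois_groupD[OF Lt_subfield g(1)] and hd = galois_groupD[OF Lt_subfield h(1)]
  note Lc = subfield_closed[OF Lt_subfield]
  have \<tau>n: "\<tau> \<up> n \<in> carrier G" using \<tau>(1) by simp
  have zn: "\<zeta> ^ n \<in> Lt" by (rule zeta_power_mem_K[OF Lt_over_M])
  have zn_fixed: "g (\<zeta> ^ n) = \<zeta> ^ n" "h (\<zeta> ^ n) = \<zeta> ^ n"
    using zeta_power_fixed[OF Lt_over_M] g(1) h(1) by auto
  have "(g \<cdot> h) z = g \<delta> * \<gamma> * z" using g h z_mem mem by (simp add: gd(3) mult_ac)
  moreover have "(h \<cdot> g \<cdot> \<tau> \<up> n) z = \<zeta> ^ n * (h \<gamma> * \<delta>) * z"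
    using g h z_mem mem \<tau>n zn zn_fixed
    by (simp add: galois_mult_apply[OF G.m_closed[OF h(1) g(1)] \<tau>n z_mem] tau_pow_z gd(1,3) hd(1,3) Lc(4) mult_ac)
  ultimately have "(g \<cdot> h) z = (h \<cdot> g \<cdot> \<tau> \<up> n) z" using eq by simp
  moreover have "acts (g \<cdot> h) (\<lambda>i. e i + e' i)" by (rule acts_mult[OF Lt_over_M g(1,2) h(1,2)])
  moreover have "acts (h \<cdot> g \<cdot> \<tau> \<up> n) (\<lambda>i. e' i + e i + n * 0)"
    using g h \<tau> \<tau>n
    by (intro acts_mult[OF Lt_over_M] acts_pow[OF Lt_over_M]) auto
  ultimately show ?thesis
    using g(1) h(1) \<tau>n by (intro G_eqI_acts) (auto simp: add.commute)
qed

end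

end

section \<open>Generators and relations\<close>

text \<open>A choice of the six lifts and of \<open>\<tau>\<close>. The factors \<open>1\<close> are kept in \<open>lift_z\<close> so that all values have the same
  form \<open>\<gamma> * z\<close>.\<close>

locale six_radicals_lifts = six_radicals_root +
  fixes ga gb gc gd gx gy \<tau> :: "'a \<Rightarrow> 'a"
  assumes lifts: "ga \<in> carrier G" "gb \<in> carrier G" "gc \<in> carrier G" "gd \<in> carrier G"
      "gx \<in> carrier G" "gy \<in> carrier G" "\<tau> \<in> carrier G"
    and lift_acts: "acts ga (unit_exp 0)" "acts gb (unit_exp 1)" "acts gc (unit_exp 2)" "acts gd (unit_exp 3)"
      "acts gx (unit_exp 4)" "acts gy (unit_exp 5)" "acts \<tau> (\<lambda>_. 0)"
    and lift_z: "ga z = 1 * z" "gb z = ra / (f1 * f2) * z" "gc z = rd / (f3 * f4) * z" "gd z = 1 * z"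
      "gx z = 1 / (ry * f3) * z" "gy z = 1 / (rx * f2) * z" "\<tau> z = \<zeta> * z"
    and char: "of_nat p \<noteq> (0 :: 'a)"
begin

lemmas mem_Lt = radical_mem[THEN M_closed_Lt] f_mem_M[THEN M_closed_Lt]
lemmas Lt_closed = subfield_closed[OF Lt_subfield]

lemma zeta_mem_Lt: "\<zeta> \<in> Lt" using zeta_mem F_subset_Lt by blast

lemma lift_radicals:
  "ga ra = \<zeta> * ra" "ga rb = rb" "ga rc = rc" "ga rd = rd" "ga rx = rx" "ga ry = ry"
  "gb ra = ra" "gb rb = \<zeta> * rb" "gb rc = rc" "gb rd = rd" "gb rx = rx" "gb ry = ry"
  "gc ra = ra" "gc rb = rb" "gc rc = \<zeta> * rc" "gc rd = rd" "gc rx = rx" "gc ry = ry"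
  "gd ra = ra" "gd rb = rb" "gd rc = rc" "gd rd = \<zeta> * rd" "gd rx = rx" "gd ry = ry"
  "gx ra = ra" "gx rb = rb" "gx rc = rc" "gx rd = rd" "gx rx = \<zeta> * rx" "gx ry = ry"
  "gy ra = ra" "gy rb = rb" "gy rc = rc" "gy rd = rd" "gy rx = rx" "gy ry = \<zeta> * ry"
  "\<tau> ra = ra" "\<tau> rb = rb" "\<tau> rc = rc" "\<tau> rd = rd" "\<tau> rx = rx" "\<tau> ry = ry"
  using lift_acts by (simp_all add: acts_iff unit_exp_def)

lemma lift_f:
  "ga f1 = f1" "ga f2 = f2" "ga f3 = f3" "ga f4 = f4"
  "gb f3 = f3" "gb f4 = f4" "gc f1 = f1" "gc f2 = f2"
  "gd f1 = f1" "gd f2 = f2" "gd f3 = f3" "gd f4 = f4"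
  "gx f1 = f1" "gx f2 = f2" "gx f4 = f4" "gy f1 = f1" "gy f3 = f3" "gy f4 = f4"
  using f_mem f_fixed[OF Lt_over_M lifts(1) lift_acts(1)] f_fixed[OF Lt_over_M lifts(2) lift_acts(2)]
    f_fixed[OF Lt_over_M lifts(3) lift_acts(3)] f_fixed[OF Lt_over_M lifts(4) lift_acts(4)]
    f_fixed[OF Lt_over_M lifts(5) lift_acts(5)] f_fixed[OF Lt_over_M lifts(6) lift_acts(6)]
  by (simp_all add: unit_exp_def)

lemma tau_f: "\<tau> f1 = f1" "\<tau> f2 = f2" "\<tau> f3 = f3" "\<tau> f4 = f4"
  using tau_fixes_M[OF lifts(7) lift_acts(7) lift_z(7)] f_mem_M by auto

text \<open>The lifts for \<open>b\<close> and \<open>y\<close> both multiply \<open>rb * ry\<close> by \<open>\<zeta>\<close>, and those for \<open>x\<close> and \<open>c\<close> both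
  multiply \<open>rx * rc\<close> by \<open>\<zeta>\<close>. This is what makes them commute below.\<close>

lemma lift_f_shared: "gy f2 = gb f2" "gc f3 = gx f3"
proof -
  have "gy (rb * ry) = gb (rb * ry)" "gc (rx * rc) = gx (rx * rc)"
    using mem_Lt
    by (simp_all add: galois_groupD(3)[OF Lt_subfield lifts(2)] galois_groupD(3)[OF Lt_subfield lifts(3)]
        galois_groupD(3)[OF Lt_subfield lifts(5)] galois_groupD(3)[OF Lt_subfield lifts(6)] lift_radicals)
  then show "gy f2 = gb f2" "gc f3 = gx f3"
    using agree_on_radical_field[OF Lt_over_M lifts(6) lifts(2), of "rb * ry" f2]
      agree_on_radical_field[OF Lt_over_M lifts(3) lifts(5), of "rx * rc" f3]
      mem_Lt Lt_closed(4) f_mem by auto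
qed

lemma quotient_moved:
  assumes "g \<in> carrier G" "u \<in> Lt" "v \<in> Lt" "t \<in> Lt"
  shows "g (u / (v * t)) = g u / (g v * g t)"
  using assms(2-) Lt_closed(4) galois_groupD(3,9)[OF Lt_subfield assms(1)] by simp

lemma one_fixed: "g \<in> carrier G \<Longrightarrow> g 1 = 1"
  using galois_groupD(4)[OF Lt_subfield] .

lemmas lift_quotients = quotient_moved[OF lifts(1)] quotient_moved[OF lifts(2)] quotient_moved[OF lifts(3)]
  quotient_moved[OF lifts(4)] quotient_moved[OF lifts(5)] quotient_moved[OF lifts(6)] quotient_moved[OF lifts(7)]

lemmas lift_values = lift_radicals lift_f tau_f lift_f_shared lift_quotients lifts[THEN one_fixed] mem_Lt Lt_closed(2)

lemma multipliers_mem: "1 \<in> Lt" "ra / (f1 * f2) \<in> Lt" "rd / (f3 * f4) \<in> Lt" "1 / (ry * f3) \<in> Lt" "1 / (rx * f2) \<in> Lt"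
  using mem_Lt Lt_closed(2,4,8) by auto

lemma commute:
  assumes "g \<in> carrier G" "acts g e" "g z = \<gamma> * z" and "h \<in> carrier G" "acts h e'" "h z = \<delta> * z"
    and "\<gamma> \<in> Lt" "\<delta> \<in> Lt" "g \<delta> * \<gamma> = h \<gamma> * \<delta>"
  shows "g \<cdot> h = h \<cdot> g"
  using commutation[OF lifts(7) lift_acts(7) lift_z(7) assms(1-8), of 0] assms by simp

lemma commutator:
  assumes "g \<in> carrier G" "acts g e" "g z = \<gamma> * z" and "h \<in> carrier G" "acts h e'" "h z = \<delta> * z"
    and "\<gamma> \<in> Lt" "\<delta> \<in> Lt" "g \<delta> * \<gamma> = \<zeta> * (h \<gamma> * \<delta>)"
  shows "g \<cdot> h = h \<cdot> g \<cdot> \<tau>"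
  using commutation[OF lifts(7) lift_acts(7) lift_z(7) assms(1-8), of 1] assms lifts(7) by simp

lemmas facts_a = lifts(1) lift_acts(1) lift_z(1)
lemmas facts_b = lifts(2) lift_acts(2) lift_z(2)
lemmas facts_c = lifts(3) lift_acts(3) lift_z(3)
lemmas facts_d = lifts(4) lift_acts(4) lift_z(4)
lemmas facts_x = lifts(5) lift_acts(5) lift_z(5)
lemmas facts_y = lifts(6) lift_acts(6) lift_z(6)
lemmas facts_tau = lifts(7) lift_acts(7) lift_z(7)

context
  notes multipliers_mem [simp] lift_values [simp]
begin

text \<open>The automorphism for \<open>a\<close> multiplies \<open>ra\<close>, and with it the multiplier of \<open>gb\<close>, by \<open>\<zeta>\<close>. In the same way the
  one for \<open>d\<close> acts on the multiplier of \<open>gc\<close>; since \<open>d\<close> comes first here, the commutator of \<open>gc\<close> and \<open>gd\<close> is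
  the inverse of \<open>\<tau>\<close>.\<close>

lemma relation_ab: "ga \<cdot> gb = gb \<cdot> ga \<cdot> \<tau>"
  by (rule commutator[OF facts_a facts_b]) simp_all

lemma relation_dc: "gd \<cdot> gc = gc \<cdot> gd \<cdot> \<tau>"
  by (rule commutator[OF facts_d facts_c]) simp_all

lemma zeta_fixed: "g \<in> carrier G \<Longrightarrow> g \<zeta> = \<zeta>"
  using galois_groupD(11)[OF Lt_subfield _ zeta_mem] .

lemma tau_commutes:
  "ga \<cdot> \<tau> = \<tau> \<cdot> ga" "gb \<cdot> \<tau> = \<tau> \<cdot> gb" "gc \<cdot> \<tau> = \<tau> \<cdot> gc"
  "gd \<cdot> \<tau> = \<tau> \<cdot> gd" "gx \<cdot> \<tau> = \<tau> \<cdot> gx" "gy \<cdot> \<tau> = \<tau> \<cdot> gy"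
  by ((rule commute[OF facts_a facts_tau]; simp add: zeta_mem_Lt lifts[THEN zeta_fixed]),
      (rule commute[OF facts_b facts_tau]; simp add: zeta_mem_Lt lifts[THEN zeta_fixed]),
      (rule commute[OF facts_c facts_tau]; simp add: zeta_mem_Lt lifts[THEN zeta_fixed]),
      (rule commute[OF facts_d facts_tau]; simp add: zeta_mem_Lt lifts[THEN zeta_fixed]),
      (rule commute[OF facts_x facts_tau]; simp add: zeta_mem_Lt lifts[THEN zeta_fixed]),
      (rule commute[OF facts_y facts_tau]; simp add: zeta_mem_Lt lifts[THEN zeta_fixed]))

lemma outer_commutes:
  "ga \<cdot> gc = gc \<cdot> ga" "ga \<cdot> gd = gd \<cdot> ga" "gb \<cdot> gc = gc \<cdot> gb" "gb \<cdot> gd = gd \<cdot> gb"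
  by ((rule commute[OF facts_a facts_c]; simp),
      (rule commute[OF facts_a facts_d]; simp),
      (rule commute[OF facts_b facts_c]; simp add: mult_ac),
      (rule commute[OF facts_b facts_d]; simp))

lemma x_commutes:
  "gx \<cdot> ga = ga \<cdot> gx" "gx \<cdot> gb = gb \<cdot> gx" "gx \<cdot> gc = gc \<cdot> gx"
  "gx \<cdot> gd = gd \<cdot> gx" "gx \<cdot> gy = gy \<cdot> gx"
  by ((rule commute[OF facts_x facts_a]; simp),
      (rule commute[OF facts_x facts_b]; simp),
      (rule commute[OF facts_x facts_c]; simp),
      (rule commute[OF facts_x facts_d]; simp),
      (rule commute[OF facts_x facts_y]; simp))

lemma y_commutes:
  "gy \<cdot> ga = ga \<cdot> gy" "gy \<cdot> gb = gb \<cdot> gy" "gy \<cdot> gc = gc \<cdot> gy"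
  "gy \<cdot> gd = gd \<cdot> gy"
  by ((rule commute[OF facts_y facts_a]; simp),
      (rule commute[OF facts_y facts_b]; simp),
      (rule commute[OF facts_y facts_c]; simp),
      (rule commute[OF facts_y facts_d]; simp))

end

lemma orbit_product_fixed: "g u = u \<Longrightarrow> (\<Prod>i<p. (g ^^ i) u) = u ^ p"
proof -
  assume "g u = u"
  then have "(g ^^ i) u = u" for i by (induction i) auto
  then show ?thesis by simp
qed

text \<open>The orbit products of \<open>ra / (f1 f2)\<close>, \<open>rd / (f3 f4)\<close>, \<open>1 / (ry f3)\<close> and \<open>1 / (rx f2)\<close> are quotients of the
  prescribed norms: \<open>a / (a x x\<^bsup>-1\<^esup>)\<close>, \<open>d / (y\<^bsup>-1\<^esup> y d)\<close>, \<open>1 / (y y\<^bsup>-1\<^esup>)\<close> and \<open>1 / (x x\<^bsup>-1\<^esup>)\<close>.\<close>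

lemma lifts_order_p:
  "ga \<up> p = \<one>\<^bsub>G\<^esub>" "gb \<up> p = \<one>\<^bsub>G\<^esub>" "gc \<up> p = \<one>\<^bsub>G\<^esub>" "gd \<up> p = \<one>\<^bsub>G\<^esub>"
  "\<tau> \<up> p = \<one>\<^bsub>G\<^esub>" "gx \<up> p = \<one>\<^bsub>G\<^esub>" "gy \<up> p = \<one>\<^bsub>G\<^esub>"
proof -
  note nb = norm_as_orbit_product[OF Lt_over_M lifts(2) lift_acts(2)]
    and nc = norm_as_orbit_product[OF Lt_over_M lifts(3) lift_acts(3)]
    and nx = norm_as_orbit_product[OF Lt_over_M lifts(5) lift_acts(5)]
    and ny = norm_as_orbit_product[OF Lt_over_M lifts(6) lift_acts(6)]
  note nz = radical_nonzero and quot = orbit_product_quotient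
  show "ga \<up> p = \<one>\<^bsub>G\<^esub>"
    by (rule order_p[OF facts_a]) (simp_all add: multipliers_mem lift_values orbit_product_fixed)
  show "gd \<up> p = \<one>\<^bsub>G\<^esub>"
    by (rule order_p[OF facts_d]) (simp_all add: multipliers_mem lift_values orbit_product_fixed)
  show "\<tau> \<up> p = \<one>\<^bsub>G\<^esub>"
    by (rule order_p[OF facts_tau])
       (simp_all add: zeta_mem_Lt orbit_product_fixed zeta_fixed[OF lifts(7)] zeta_pow_p)
  show "gb \<up> p = \<one>\<^bsub>G\<^esub>"
    by (rule order_p[OF facts_b])
       (simp_all add: multipliers_mem quot[OF lifts(2)] mem_Lt orbit_product_fixed lift_radicals nb unit_exp_def nz)
  show "gc \<up> p = \<one>\<^bsub>G\<^esub>"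
    by (rule order_p[OF facts_c])
       (simp_all add: multipliers_mem quot[OF lifts(3)] mem_Lt orbit_product_fixed lift_radicals nc unit_exp_def nz)
  show "gx \<up> p = \<one>\<^bsub>G\<^esub>"
    by (rule order_p[OF facts_x])
       (simp_all add: multipliers_mem quot[OF lifts(5)] mem_Lt Lt_closed(2) orbit_product_fixed
          lift_radicals one_fixed[OF lifts(5)] nx unit_exp_def nz)
  show "gy \<up> p = \<one>\<^bsub>G\<^esub>"
    by (rule order_p[OF facts_y])
       (simp_all add: multipliers_mem quot[OF lifts(6)] mem_Lt Lt_closed(2) orbit_product_fixed
          lift_radicals one_fixed[OF lifts(6)] ny unit_exp_def nz)
qed

definition word :: "nat \<Rightarrow> nat \<Rightarrow> nat \<Rightarrow> nat \<Rightarrow> nat \<Rightarrow> nat \<Rightarrow> nat \<Rightarrow> 'a \<Rightarrow> 'a" where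
  "word a b c d t u v = gb \<up> b \<cdot> ga \<up> a \<cdot> (gd \<up> d \<cdot> gc \<up> c) \<cdot>
     \<tau> \<up> t \<cdot> (gx \<up> u \<cdot> gy \<up> v)"

lemma word_closed: "word a b c d t u v \<in> carrier G"
  using lifts by (simp add: word_def)

lemma acts_word: "acts (word a b c d t u v) (\<lambda>i. [a, b, c, d, u, v] ! i)"
proof -
  note pow = acts_pow[OF Lt_over_M] and mult = acts_mult[OF Lt_over_M]
  have "acts (word a b c d t u v) (\<lambda>i. b * unit_exp 1 i + a * unit_exp 0 i + (d * unit_exp 3 i + c * unit_exp 2 i) +
      t * 0 + (u * unit_exp 4 i + v * unit_exp 5 i))"
    unfolding word_def
    by (intro mult pow lift_acts lifts G.m_closed G.nat_pow_closed)
  then show ?thesis by (simp add: acts_iff unit_exp_def)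
qed

text \<open>The exponents of the lifts are those by which \<open>g\<close> acts on the radicals. The resulting word \<open>h\<close> agrees with \<open>g\<close>
  on \<open>M\<close>, so \<open>g z\<close> and \<open>h z\<close> have the same \<open>p\<close>-th power, and a power of \<open>\<tau>\<close> corrects the difference.\<close>

lemma word_exists:
  assumes g: "g \<in> carrier G" shows "\<exists>a b c d t u v. g = word a b c d t u v"
proof -
  obtain e where e: "acts g e" using acts_exists[OF Lt_over_M g] by blast
  define h where "h = word (e 0) (e 1) (e 2) (e 3) 0 (e 4) (e 5)"
  have h: "h \<in> carrier G" "acts h (\<lambda>i. [e 0, e 1, e 2, e 3, e 4, e 5] ! i)"
    unfolding h_def by (rule word_closed, rule acts_word)
  have "acts h e" using h(2) by (simp add: acts_iff)
  then have agree: "g u = h u" if "u \<in> M" for u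
    using agree_on_M[OF Lt_over_M g e h(1) _ _ that] by blast
  have "g z ^ p = h z ^ p"
    using agree[OF z_power_mem] galois_groupD(10)[OF Lt_subfield g z_mem, of p]
      galois_groupD(10)[OF Lt_subfield h(1) z_mem, of p] by simp
  then obtain t where t: "g z = \<zeta> ^ t * h z" using pth_roots_differ_by_zeta by blast
  have \<tau>t: "\<tau> \<up> t \<in> carrier G" using lifts by simp
  have zt: "\<zeta> ^ t \<in> Lt" by (rule zeta_power_mem_K[OF Lt_over_M])
  have "g = h \<cdot> \<tau> \<up> t"
  proof (rule G_eqI_acts[OF g e G.m_closed[OF h(1) \<tau>t] acts_mult[OF Lt_over_M h(1) \<open>acts h e\<close> \<tau>t
          acts_pow[OF Lt_over_M lifts(7) lift_acts(7)]]])
    show "g z = (h \<cdot> \<tau> \<up> t) z"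
      using h(1) \<tau>t z_mem zt
      by (simp add: tau_pow_z[OF facts_tau] t galois_groupD(3)[OF Lt_subfield h(1)]
          zeta_power_fixed[OF Lt_over_M h(1)])
  qed simp
  also have "gx \<up> e 4 \<cdot> gy \<up> e 5 \<cdot> \<tau> \<up> t = \<tau> \<up> t \<cdot> (gx \<up> e 4 \<cdot> gy \<up> e 5)"
    using G.nat_pow_commute[OF lifts(5,7) tau_commutes(5), of "e 4" t]
      G.nat_pow_commute[OF lifts(6,7) tau_commutes(6), of "e 5" t] lifts
    by (metis G.m_assoc G.nat_pow_closed)
  then have "h \<cdot> \<tau> \<up> t = word (e 0) (e 1) (e 2) (e 3) t (e 4) (e 5)"
    unfolding h_def word_def using lifts by (simp add: G.m_assoc)
  finally show ?thesis by blast
qed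

text \<open>The action on the radicals shows that the exponents of the lifts are divisible by \<open>p\<close>; what remains is a
  power of \<open>\<tau>\<close>, which is detected by \<open>z\<close>.\<close>

lemma word_trivial:
  assumes one: "word a b c d t u v = \<one>\<^bsub>G\<^esub>"
  shows "p dvd a \<and> p dvd b \<and> p dvd c \<and> p dvd d \<and> p dvd t \<and> p dvd u \<and> p dvd v"
proof -
  have fixed: "word a b c d t u v r = r" if "r \<in> Lt" for r using that by (simp add: one)
  have dvd: "p dvd a" "p dvd b" "p dvd c" "p dvd d" "p dvd u" "p dvd v"
    using acts_word[of a b c d t u v] fixed mem_Lt radical_nonzero by (simp_all add: acts_iff zeta_pow_eq_1_iff)
  have trivial: "g \<up> n = \<one>\<^bsub>G\<^esub>" if "g \<in> carrier G" "g \<up> p = \<one>\<^bsub>G\<^esub>" "p dvd n" for g n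
    using G.nat_pow_mod[OF that(1,2), of n] that(3) by simp
  have "word a b c d t u v = \<tau> \<up> t"
    unfolding word_def using lifts lifts_order_p dvd by (simp add: trivial)
  then have "\<zeta> ^ t * z = z" using tau_pow_z[OF facts_tau, of t] fixed[OF z_mem] by simp
  then show ?thesis using dvd z_nonzero by (simp add: zeta_pow_eq_1_iff)
qed

lemma aux_commutes:
  "h \<in> {ga, gb, gc, gd, \<tau>, gy} \<Longrightarrow> gx \<cdot> h = h \<cdot> gx"
  "h \<in> {ga, gb, gc, gd, \<tau>} \<Longrightarrow> gy \<cdot> h = h \<cdot> gy"
  using x_commutes y_commutes tau_commutes by auto

lemma central_product_structure:
  "\<exists>\<phi>\<in>iso G (heisenberg_central_product p \<times>\<times> elementary_abelian p 2). \<phi> ` generate G {gx, gy} =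
     {\<one>\<^bsub>heisenberg_central_product p\<^esub>} \<times> carrier (elementary_abelian p 2)"
  "G\<lparr>carrier := generate G {gx, gy}\<rparr> \<cong> elementary_abelian p 2" "group (heisenberg_central_product p)"
proof -
  note r = G.recognise_central_product[OF p_gt_1 lifts(1-4) lifts(7) lifts(5,6) lifts_order_p relation_ab
      relation_dc tau_commutes(1-4) outer_commutes aux_commutes word_exists[unfolded word_def]
      word_trivial[unfolded word_def]]
  show "\<exists>\<phi>\<in>iso G (heisenberg_central_product p \<times>\<times> elementary_abelian p 2). \<phi> ` generate G {gx, gy} =
     {\<one>\<^bsub>heisenberg_central_product p\<^esub>} \<times> carrier (elementary_abelian p 2)" by (rule r(1))
  show "G\<lparr>carrier := generate G {gx, gy}\<rparr> \<cong> elementary_abelian p 2" by (rule r(2))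
  show "group (heisenberg_central_product p)" by (rule r(3))
qed

lemma x_y_central:
  assumes g: "g \<in> carrier G"
  shows "gx \<cdot> g = g \<cdot> gx" "gy \<cdot> g = g \<cdot> gy"
proof -
  have mult: "k \<cdot> (h1 \<cdot> h2) = h1 \<cdot> h2 \<cdot> k"
    if "k \<in> carrier G" "h1 \<in> carrier G" "h2 \<in> carrier G" "k \<cdot> h1 = h1 \<cdot> k" "k \<cdot> h2 = h2 \<cdot> k" for k h1 h2
    using that by (metis G.m_assoc)
  have pow: "k \<cdot> h \<up> (n::nat) = h \<up> n \<cdot> k"
    if "k \<in> carrier G" "h \<in> carrier G" "k \<cdot> h = h \<cdot> k" for k h n
    using G.group_commutes_pow[of h k n] that by simp
  obtain a b c d t u v where w: "g = word a b c d t u v" using word_exists[OF g] by blast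
  show "gx \<cdot> g = g \<cdot> gx"
    unfolding w word_def
    by (intro mult pow G.m_closed G.nat_pow_closed lifts x_commutes tau_commutes refl)
  show "gy \<cdot> g = g \<cdot> gy"
    unfolding w word_def
    by (intro mult pow G.m_closed G.nat_pow_closed lifts y_commutes tau_commutes x_commutes(5)[symmetric] refl)
qed

abbreviation L :: "'a set" where "L \<equiv> fixed_field Lt (generate G {gx, gy})"

lemma fixed_field_structure:
  "finite_galois L F" "group_hom G (galois_group L F) (\<lambda>g. restrict g L)"
  "(\<lambda>g. restrict g L) ` carrier G = Gal L F"
  "kernel G (galois_group L F) (\<lambda>g. restrict g L) = generate G {gx, gy}"
proof -
  note r = fixed_field_of_central_pair[OF char Lt_galois lifts(5,6) x_y_central lifts_order_p(6,7)
    mem_Lt(5) radical_nonzero(5) radical_power_mem(5) lift_radicals(29) lift_radicals(35)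
    mem_Lt(6) radical_nonzero(6) radical_power_mem(6) lift_radicals(36) lift_radicals(30)]
  show "finite_galois L F" by (rule r(1))
  show "group_hom G (galois_group L F) (\<lambda>g. restrict g L)" by (rule r(2))
  show "(\<lambda>g. restrict g L) ` carrier G = Gal L F" by (rule r(3))
  show "kernel G (galois_group L F) (\<lambda>g. restrict g L) = generate G {gx, gy}" by (rule r(4))
qed

text \<open>Restriction to \<open>L\<close> and projection to the central product are both onto and have the same kernel, the
  subgroup generated by \<open>gx\<close> and \<open>gy\<close>.\<close>

lemma fixed_field_group: "galois_group L F \<cong> heisenberg_central_product p"
proof -
  let ?HC = "heisenberg_central_product p" and ?EA = "elementary_abelian p 2"
  obtain \<phi> where \<phi>: "\<phi> \<in> iso G (?HC \<times>\<times> ?EA)"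
      and im: "\<phi> ` generate G {gx, gy} = {\<one>\<^bsub>?HC\<^esub>} \<times> carrier ?EA"
    using central_product_structure(1) by blast
  have bij: "bij_betw \<phi> (carrier G) (carrier ?HC \<times> carrier ?EA)" and hom: "\<phi> \<in> hom G (?HC \<times>\<times> ?EA)"
    using \<phi> by (auto simp: iso_def)
  have one: "\<one>\<^bsub>?EA\<^esub> \<in> carrier ?EA"
    by (simp add: elementary_abelian_def group.is_monoid monoid.one_closed)
  have "(fst \<circ> \<phi>) \<in> hom G ?HC" using hom by (simp add: hom_pairwise)
  then have hom1: "group_hom G ?HC (fst \<circ> \<phi>)"
    using central_product_structure(3) by (simp add: group_hom_def group_hom_axioms_def G.is_group)
  have image: "(fst \<circ> \<phi>) ` carrier G = carrier ?HC"
  proof -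
    have "(fst \<circ> \<phi>) ` carrier G = fst ` (\<phi> ` carrier G)" by (simp add: image_comp)
    also have "\<dots> = fst ` (carrier ?HC \<times> carrier ?EA)" using bij by (simp add: bij_betw_def)
    also have "\<dots> = carrier ?HC" using one by (auto simp: fst_image_times)
    finally show ?thesis .
  qed
  have "kernel G ?HC (fst \<circ> \<phi>) = generate G {gx, gy}"
  proof
    have sub: "generate G {gx, gy} \<subseteq> carrier G" using lifts by (intro G.generate_incl) auto
    show "generate G {gx, gy} \<subseteq> kernel G ?HC (fst \<circ> \<phi>)"
    proof
      fix g assume g: "g \<in> generate G {gx, gy}"
      then have "\<phi> g \<in> {\<one>\<^bsub>?HC\<^esub>} \<times> carrier ?EA" unfolding im[symmetric] by (rule imageI)
      then show "g \<in> kernel G ?HC (fst \<circ> \<phi>)" using g sub by (auto simp: kernel_def mem_Times_iff)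
    qed
    show "kernel G ?HC (fst \<circ> \<phi>) \<subseteq> generate G {gx, gy}"
    proof
      fix g assume "g \<in> kernel G ?HC (fst \<circ> \<phi>)"
      then have g: "g \<in> carrier G" "fst (\<phi> g) = \<one>\<^bsub>?HC\<^esub>" by (auto simp: kernel_def)
      have "\<phi> g \<in> carrier ?HC \<times> carrier ?EA" using bij g(1) by (auto simp: bij_betw_def)
      then have "\<phi> g \<in> \<phi> ` generate G {gx, gy}" unfolding im using g(2) by (auto simp: mem_Times_iff)
      then obtain h where h: "h \<in> generate G {gx, gy}" "\<phi> g = \<phi> h" by blast
      then have "g = h" using bij g(1) sub by (auto simp: bij_betw_def dest: inj_onD)
      then show "g \<in> generate G {gx, gy}" using h(1) by simp
    qed
  qed
  then show ?thesis
    using isomorphic_of_equal_kernels[OF fixed_field_structure(2) hom1 fixed_field_structure(3) image]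
      fixed_field_structure(4) by simp
qed

lemma radicals_in_fixed_field: "adjoin F {ra, rb, rc, rd} \<subseteq> L"
proof (rule adjoin_least)
  show "subfield_of_type L" "F \<subseteq> L" using fixed_field_structure(1) by (auto simp: finite_galois_def)
  show "{ra, rb, rc, rd} \<subseteq> L"
    using fixed_field_generate[OF Lt_subfield F_subset_Lt, of "{gx, gy}"] lifts mem_Lt lift_radicals
    by (simp add: fixed_field_def)
qed

lemma lift_x_iff:
  "g \<in> carrier G \<and> radical_aut M F \<zeta> rx {ra, rb, rc, rd, ry} (restrict g M) \<and> g z = 1 / (ry * f3) * z \<longleftrightarrow>
    g = gx"
  using radical_aut_x_iff lifts(5) lift_acts(5) lift_z(5) G_eqI_acts[of g _ gx, OF _ _ lifts(5) lift_acts(5)]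
  by auto

lemma lift_y_iff:
  "g \<in> carrier G \<and> radical_aut M F \<zeta> ry {ra, rb, rc, rd, rx} (restrict g M) \<and> g z = 1 / (rx * f2) * z \<longleftrightarrow>
    g = gy"
  using radical_aut_y_iff lifts(6) lift_acts(6) lift_z(6) G_eqI_acts[of g _ gy, OF _ _ lifts(6) lift_acts(6)]
  by auto

end

section \<open>The theorem\<close>

theorem theorem3p7:
  fixes F K M :: "'a::alg_closed_field set" and p :: nat
    and \<zeta> a b c d x y ra rb rc rd rx ry f1 f2 f3 f4 w :: 'a
  assumes "global_field F"
    and "Factorial_Ring.prime p" and "odd p" and "p \<noteq> CHAR('a)"
    and "{\<mu>::'a. \<mu> ^ p = 1} \<subseteq> F"
    and "\<zeta> \<in> F" and "primitive_root_of_unity p \<zeta>"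
    and "a \<in> F - {0}" and "b \<in> F - {0}" and "c \<in> F - {0}" and "d \<in> F - {0}"
    and "x \<in> F - {0}" and "y \<in> F - {0}"
    and "ra ^ p = a" and "rb ^ p = b" and "rc ^ p = c" and "rd ^ p = d"
    and "rx ^ p = x" and "ry ^ p = y"
    and K: "K = adjoin F {ra, rb, rc, rd}"
    and "finite_galois K F" and "galois_group K F \<cong> elementary_abelian p 4"
    and "symbol_class F \<zeta> p a b = symbol_class F \<zeta> p c d"
    and "symbol_class F \<zeta> p a b = symbol_class F \<zeta> p (inverse x) b"
    and "symbol_class F \<zeta> p (inverse x) b = symbol_class F \<zeta> p x y"
    and "symbol_class F \<zeta> p x y = symbol_class F \<zeta> p (inverse c) y"
    and "symbol_class F \<zeta> p (inverse c) y = symbol_class F \<zeta> p c d"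
    and "f1 \<in> adjoin F {rb} - {0}" and "f2 \<in> adjoin F {rb * ry} - {0}"
    and "f3 \<in> adjoin F {rx * rc} - {0}" and "f4 \<in> adjoin F {rc} - {0}"
    and "field_norm (adjoin F {rb}) F f1 = a * x"
    and "field_norm (adjoin F {rb * ry}) F f2 = inverse x"
    and "field_norm (adjoin F {rx * rc}) F f3 = inverse y"
    and "field_norm (adjoin F {rc}) F f4 = y * d"
    and "independent_mod_powers p F [a, b, c, d, x, y]"
    and M: "M = adjoin F {ra, rb, rc, rd, rx, ry}"
    and w: "w = W_elem F \<zeta> p rb f1 * W_elem F \<zeta> p (rb * ry) f2 *
                W_elem F \<zeta> p (rx * rc) f3 * W_elem F \<zeta> p rc f4"
  shows "(\<exists>r\<in>F - {0}. r * w \<notin> power_units p M) \<and>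
    (\<forall>r\<in>F - {0}. r * w \<notin> power_units p M \<longrightarrow>
      (\<forall>z. z ^ p = r * w \<longrightarrow>
        (let Lt = adjoin M {z};
             G = galois_group Lt F;
             lift_x = (\<lambda>s. s \<in> carrier G \<and>
               radical_aut M F \<zeta> rx {ra, rb, rc, rd, ry} (restrict s M) \<and>
               s z = 1 / (ry * f3) * z);
             lift_y = (\<lambda>s. s \<in> carrier G \<and>
               radical_aut M F \<zeta> ry {ra, rb, rc, rd, rx} (restrict s M) \<and>
               s z = 1 / (rx * f2) * z)
         in finite_galois Lt F \<and>
            G \<cong> heisenberg_central_product p \<times>\<times> elementary_abelian p 2 \<and>
            (\<exists>!s. lift_x s) \<and> (\<exists>!s. lift_y s) \<and>
            (\<forall>sx sy. lift_x sx \<longrightarrow> lift_y sy \<longrightarrow>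
              (let A = generate G {sx, sy}; L = fixed_field Lt A
               in G\<lparr>carrier := A\<rparr> \<cong> elementary_abelian p 2 \<and>
                  (\<exists>\<phi> \<in> iso G (heisenberg_central_product p \<times>\<times> elementary_abelian p 2).
                     \<phi> ` A = {\<one>\<^bsub>heisenberg_central_product p\<^esub>} \<times>
                             carrier (elementary_abelian p 2)) \<and>
                  K \<subseteq> L \<and> finite_galois L F \<and>
                  galois_group L F \<cong> heisenberg_central_product p)))))"
proof -
  have CHAR_ne_1: "CHAR('a) \<noteq> 1" by (metis of_nat_1 of_nat_CHAR one_neq_zero)
  have "\<not> CHAR('a) dvd p" using assms(2,4) CHAR_ne_1 prime_nat_iff by metis
  then have char: "of_nat p \<noteq> (0 :: 'a)" by (simp add: of_nat_eq_0_iff_char_dvd)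
  have F: "subfield_of_type F"
    using assms(1) by (auto simp: global_field_def number_field_def global_function_field_def)
  have p0: "p > 0" using prime_gt_0_nat[OF assms(2)] .
  have radicals: "t ^ p \<in> F \<and> t \<noteq> 0" if "t \<in> {ra, rb, rc, rd, rx, ry}" for t
    using that assms(8-19) p0 by (auto simp: power_0_left)
  interpret R: six_radicals p \<zeta> F ra rb rc rd rx ry f1 f2 f3 f4
  proof (intro six_radicals.intro kummer_base.intro six_radicals_axioms.intro)
    show "independent_mod_powers p F (map (\<lambda>r. r ^ p) [ra, rb, rc, rd, rx, ry])"
      using assms(14-19) \<open>independent_mod_powers p F [a, b, c, d, x, y]\<close> by simp
    show "field_norm (adjoin F {rb}) F f1 = ra ^ p * rx ^ p"
      "field_norm (adjoin F {rb * ry}) F f2 = inverse (rx ^ p)"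
      "field_norm (adjoin F {rx * rc}) F f3 = inverse (ry ^ p)"
      "field_norm (adjoin F {rc}) F f4 = ry ^ p * rd ^ p"
      by (simp_all only: assms(14-19) assms(32-35))
  qed (use assms(2,5,7) F radicals assms(28-31) in auto)
  have M_eq: "M = R.M" by (simp add: M R.M_def R.set_rs)
  have w_eq: "w = R.w" by (simp add: w R.w_def)
  show ?thesis
  proof (intro conjI ballI impI allI, goal_cases)
    case 1
    show ?case
      using R.w_not_power[of 1] R.base_closed(2) unfolding M_eq w_eq by (intro bexI[of _ 1]) auto
  next
    case (2 r z)
    then have r: "r \<in> F - {0}" and z: "z ^ p = r * w" by auto
    interpret R: six_radicals_root p \<zeta> F ra rb rc rd rx ry f1 f2 f3 f4 r z
      using r z unfolding w_eq by (intro six_radicals_root.intro R.six_radicals_axioms six_radicals_root_axioms.intro)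
    have Lt_eq: "adjoin R.M {z} = R.Lt" by (simp add: R.Lt_def)
    have lift: "\<exists>g. g \<in> carrier R.G \<and> R.acts g (R.unit_exp j) \<and> g z = R.multiplier j * z" if "j < 6" for j
      using R.lift_exists[OF that] by blast
    obtain ga where ga: "ga \<in> carrier R.G" "R.acts ga (R.unit_exp 0)" "ga z = R.multiplier 0 * z" using lift[of 0] by auto
    obtain gb where gb: "gb \<in> carrier R.G" "R.acts gb (R.unit_exp 1)" "gb z = R.multiplier 1 * z" using lift[of 1] by auto
    obtain gc where gc: "gc \<in> carrier R.G" "R.acts gc (R.unit_exp 2)" "gc z = R.multiplier 2 * z" using lift[of 2] by auto
    obtain gd where gd: "gd \<in> carrier R.G" "R.acts gd (R.unit_exp 3)" "gd z = R.multiplier 3 * z" using lift[of 3] by auto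
    obtain gx where gx: "gx \<in> carrier R.G" "R.acts gx (R.unit_exp 4)" "gx z = R.multiplier 4 * z" using lift[of 4] by auto
    obtain gy where gy: "gy \<in> carrier R.G" "R.acts gy (R.unit_exp 5)" "gy z = R.multiplier 5 * z" using lift[of 5] by auto
    obtain \<tau> where \<tau>: "\<tau> \<in> carrier R.G" "R.acts \<tau> (\<lambda>_. 0)" "\<tau> z = \<zeta> * z" using R.central_generator_exists by auto
    interpret R: six_radicals_lifts p \<zeta> F ra rb rc rd rx ry f1 f2 f3 f4 r z ga gb gc gd gx gy \<tau>
      by (intro six_radicals_lifts.intro R.six_radicals_root_axioms six_radicals_lifts_axioms.intro)
         (use ga gb gc gd gx gy \<tau> char in \<open>simp_all only: R.multiplier_simps simp_thms\<close>)
    have iso: "R.G \<cong> heisenberg_central_product p \<times>\<times> elementary_abelian p 2"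
      using R.central_product_structure(1) by (auto simp: is_iso_def)
    show ?case
      unfolding Let_def M_eq Lt_eq R.lift_x_iff R.lift_y_iff K
      using R.Lt_galois iso R.central_product_structure R.radicals_in_fixed_field
        R.fixed_field_structure(1) R.fixed_field_group
      by blast
  qed
qed

end
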